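(* Let $G$ be a compact Lie group and $H$ a closed subgroup with inclusion $\iota\colon H\to G$, and let $\mathsf{Sp}$ denote either orthogonal spectra or unitary spectra. The adjoint pair $$G_+\wedge_H-\colon\mathsf{Sp}[H]\rightleftarrows\mathsf{Sp}[G]\colon\iota^*$$ is a Quillen adjunction (with respect to the stable model structures).
   Context: Let $\mathbb{F}=\mathbb{R}$ (orthogonal spectra) or $\mathbb{F}=\mathbb{C}$ (unitary spectra). $\mathsf{Top}_*$: based compactly generated weak Hausdorff spaces. $\mathcal{J}_1$ is the $\mathsf{Top}_*$-enriched category whose objects are finite-dimensional $\mathbb{F}$-inner product subspaces of $\mathbb{F}^\infty$ and whose morphism space $\mathcal{J}_1(U,V)$ is the Thom space of the vector bundle $\{(f,x): f\colon U\to V \text{ an }\mathbb{F}\text{-linear isometry},\ x\in f(U)^\perp\}$ over the space of linear isometries, with composition $(g,y)\circ(f,x)=(gf,y+gx)$. $\mathsf{Sp}$ is the category of $\mathsf{Top}_*$-enriched functors $\mathcal{J}_1\to\mathsf{Top}_*$. For a compact Lie group $G$, $\mathsf{Sp}[G]$ (naïve $G$-spectra) is the category of $G$-objects in $\mathsf{Sp}$ (objects $X$ with a continuous homomorphism $G\to\mathrm{Aut}(X)$) and $G$-equivariant maps. Stable model structure on $\mathsf{Sp}[G]$: weak equivalences are $\pi_*$-isomorphisms, where $\pi_k(\Theta)=\operatorname{colim}_q\pi_{k+q}(\Theta(\mathbb{R}^q))$ for orthogonal spectra and $\pi_k(\Theta)=\operatorname{colim}_q\pi_{k+2q}(\Theta(\mathbb{C}^q))$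 for unitary spectra; fibrations are the levelwise Serre fibrations $\Theta\to\Psi$ for which the square formed by $\Theta(V)\to\Omega^W\Theta(V\oplus W)$ and $\Psi(V)\to\Omega^W\Psi(V\oplus W)$ is a homotopy pullback for all $V,W$. All levelwise notions refer to underlying spaces, independently of the group action. $\iota^*$ restricts the $G$-action to an $H$-action along $\iota$; its left adjoint is $(G_+\wedge_H\Theta)(V)=G_+\wedge_H\Theta(V)$. *)

theory Defs
  imports "HOL-Analysis.Analysis" "HOL-Algebra.Group"
begin

section \<open>Compactly generated weak Hausdorff spaces\<close>

text \<open>
  Compact generation and weak Hausdorffness quantify over all compact Hausdorff test spaces
  \<open>K\<close>, which HOL cannot do inside a formula; here the points of \<open>K\<close> are taken from
  \<open>'a set set\<close>. For weak Hausdorffness nothing is lost: if \<open>v\<close> maps a compact Hausdorff space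
  into \<open>X\<close>, choose \<open>S\<close> with one point in each nonempty fibre; its closure has the same image and
  at most as many points as \<open>'a set set\<close>, a point of the closure being determined by the traces
  on \<open>S\<close> of its neighbourhoods. In a weak Hausdorff space, compact generation and
  k-ification are already detected by the compact Hausdorff subspaces.
\<close>

definition kify :: "'a topology \<Rightarrow> 'a topology" where
  "kify X = topology (\<lambda>U. U \<subseteq> topspace X \<and>
     (\<forall>(K::'a set set topology) v.
        compact_space K \<and> Hausdorff_space K \<and> continuous_map K X v
        \<longrightarrow> openin K {k \<in> topspace K. v k \<in> U}))"

definition weak_Hausdorff :: "'a topology \<Rightarrow> bool" where
  "weak_Hausdorff X \<longleftrightarrow>
     (\<forall>(K::'a set set topology) v.
        compact_space K \<and> Hausdorff_space K \<and> continuous_map K X v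
        \<longrightarrow> closedin X (v ` topspace K))"

definition cgwh :: "'a topology \<Rightarrow> bool" where
  "cgwh X \<longleftrightarrow> kify X = X \<and> weak_Hausdorff X"

definition kprod :: "'a topology \<Rightarrow> 'b topology \<Rightarrow> ('a \<times> 'b) topology" where
  "kprod X Y = kify (prod_topology X Y)"

definition quot_topology :: "'a topology \<Rightarrow> ('a \<Rightarrow> 'b) \<Rightarrow> 'b topology" where
  "quot_topology X q = topology (\<lambda>U. U \<subseteq> q ` topspace X \<and> openin X {x \<in> topspace X. q x \<in> U})"

definition cont_maps :: "'a topology \<Rightarrow> 'b topology \<Rightarrow> ('a \<Rightarrow> 'b) set" where
  "cont_maps X Y = {f \<in> extensional (topspace X). continuous_map X Y f}"

definition compact_open :: "'a topology \<Rightarrow> 'b topology \<Rightarrow> ('a \<Rightarrow> 'b) topology" where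
  "compact_open X Y = topology_generated_by
     {{f \<in> cont_maps X Y. f ` K \<subseteq> U} | K U.
        compactin X K \<and> Hausdorff_space (subtopology X K) \<and> openin Y U}"

definition map_space :: "'a topology \<Rightarrow> 'b topology \<Rightarrow> ('a \<Rightarrow> 'b) topology" where
  "map_space X Y = kify (compact_open X Y)"

definition based_map_space ::
    "'a topology \<Rightarrow> 'a \<Rightarrow> 'b topology \<Rightarrow> 'b \<Rightarrow> ('a \<Rightarrow> 'b) topology" where
  "based_map_space X x Y y = kify (subtopology (compact_open X Y) {f. f x = y})"

section \<open>Homotopy groups, fibrations and homotopy pullbacks of spaces\<close>

definition sphere_space :: "nat \<Rightarrow> (nat \<Rightarrow> real) option topology" where
  "sphere_space n = Alexandroff_compactification (Euclidean_space n)"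

definition based_sphere_maps ::
    "nat \<Rightarrow> 'a topology \<Rightarrow> 'a \<Rightarrow> ((nat \<Rightarrow> real) option \<Rightarrow> 'a) set" where
  "based_sphere_maps n X x = {f. continuous_map (sphere_space n) X f \<and> f None = x}"

definition pi_class ::
    "nat \<Rightarrow> 'a topology \<Rightarrow> 'a \<Rightarrow> ((nat \<Rightarrow> real) option \<Rightarrow> 'a) \<Rightarrow> ((nat \<Rightarrow> real) option \<Rightarrow> 'a) set" where
  "pi_class n X x f = {g. homotopic_with (\<lambda>h. h None = x) (sphere_space n) X f g}"

definition pi_set :: "nat \<Rightarrow> 'a topology \<Rightarrow> 'a \<Rightarrow> ((nat \<Rightarrow> real) option \<Rightarrow> 'a) set set" where
  "pi_set n X x = pi_class n X x ` based_sphere_maps n X x"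

text \<open>
  The map on homotopy classes induced by an operation \<open>\<phi>\<close> on based maps that respects based
  homotopy, with values in \<open>pi_set m Y y\<close>.
\<close>

definition pi_lift ::
    "nat \<Rightarrow> 'b topology \<Rightarrow> 'b
     \<Rightarrow> (((nat \<Rightarrow> real) option \<Rightarrow> 'a) \<Rightarrow> ((nat \<Rightarrow> real) option \<Rightarrow> 'b))
     \<Rightarrow> ((nat \<Rightarrow> real) option \<Rightarrow> 'a) set \<Rightarrow> ((nat \<Rightarrow> real) option \<Rightarrow> 'b) set" where
  "pi_lift m Y y \<phi> c = \<Union> ((\<lambda>f. pi_class m Y y (\<phi> f)) ` c)"

definition weak_equivalence :: "'a topology \<Rightarrow> 'b topology \<Rightarrow> ('a \<Rightarrow> 'b) \<Rightarrow> bool" where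
  "weak_equivalence X Y f \<longleftrightarrow> continuous_map X Y f \<and>
     (topspace X = {} \<longrightarrow> topspace Y = {}) \<and>
     (\<forall>x \<in> topspace X. \<forall>n.
        bij_betw (pi_lift n Y (f x) (\<lambda>s. f \<circ> s)) (pi_set n X x) (pi_set n Y (f x)))"

definition unit_cube :: "nat \<Rightarrow> (nat \<Rightarrow> real) topology" where
  "unit_cube n = subtopology (Euclidean_space n) {x. \<forall>i<n. 0 \<le> x i \<and> x i \<le> 1}"

abbreviation unit_interval :: "real topology" where
  "unit_interval \<equiv> top_of_set {0..1}"

definition serre_fibration :: "'a topology \<Rightarrow> 'b topology \<Rightarrow> ('a \<Rightarrow> 'b) \<Rightarrow> bool" where
  "serre_fibration X Y p \<longleftrightarrow> continuous_map X Y p \<and>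
     (\<forall>n f h. continuous_map (unit_cube n) X f \<and>
        continuous_map (prod_topology (unit_cube n) unit_interval) Y h \<and>
        (\<forall>a \<in> topspace (unit_cube n). h (a, 0) = p (f a)) \<longrightarrow>
        (\<exists>k. continuous_map (prod_topology (unit_cube n) unit_interval) X k \<and>
           (\<forall>a \<in> topspace (unit_cube n). k (a, 0) = f a) \<and>
           (\<forall>a \<in> topspace (unit_cube n). \<forall>t \<in> {0..1}. p (k (a, t)) = h (a, t))))"

definition homotopy_pullback_space ::
    "'b topology \<Rightarrow> 'c topology \<Rightarrow> 'd topology \<Rightarrow> ('b \<Rightarrow> 'd) \<Rightarrow> ('c \<Rightarrow> 'd)
     \<Rightarrow> ('c \<times> (real \<Rightarrow> 'd) \<times> 'b) topology" where
  "homotopy_pullback_space B C D g f =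
     kify (subtopology (prod_topology C (prod_topology (map_space unit_interval D) B))
       {(c, \<gamma>, b). \<gamma> 0 = f c \<and> \<gamma> 1 = g b})"

text \<open>
  The strictly commutative square with \<open>u : A \<rightarrow> B\<close>, \<open>p : A \<rightarrow> C\<close>, \<open>g : B \<rightarrow> D\<close>, \<open>f : C \<rightarrow> D\<close>.
\<close>

definition homotopy_pullback_square ::
    "'a topology \<Rightarrow> 'b topology \<Rightarrow> 'c topology \<Rightarrow> 'd topology
     \<Rightarrow> ('a \<Rightarrow> 'b) \<Rightarrow> ('a \<Rightarrow> 'c) \<Rightarrow> ('b \<Rightarrow> 'd) \<Rightarrow> ('c \<Rightarrow> 'd) \<Rightarrow> bool" where
  "homotopy_pullback_square A B C D u p g f \<longleftrightarrow>
     (\<forall>a \<in> topspace A. f (p a) = g (u a)) \<and>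
     weak_equivalence A (homotopy_pullback_space B C D g f)
       (\<lambda>a. (p a, restrict (\<lambda>t. g (u a)) {0..1}, u a))"

section \<open>The category of inner product spaces and Thom spaces\<close>

text \<open>
  The base field is a subset \<open>F\<close> of the complex numbers: \<open>\<real>\<close> for orthogonal spectra and \<open>UNIV\<close>
  for unitary spectra.
\<close>

type_synonym vec = "nat \<Rightarrow> complex"

definition vec_infty :: "complex set \<Rightarrow> vec set" where
  "vec_infty F = {v. finite {i. v i \<noteq> 0} \<and> (\<forall>i. v i \<in> F)}"

definition ip :: "vec \<Rightarrow> vec \<Rightarrow> complex" where
  "ip v w = (\<Sum>i | v i \<noteq> 0. v i * cnj (w i))"

definition fd_spaces :: "complex set \<Rightarrow> vec set set" where
  "fd_spaces F = {V. V \<subseteq> vec_infty F \<and> (\<lambda>i. 0) \<in> V \<and>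
     (\<forall>v \<in> V. \<forall>w \<in> V. (\<lambda>i. v i + w i) \<in> V) \<and>
     (\<forall>a \<in> F. \<forall>v \<in> V. (\<lambda>i. a * v i) \<in> V) \<and>
     (\<exists>B. finite B \<and> B \<subseteq> V \<and>
        (\<forall>v \<in> V. \<exists>c. (\<forall>b \<in> B. c b \<in> F) \<and> v = (\<lambda>i. \<Sum>b\<in>B. c b * b i)))}"

definition isometries :: "complex set \<Rightarrow> vec set \<Rightarrow> vec set \<Rightarrow> (vec \<Rightarrow> vec) set" where
  "isometries F U V = {f \<in> U \<rightarrow>\<^sub>E V.
     (\<forall>v \<in> U. \<forall>w \<in> U. f (\<lambda>i. v i + w i) = (\<lambda>i. f v i + f w i)) \<and>
     (\<forall>a \<in> F. \<forall>v \<in> U. f (\<lambda>i. a * v i) = (\<lambda>i. a * f v i)) \<and>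
     (\<forall>v \<in> U. \<forall>w \<in> U. ip (f v) (f w) = ip v w)}"

text \<open>
  On a finite-dimensional subspace of \<open>vec_infty F\<close> the product topology of the type \<open>vec\<close> is the
  norm topology; on linear maps between two such, pointwise convergence is norm convergence.
\<close>

definition J1_bundle :: "complex set \<Rightarrow> vec set \<Rightarrow> vec set \<Rightarrow> ((vec \<Rightarrow> vec) \<times> vec) topology" where
  "J1_bundle F U V =
     subtopology (prod_topology (product_topology (\<lambda>_. top_of_set V) U) (top_of_set V))
       {(f, x). f \<in> isometries F U V \<and> x \<in> V \<and> (\<forall>u \<in> U. ip x (f u) = 0)}"

type_synonym J1_mor = "((vec \<Rightarrow> vec) \<times> vec) option"

text \<open>
  The space of isometries is compact, so the Thom space is the one-point compactification of the
  total space, \<open>None\<close> being the base point.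
\<close>

definition J1 :: "complex set \<Rightarrow> vec set \<Rightarrow> vec set \<Rightarrow> J1_mor topology" where
  "J1 F U V = Alexandroff_compactification (J1_bundle F U V)"

text \<open>\<open>J1_comp U b a\<close> is the composite of \<open>a\<close>, with source \<open>U\<close>, followed by \<open>b\<close>.\<close>

fun J1_comp :: "vec set \<Rightarrow> J1_mor \<Rightarrow> J1_mor \<Rightarrow> J1_mor" where
  "J1_comp U (Some (g, y)) (Some (f, x)) = Some (compose U g f, \<lambda>i. y i + g x i)"
| "J1_comp U _ None = None"
| "J1_comp U None _ = None"

definition J1_id :: "vec set \<Rightarrow> J1_mor" where
  "J1_id V = Some (restrict (\<lambda>v. v) V, \<lambda>i. 0)"

section \<open>Spectra and naive G-spectra\<close>

record 'u spectrum =
  lev :: "vec set \<Rightarrow> 'u topology"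
  bas :: "vec set \<Rightarrow> 'u"
  act :: "vec set \<Rightarrow> vec set \<Rightarrow> J1_mor \<Rightarrow> 'u \<Rightarrow> 'u"

definition lev_maps ::
    "('u, 'x) spectrum_scheme \<Rightarrow> vec set \<Rightarrow> ('u, 'y) spectrum_scheme \<Rightarrow> vec set \<Rightarrow> ('u \<Rightarrow> 'u) topology" where
  "lev_maps \<Theta> U \<Psi> V = based_map_space (lev \<Theta> U) (bas \<Theta> U) (lev \<Psi> V) (bas \<Psi> V)"

definition is_spectrum :: "complex set \<Rightarrow> ('u, 'x) spectrum_scheme \<Rightarrow> bool" where
  "is_spectrum F \<Theta> \<longleftrightarrow>
     (\<forall>V \<in> fd_spaces F. cgwh (lev \<Theta> V) \<and> bas \<Theta> V \<in> topspace (lev \<Theta> V)) \<and>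
     (\<forall>U \<in> fd_spaces F. \<forall>V \<in> fd_spaces F.
        continuous_map (J1 F U V) (lev_maps \<Theta> U \<Theta> V) (act \<Theta> U V) \<and>
        act \<Theta> U V None = restrict (\<lambda>x. bas \<Theta> V) (topspace (lev \<Theta> U))) \<and>
     (\<forall>V \<in> fd_spaces F. act \<Theta> V V (J1_id V) = restrict (\<lambda>x. x) (topspace (lev \<Theta> V))) \<and>
     (\<forall>U \<in> fd_spaces F. \<forall>V \<in> fd_spaces F. \<forall>W \<in> fd_spaces F.
        \<forall>a \<in> topspace (J1 F U V). \<forall>b \<in> topspace (J1 F V W).
          act \<Theta> U W (J1_comp U b a) = compose (topspace (lev \<Theta> U)) (act \<Theta> V W b) (act \<Theta> U V a))"

type_synonym 'u spectrum_map = "vec set \<Rightarrow> 'u \<Rightarrow> 'u"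

definition spectrum_maps ::
    "complex set \<Rightarrow> ('u, 'x) spectrum_scheme \<Rightarrow> ('u, 'y) spectrum_scheme \<Rightarrow> 'u spectrum_map set" where
  "spectrum_maps F \<Theta> \<Psi> = {f \<in> (\<Pi>\<^sub>E V \<in> fd_spaces F. topspace (lev_maps \<Theta> V \<Psi> V)).
     \<forall>U \<in> fd_spaces F. \<forall>V \<in> fd_spaces F. \<forall>a \<in> topspace (J1 F U V). \<forall>x \<in> topspace (lev \<Theta> U).
       f V (act \<Theta> U V a x) = act \<Psi> U V a (f U x)}"

definition spectrum_comp ::
    "complex set \<Rightarrow> ('u, 'x) spectrum_scheme \<Rightarrow> 'u spectrum_map \<Rightarrow> 'u spectrum_map \<Rightarrow> 'u spectrum_map" where
  "spectrum_comp F \<Theta> g f = (\<lambda>V \<in> fd_spaces F. compose (topspace (lev \<Theta> V)) (g V) (f V))"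

definition spectrum_id :: "complex set \<Rightarrow> ('u, 'x) spectrum_scheme \<Rightarrow> 'u spectrum_map" where
  "spectrum_id F \<Theta> = (\<lambda>V \<in> fd_spaces F. \<lambda>x \<in> topspace (lev \<Theta> V). x)"

record 'g topgroup = "'g monoid" +
  gtop :: "'g topology"

record ('g, 'u) gspectrum = "'u spectrum" +
  gact :: "'g \<Rightarrow> 'u spectrum_map"

text \<open>
  The topology on the automorphisms of a spectrum is the one induced from the product over \<open>V\<close> of
  the mapping spaces, so continuity of the action is tested for each \<open>V\<close> separately.
\<close>

definition is_gspectrum :: "complex set \<Rightarrow> 'g topgroup \<Rightarrow> ('g, 'u) gspectrum \<Rightarrow> bool" where
  "is_gspectrum F G \<Theta> \<longleftrightarrow> is_spectrum F \<Theta> \<and>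
     (\<forall>g \<in> carrier G. gact \<Theta> g \<in> spectrum_maps F \<Theta> \<Theta>) \<and>
     gact \<Theta> \<one>\<^bsub>G\<^esub> = spectrum_id F \<Theta> \<and>
     (\<forall>g \<in> carrier G. \<forall>h \<in> carrier G.
        gact \<Theta> (g \<otimes>\<^bsub>G\<^esub> h) = spectrum_comp F \<Theta> (gact \<Theta> g) (gact \<Theta> h)) \<and>
     (\<forall>V \<in> fd_spaces F. continuous_map (gtop G) (lev_maps \<Theta> V \<Theta> V) (\<lambda>g. gact \<Theta> g V))"

definition gspectrum_maps ::
    "complex set \<Rightarrow> 'g topgroup \<Rightarrow> ('g, 'u) gspectrum \<Rightarrow> ('g, 'u) gspectrum \<Rightarrow> 'u spectrum_map set" where
  "gspectrum_maps F G \<Theta> \<Psi> = {f \<in> spectrum_maps F \<Theta> \<Psi>.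
     \<forall>g \<in> carrier G. spectrum_comp F \<Theta> f (gact \<Theta> g) = spectrum_comp F \<Theta> (gact \<Psi> g) f}"

section \<open>Stable homotopy groups and stable fibrations\<close>

definition seq_shift :: "(nat \<Rightarrow> 'a \<Rightarrow> 'a) \<Rightarrow> nat \<Rightarrow> nat \<Rightarrow> 'a \<Rightarrow> 'a" where
  "seq_shift s q m = fold s [q..<q + m]"

definition colim_class ::
    "nat set \<Rightarrow> (nat \<Rightarrow> 'a set) \<Rightarrow> (nat \<Rightarrow> 'a \<Rightarrow> 'a) \<Rightarrow> nat \<times> 'a \<Rightarrow> (nat \<times> 'a) set" where
  "colim_class I A s = (\<lambda>(q, a). {(r, b). r \<in> I \<and> b \<in> A r \<and>
     (\<exists>m n. q + m = r + n \<and> seq_shift s q m a = seq_shift s r n b)})"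

text \<open>
  The colimit of the sets \<open>A q\<close> along \<open>s q : A q \<rightarrow> A (Suc q)\<close>, over an upward closed set \<open>I\<close> of
  indices.
\<close>

definition seq_colim ::
    "nat set \<Rightarrow> (nat \<Rightarrow> 'a set) \<Rightarrow> (nat \<Rightarrow> 'a \<Rightarrow> 'a) \<Rightarrow> (nat \<times> 'a) set set" where
  "seq_colim I A s = colim_class I A s ` (SIGMA q:I. A q)"

definition real_dim :: "complex set \<Rightarrow> nat" where
  "real_dim F = (if F = UNIV then 2 else 1)"

definition coord_space :: "complex set \<Rightarrow> nat \<Rightarrow> vec set" where
  "coord_space F q = {v. (\<forall>i. v i \<in> F) \<and> (\<forall>i\<ge>q. v i = 0)}"

text \<open>
  The stabilization of \<open>f : S\<^sup>n \<rightarrow> \<Theta>(F\<^sup>q)\<close> is the composite of \<open>f \<and> S\<^sup>F\<close> with the structure map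
  \<open>\<Theta>(F\<^sup>q) \<and> S\<^sup>F \<rightarrow> \<Theta>(F\<^sup>q\<^sup>+\<^sup>1)\<close>, where the coordinates of \<open>S\<^sup>F\<close> are those with index at least \<open>n\<close>
  in \<open>S\<^sup>n \<and> S\<^sup>F = S\<^sup>n\<^sup>+\<^sup>1\<close> (respectively \<open>S\<^sup>n\<^sup>+\<^sup>2\<close>).
\<close>

definition stab_map ::
    "complex set \<Rightarrow> ('u, 'x) spectrum_scheme \<Rightarrow> nat \<Rightarrow> nat
     \<Rightarrow> ((nat \<Rightarrow> real) option \<Rightarrow> 'u) \<Rightarrow> (nat \<Rightarrow> real) option \<Rightarrow> 'u" where
  "stab_map F \<Theta> n q f z = (case z of
      None \<Rightarrow> bas \<Theta> (coord_space F (Suc q))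
    | Some y \<Rightarrow>
        act \<Theta> (coord_space F q) (coord_space F (Suc q))
          (Some (restrict (\<lambda>v. v) (coord_space F q),
             \<lambda>i. if i = q then (if F = UNIV then Complex (y n) (y (Suc n)) else of_real (y n)) else 0))
          (f (Some (\<lambda>i. if i < n then y i else 0))))"

definition spi_index :: "complex set \<Rightarrow> int \<Rightarrow> nat set" where
  "spi_index F k = {q. 0 \<le> k + int (real_dim F * q)}"

definition spi_dim :: "complex set \<Rightarrow> int \<Rightarrow> nat \<Rightarrow> nat" where
  "spi_dim F k q = nat (k + int (real_dim F * q))"

definition spi_level ::
    "complex set \<Rightarrow> int \<Rightarrow> ('u, 'x) spectrum_scheme \<Rightarrow> nat \<Rightarrow> ((nat \<Rightarrow> real) option \<Rightarrow> 'u) set set" where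
  "spi_level F k \<Theta> q =
     pi_set (spi_dim F k q) (lev \<Theta> (coord_space F q)) (bas \<Theta> (coord_space F q))"

definition spi_stab ::
    "complex set \<Rightarrow> int \<Rightarrow> ('u, 'x) spectrum_scheme \<Rightarrow> nat
     \<Rightarrow> ((nat \<Rightarrow> real) option \<Rightarrow> 'u) set \<Rightarrow> ((nat \<Rightarrow> real) option \<Rightarrow> 'u) set" where
  "spi_stab F k \<Theta> q =
     pi_lift (spi_dim F k (Suc q)) (lev \<Theta> (coord_space F (Suc q))) (bas \<Theta> (coord_space F (Suc q)))
       (stab_map F \<Theta> (spi_dim F k q) q)"

definition spi ::
    "complex set \<Rightarrow> int \<Rightarrow> ('u, 'x) spectrum_scheme \<Rightarrow> (nat \<times> ((nat \<Rightarrow> real) option \<Rightarrow> 'u) set) set set" where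
  "spi F k \<Theta> = seq_colim (spi_index F k) (spi_level F k \<Theta>) (spi_stab F k \<Theta>)"

definition spi_map ::
    "complex set \<Rightarrow> int \<Rightarrow> ('u, 'y) spectrum_scheme \<Rightarrow> 'u spectrum_map
     \<Rightarrow> (nat \<times> ((nat \<Rightarrow> real) option \<Rightarrow> 'u) set) set
     \<Rightarrow> (nat \<times> ((nat \<Rightarrow> real) option \<Rightarrow> 'u) set) set" where
  "spi_map F k \<Psi> f C =
     (\<Union>(q, c) \<in> C. colim_class (spi_index F k) (spi_level F k \<Psi>) (spi_stab F k \<Psi>)
        (q, pi_lift (spi_dim F k q) (lev \<Psi> (coord_space F q)) (bas \<Psi> (coord_space F q))
              (\<lambda>s. f (coord_space F q) \<circ> s) c))"

text \<open>
  The induced maps are homomorphisms, so they are isomorphisms precisely when they are bijective.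
\<close>

definition pi_isomorphism ::
    "complex set \<Rightarrow> ('u, 'x) spectrum_scheme \<Rightarrow> ('u, 'y) spectrum_scheme \<Rightarrow> 'u spectrum_map \<Rightarrow> bool" where
  "pi_isomorphism F \<Theta> \<Psi> f \<longleftrightarrow> (\<forall>k::int. bij_betw (spi_map F k \<Psi> f) (spi F k \<Theta>) (spi F k \<Psi>))"

text \<open>
  The external direct sum is formed inside \<open>vec_infty F\<close> by means of the isometric isomorphism
  from \<open>vec_infty F \<oplus> vec_infty F\<close> that interleaves coordinates.
\<close>

definition inl_vec :: "vec \<Rightarrow> vec" where
  "inl_vec v = (\<lambda>i. if even i then v (i div 2) else 0)"

definition inr_vec :: "vec \<Rightarrow> vec" where
  "inr_vec w = (\<lambda>i. if even i then 0 else w (i div 2))"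

definition dsum :: "vec set \<Rightarrow> vec set \<Rightarrow> vec set" where
  "dsum V W = {\<lambda>i. inl_vec v i + inr_vec w i | v w. v \<in> V \<and> w \<in> W}"

definition sphere_of :: "vec set \<Rightarrow> vec option topology" where
  "sphere_of W = Alexandroff_compactification (top_of_set W)"

definition loops ::
    "('u, 'x) spectrum_scheme \<Rightarrow> vec set \<Rightarrow> vec set \<Rightarrow> (vec option \<Rightarrow> 'u) topology" where
  "loops \<Theta> W Z = based_map_space (sphere_of W) None (lev \<Theta> Z) (bas \<Theta> Z)"

definition loops_map ::
    "vec set \<Rightarrow> ('u \<Rightarrow> 'u) \<Rightarrow> (vec option \<Rightarrow> 'u) \<Rightarrow> vec option \<Rightarrow> 'u" where
  "loops_map W f = compose (topspace (sphere_of W)) f"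

definition adj_struct ::
    "('u, 'x) spectrum_scheme \<Rightarrow> vec set \<Rightarrow> vec set \<Rightarrow> 'u \<Rightarrow> vec option \<Rightarrow> 'u" where
  "adj_struct \<Theta> V W x = (\<lambda>z \<in> topspace (sphere_of W).
     act \<Theta> V (dsum V W) (map_option (\<lambda>w. (restrict inl_vec V, inr_vec w)) z) x)"

definition stable_fibration ::
    "complex set \<Rightarrow> ('u, 'x) spectrum_scheme \<Rightarrow> ('u, 'y) spectrum_scheme \<Rightarrow> 'u spectrum_map \<Rightarrow> bool" where
  "stable_fibration F \<Theta> \<Psi> f \<longleftrightarrow>
     (\<forall>V \<in> fd_spaces F. serre_fibration (lev \<Theta> V) (lev \<Psi> V) (f V)) \<and>
     (\<forall>V \<in> fd_spaces F. \<forall>W \<in> fd_spaces F.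
        homotopy_pullback_square
          (lev \<Theta> V) (loops \<Theta> W (dsum V W)) (lev \<Psi> V) (loops \<Psi> W (dsum V W))
          (adj_struct \<Theta> V W) (f V) (loops_map W (f (dsum V W))) (adj_struct \<Psi> V W))"

section \<open>Quillen adjunctions\<close>

record ('o, 'm) category_data =
  Ob :: "'o set"
  Mor :: "'o \<Rightarrow> 'o \<Rightarrow> 'm set"
  Cmp :: "'o \<Rightarrow> 'o \<Rightarrow> 'o \<Rightarrow> 'm \<Rightarrow> 'm \<Rightarrow> 'm"
  Idt :: "'o \<Rightarrow> 'm"

definition is_category :: "('o, 'm, 'z) category_data_scheme \<Rightarrow> bool" where
  "is_category C \<longleftrightarrow>
     (\<forall>X \<in> Ob C. Idt C X \<in> Mor C X X) \<and>
     (\<forall>X \<in> Ob C. \<forall>Y \<in> Ob C. \<forall>Z \<in> Ob C. \<forall>f \<in> Mor C X Y. \<forall>g \<in> Mor C Y Z.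
        Cmp C X Y Z g f \<in> Mor C X Z) \<and>
     (\<forall>X \<in> Ob C. \<forall>Y \<in> Ob C. \<forall>f \<in> Mor C X Y.
        Cmp C X X Y f (Idt C X) = f \<and> Cmp C X Y Y (Idt C Y) f = f) \<and>
     (\<forall>W \<in> Ob C. \<forall>X \<in> Ob C. \<forall>Y \<in> Ob C. \<forall>Z \<in> Ob C.
        \<forall>f \<in> Mor C W X. \<forall>g \<in> Mor C X Y. \<forall>h \<in> Mor C Y Z.
        Cmp C W X Z (Cmp C X Y Z h g) f = Cmp C W Y Z h (Cmp C W X Y g f))"

definition is_functor ::
    "('o, 'm, 'y) category_data_scheme \<Rightarrow> ('p, 'n, 'z) category_data_scheme
     \<Rightarrow> ('o \<Rightarrow> 'p) \<Rightarrow> ('o \<Rightarrow> 'o \<Rightarrow> 'm \<Rightarrow> 'n) \<Rightarrow> bool" where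
  "is_functor C D Fo Fm \<longleftrightarrow>
     (\<forall>X \<in> Ob C. Fo X \<in> Ob D \<and> Fm X X (Idt C X) = Idt D (Fo X)) \<and>
     (\<forall>X \<in> Ob C. \<forall>Y \<in> Ob C. \<forall>f \<in> Mor C X Y. Fm X Y f \<in> Mor D (Fo X) (Fo Y)) \<and>
     (\<forall>X \<in> Ob C. \<forall>Y \<in> Ob C. \<forall>Z \<in> Ob C. \<forall>f \<in> Mor C X Y. \<forall>g \<in> Mor C Y Z.
        Fm X Z (Cmp C X Y Z g f) = Cmp D (Fo X) (Fo Y) (Fo Z) (Fm Y Z g) (Fm X Y f))"

definition adjoint_pair ::
    "('o, 'm, 'y) category_data_scheme \<Rightarrow> ('p, 'n, 'z) category_data_scheme
     \<Rightarrow> ('o \<Rightarrow> 'p) \<Rightarrow> ('o \<Rightarrow> 'o \<Rightarrow> 'm \<Rightarrow> 'n) \<Rightarrow> ('p \<Rightarrow> 'o) \<Rightarrow> ('p \<Rightarrow> 'p \<Rightarrow> 'n \<Rightarrow> 'm) \<Rightarrow> bool" where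
  "adjoint_pair C D Lo Lm Ro Rm \<longleftrightarrow>
     is_category C \<and> is_category D \<and> is_functor C D Lo Lm \<and> is_functor D C Ro Rm \<and>
     (\<exists>\<phi>. (\<forall>X \<in> Ob C. \<forall>Y \<in> Ob D. bij_betw (\<phi> X Y) (Mor D (Lo X) Y) (Mor C X (Ro Y))) \<and>
        (\<forall>X \<in> Ob C. \<forall>X' \<in> Ob C. \<forall>Y \<in> Ob D. \<forall>Y' \<in> Ob D.
         \<forall>a \<in> Mor C X' X. \<forall>f \<in> Mor D (Lo X) Y. \<forall>b \<in> Mor D Y Y'.
           \<phi> X' Y' (Cmp D (Lo X') Y Y' b (Cmp D (Lo X') (Lo X) Y f (Lm X' X a)))
           = Cmp C X' (Ro Y) (Ro Y') (Rm Y Y' b) (Cmp C X' X (Ro Y) (\<phi> X Y f) a)))"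

record ('o, 'm) model_data = "('o, 'm) category_data" +
  Weq :: "'o \<Rightarrow> 'o \<Rightarrow> 'm set"
  Fib :: "'o \<Rightarrow> 'o \<Rightarrow> 'm set"
  Cof :: "'o \<Rightarrow> 'o \<Rightarrow> 'm set"

definition has_llp ::
    "('o, 'm, 'z) category_data_scheme \<Rightarrow> 'o \<Rightarrow> 'o \<Rightarrow> 'm \<Rightarrow> 'o \<Rightarrow> 'o \<Rightarrow> 'm \<Rightarrow> bool" where
  "has_llp C A B i X Y p \<longleftrightarrow>
     (\<forall>u \<in> Mor C A X. \<forall>v \<in> Mor C B Y. Cmp C A X Y p u = Cmp C A B Y v i \<longrightarrow>
        (\<exists>h \<in> Mor C B X. Cmp C A B X h i = u \<and> Cmp C B X Y p h = v))"

text \<open>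
  In a model category the cofibrations are determined by the other two classes: they are the maps
  with the left lifting property against the acyclic fibrations.
\<close>

definition with_cofibrations ::
    "('o, 'm) model_data \<Rightarrow> ('o, 'm) model_data" where
  "with_cofibrations M = M\<lparr>Cof := (\<lambda>A B. {i \<in> Mor M A B.
     \<forall>X \<in> Ob M. \<forall>Y \<in> Ob M. \<forall>p \<in> Fib M X Y \<inter> Weq M X Y. has_llp M A B i X Y p})\<rparr>"

text \<open>
  The requirement on acyclic fibrations is redundant when \<open>C\<close> and \<open>D\<close> satisfy the axioms of a
  model category, as is preservation of acyclic cofibrations by the left adjoint.
\<close>

definition quillen_adjunction ::
    "('o, 'm) model_data \<Rightarrow> ('p, 'n) model_data
     \<Rightarrow> ('o \<Rightarrow> 'p) \<Rightarrow> ('o \<Rightarrow> 'o \<Rightarrow> 'm \<Rightarrow> 'n) \<Rightarrow> ('p \<Rightarrow> 'o) \<Rightarrow> ('p \<Rightarrow> 'p \<Rightarrow> 'n \<Rightarrow> 'm) \<Rightarrow> bool" where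
  "quillen_adjunction C D Lo Lm Ro Rm \<longleftrightarrow> adjoint_pair C D Lo Lm Ro Rm \<and>
     (\<forall>X \<in> Ob C. \<forall>Y \<in> Ob C. \<forall>i \<in> Cof C X Y. Lm X Y i \<in> Cof D (Lo X) (Lo Y)) \<and>
     (\<forall>X \<in> Ob D. \<forall>Y \<in> Ob D. \<forall>p \<in> Fib D X Y. Rm X Y p \<in> Fib C (Ro X) (Ro Y)) \<and>
     (\<forall>X \<in> Ob D. \<forall>Y \<in> Ob D. \<forall>p \<in> Fib D X Y \<inter> Weq D X Y.
        Rm X Y p \<in> Fib C (Ro X) (Ro Y) \<inter> Weq C (Ro X) (Ro Y))"

text \<open>\<open>Sp[G]\<close> with the stable model structure.\<close>

definition Sp_G ::
    "complex set \<Rightarrow> 'g topgroup \<Rightarrow> (('g, 'u) gspectrum, 'u spectrum_map) model_data" where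
  "Sp_G F G = with_cofibrations
     \<lparr>Ob = {\<Theta>. is_gspectrum F G \<Theta>},
      Mor = gspectrum_maps F G,
      Cmp = (\<lambda>\<Theta> \<Psi> \<Phi> g f. spectrum_comp F \<Theta> g f),
      Idt = spectrum_id F,
      Weq = (\<lambda>\<Theta> \<Psi>. {f \<in> gspectrum_maps F G \<Theta> \<Psi>. pi_isomorphism F \<Theta> \<Psi> f}),
      Fib = (\<lambda>\<Theta> \<Psi>. {f \<in> gspectrum_maps F G \<Theta> \<Psi>. stable_fibration F \<Theta> \<Psi> f}),
      Cof = (\<lambda>\<Theta> \<Psi>. {})\<rparr>"

section \<open>Compact Lie groups\<close>

text \<open>
  \<open>C_k k n S f\<close>: all iterated partial derivatives of order at most \<open>k\<close> of the function \<open>f\<close> exist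
  and are continuous on the set \<open>S\<close>, which has to be open in Euclidean \<open>n\<close>-space.
\<close>

primrec C_k :: "nat \<Rightarrow> nat \<Rightarrow> (nat \<Rightarrow> real) set \<Rightarrow> ((nat \<Rightarrow> real) \<Rightarrow> real) \<Rightarrow> bool" where
  "C_k 0 n S f \<longleftrightarrow> continuous_map (subtopology (Euclidean_space n) S) euclideanreal f"
| "C_k (Suc k) n S f \<longleftrightarrow> continuous_map (subtopology (Euclidean_space n) S) euclideanreal f \<and>
     (\<forall>i<n. \<exists>f'. (\<forall>x \<in> S. ((\<lambda>t. f (x(i := t))) has_real_derivative f' x) (at (x i))) \<and>
        C_k k n S f')"

definition smooth_map ::
    "nat \<Rightarrow> nat \<Rightarrow> (nat \<Rightarrow> real) set \<Rightarrow> ((nat \<Rightarrow> real) \<Rightarrow> (nat \<Rightarrow> real)) \<Rightarrow> bool" where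
  "smooth_map n m S f \<longleftrightarrow> (\<forall>j<m. \<forall>k. C_k k n S (\<lambda>x. f x j))"

type_synonym 'g chart = "'g set \<times> ('g \<Rightarrow> nat \<Rightarrow> real)"

definition smooth_atlas :: "'g topology \<Rightarrow> nat \<Rightarrow> 'g chart set \<Rightarrow> bool" where
  "smooth_atlas T n A \<longleftrightarrow>
     (\<forall>(U, \<phi>) \<in> A. openin T U \<and> openin (Euclidean_space n) (\<phi> ` U) \<and>
        homeomorphic_map (subtopology T U) (subtopology (Euclidean_space n) (\<phi> ` U)) \<phi>) \<and>
     \<Union> (fst ` A) = topspace T \<and>
     (\<forall>(U, \<phi>) \<in> A. \<forall>(V, \<psi>) \<in> A. smooth_map n n (\<phi> ` (U \<inter> V)) (\<psi> \<circ> inv_into U \<phi>))"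

definition topological_group :: "'g topgroup \<Rightarrow> bool" where
  "topological_group G \<longleftrightarrow> group G \<and> topspace (gtop G) = carrier G \<and>
     continuous_map (prod_topology (gtop G) (gtop G)) (gtop G) (\<lambda>(x, y). x \<otimes>\<^bsub>G\<^esub> y) \<and>
     continuous_map (gtop G) (gtop G) (\<lambda>x. inv\<^bsub>G\<^esub> x)"

definition fst_coords :: "nat \<Rightarrow> (nat \<Rightarrow> real) \<Rightarrow> nat \<Rightarrow> real" where
  "fst_coords n z = (\<lambda>i. if i < n then z i else 0)"

definition snd_coords :: "nat \<Rightarrow> (nat \<Rightarrow> real) \<Rightarrow> nat \<Rightarrow> real" where
  "snd_coords n z = (\<lambda>i. z (n + i))"

definition lie_group :: "'g topgroup \<Rightarrow> nat \<Rightarrow> 'g chart set \<Rightarrow> bool" where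
  "lie_group G n A \<longleftrightarrow> topological_group G \<and>
     Hausdorff_space (gtop G) \<and> second_countable (gtop G) \<and> smooth_atlas (gtop G) n A \<and>
     (\<forall>(U, \<phi>) \<in> A. \<forall>(V, \<psi>) \<in> A. \<forall>(W, \<theta>) \<in> A.
        smooth_map (n + n) n
          {z \<in> topspace (Euclidean_space (n + n)). \<exists>x \<in> U. \<exists>y \<in> V. x \<otimes>\<^bsub>G\<^esub> y \<in> W \<and>
             fst_coords n z = \<phi> x \<and> snd_coords n z = \<psi> y}
          (\<lambda>z. \<theta> (inv_into U \<phi> (fst_coords n z) \<otimes>\<^bsub>G\<^esub> inv_into V \<psi> (snd_coords n z)))) \<and>
     (\<forall>(U, \<phi>) \<in> A. \<forall>(V, \<psi>) \<in> A.
        smooth_map n n (\<phi> ` {x \<in> U. inv\<^bsub>G\<^esub> x \<in> V}) (\<lambda>z. \<psi> (inv\<^bsub>G\<^esub> (inv_into U \<phi> z))))"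

definition subgroup_of :: "'g topgroup \<Rightarrow> 'g set \<Rightarrow> 'g topgroup" where
  "subgroup_of G H = G\<lparr>carrier := H, gtop := subtopology (gtop G) H\<rparr>"

section \<open>Restriction and induction of naive spectra\<close>

definition res_ob :: "'g set \<Rightarrow> ('g, 'u) gspectrum \<Rightarrow> ('g, 'u) gspectrum" where
  "res_ob H \<Theta> = \<Theta>\<lparr>gact := restrict (gact \<Theta>) H\<rparr>"

definition res_mor ::
    "('g, 'u) gspectrum \<Rightarrow> ('g, 'u) gspectrum \<Rightarrow> 'u spectrum_map \<Rightarrow> 'u spectrum_map" where
  "res_mor \<Theta> \<Psi> f = f"

text \<open>
  \<open>ind_class G H \<Theta> V (g, x)\<close> is the equivalence class of \<open>(g, x)\<close> in \<open>G \<times> \<Theta>(V)\<close> for the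
  identifications \<open>(g h, y) \<sim> (g, h y)\<close>, with \<open>h \<in> H\<close>, that collapses \<open>G \<times> {*}\<close> to a point. The
  points of \<open>G\<^sub>+ \<and>\<^sub>H \<Theta>(V)\<close> have to be elements of the type \<open>'u\<close> again; the class is represented by
  the code, under an injection \<open>e\<close> of \<open>G \<times> 'u\<close> into \<open>'u\<close>, of a chosen element.
\<close>

definition ind_class ::
    "'g topgroup \<Rightarrow> 'g set \<Rightarrow> ('g, 'u) gspectrum \<Rightarrow> vec set \<Rightarrow> 'g \<times> 'u \<Rightarrow> ('g \<times> 'u) set" where
  "ind_class G H \<Theta> V = (\<lambda>(g, x). {(g', y). g' \<in> carrier G \<and> y \<in> topspace (lev \<Theta> V) \<and>
     ((x = bas \<Theta> V \<and> y = bas \<Theta> V) \<or> (\<exists>h \<in> H. g' = g \<otimes>\<^bsub>G\<^esub> h \<and> x = gact \<Theta> h V y))})"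

definition ind_point ::
    "('g \<times> 'u \<Rightarrow> 'u) \<Rightarrow> 'g topgroup \<Rightarrow> 'g set \<Rightarrow> ('g, 'u) gspectrum \<Rightarrow> vec set \<Rightarrow> 'g \<times> 'u \<Rightarrow> 'u" where
  "ind_point e G H \<Theta> V p = e (SOME q. q \<in> ind_class G H \<Theta> V p)"

definition ind_lev ::
    "('g \<times> 'u \<Rightarrow> 'u) \<Rightarrow> 'g topgroup \<Rightarrow> 'g set \<Rightarrow> ('g, 'u) gspectrum \<Rightarrow> vec set \<Rightarrow> 'u topology" where
  "ind_lev e G H \<Theta> V = quot_topology (kprod (gtop G) (lev \<Theta> V)) (ind_point e G H \<Theta> V)"

text \<open>The map out of \<open>G\<^sub>+ \<and>\<^sub>H \<Theta>(V)\<close> induced by a map out of \<open>G \<times> \<Theta>(V)\<close>.\<close>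

definition ind_lift ::
    "('g \<times> 'u \<Rightarrow> 'u) \<Rightarrow> 'g topgroup \<Rightarrow> 'g set \<Rightarrow> ('g, 'u) gspectrum \<Rightarrow> vec set
     \<Rightarrow> ('g \<times> 'u \<Rightarrow> 'u) \<Rightarrow> 'u \<Rightarrow> 'u" where
  "ind_lift e G H \<Theta> V r = (\<lambda>y \<in> topspace (ind_lev e G H \<Theta> V).
     r (inv_into (carrier G \<times> topspace (lev \<Theta> V)) (ind_point e G H \<Theta> V) y))"

definition ind_ob ::
    "complex set \<Rightarrow> ('g \<times> 'u \<Rightarrow> 'u) \<Rightarrow> 'g topgroup \<Rightarrow> 'g set \<Rightarrow> ('g, 'u) gspectrum \<Rightarrow> ('g, 'u) gspectrum" where
  "ind_ob F e G H \<Theta> =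
     \<lparr>lev = ind_lev e G H \<Theta>,
      bas = (\<lambda>V. ind_point e G H \<Theta> V (\<one>\<^bsub>G\<^esub>, bas \<Theta> V)),
      act = (\<lambda>U V a. ind_lift e G H \<Theta> U (\<lambda>(g, x). ind_point e G H \<Theta> V (g, act \<Theta> U V a x))),
      gact = (\<lambda>k. \<lambda>V \<in> fd_spaces F.
        ind_lift e G H \<Theta> V (\<lambda>(g, x). ind_point e G H \<Theta> V (k \<otimes>\<^bsub>G\<^esub> g, x)))\<rparr>"

definition ind_mor ::
    "complex set \<Rightarrow> ('g \<times> 'u \<Rightarrow> 'u) \<Rightarrow> 'g topgroup \<Rightarrow> 'g set
     \<Rightarrow> ('g, 'u) gspectrum \<Rightarrow> ('g, 'u) gspectrum \<Rightarrow> 'u spectrum_map \<Rightarrow> 'u spectrum_map" where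
  "ind_mor F e G H \<Theta> \<Psi> f = (\<lambda>V \<in> fd_spaces F.
     ind_lift e G H \<Theta> V (\<lambda>(g, x). ind_point e G H \<Psi> V (g, f V x)))"

end

theory Submission
  imports Defs
begin

text \<open>
  Restriction changes neither the levels nor the structure maps of a spectrum, so it preserves
  fibrations and \<open>\<pi>\<^sub>*\<close>-isomorphisms, and its left adjoint then preserves cofibrations by
  transposing lifting problems. What takes work is that induction stays within spectra. Since \<open>G\<close> is
  compact Hausdorff, \<open>G \<times> \<Theta>(V)\<close> with the product topology is already compactly generated, and
  \<open>G \<times> \<Theta>(V) \<rightarrow> G\<^sub>+ \<and>\<^sub>H \<Theta>(V)\<close> is closed with compact fibres, so the quotient is
  weak Hausdorff. The spaces of morphisms \<open>J\<^sub>1(U, V)\<close> and \<open>G\<close> are compact Hausdorff, and a map from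
  such a space to a mapping space is continuous exactly if its adjoint is; all continuity
  conditions thus become statements about maps out of products, which descend along quotient maps.
\<close>

section \<open>Weak Hausdorff spaces and k-ification\<close>

text \<open>\<open>kify\<close> and \<open>weak_Hausdorff\<close> test a space with points in
  \<open>'a\<close> against spaces with points in \<open>'a set set\<close>, while the proof passes
  between \<open>'g \<times> 'u\<close>, \<open>'u\<close> and function types. Subspaces remove this
  dependence: in a weak Hausdorff space the image of any compact Hausdorff space, of whatever type,
  is a closed compact Hausdorff subspace, and such subspaces decide which sets are k-open.

  The quotient is controlled by the orbit map, which sends \<open>h\<close> and
  \<open>(g, x)\<close> to \<open>(g h, inv h x)\<close>. Away from the base point it parametrizes
  the classes by the compact group \<open>H\<close>; the pairs over the base point form one further
  closed class. The levels of a spectrum need not be Hausdorff. What replaces this is that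
  \<open>H\<close> acts freely on \<open>G\<close>, so the quotient map is injective on the pairs
  with a given first coordinate.

  Write \<open>[g, x]\<close> for the class of \<open>(g, x)\<close>. The adjunction bijection sends
  \<open>f\<close> to the map taking \<open>x\<close> to \<open>f [1, x]\<close>, and its inverse
  extends \<open>f\<close> by \<open>[g, x] \<mapsto> g (f x)\<close>.\<close>

lemma istopology_kify:
  fixes X :: "'a topology"
  shows "istopology (\<lambda>U. U \<subseteq> topspace X \<and>
     (\<forall>(K::'a set set topology) v.
        compact_space K \<and> Hausdorff_space K \<and> continuous_map K X v
        \<longrightarrow> openin K {k \<in> topspace K. v k \<in> U}))"
proof -
  have 1: "openin K {k \<in> topspace K. v k \<in> S \<inter> T}"
    if "openin K {k \<in> topspace K. v k \<in> S}" "openin K {k \<in> topspace K. v k \<in> T}"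
    for K :: "'a set set topology" and v :: "'a set set \<Rightarrow> 'a" and S T
    using openin_Int[OF that] by (rule back_subst) auto
  have 2: "openin K {k \<in> topspace K. v k \<in> \<Union>\<K>}"
    if "\<And>S. S \<in> \<K> \<Longrightarrow> openin K {k \<in> topspace K. v k \<in> S}"
    for K :: "'a set set topology" and v :: "'a set set \<Rightarrow> 'a" and \<K>
  proof -
    have "openin K (\<Union>S\<in>\<K>. {k \<in> topspace K. v k \<in> S})"
      using that by (intro openin_Union) auto
    then show ?thesis by (rule back_subst) auto
  qed
  show ?thesis
    unfolding istopology_def by (intro conjI allI impI 1 2) (auto simp del: Union_iff)
qed

lemma openin_kify:
  fixes X :: "'a topology"
  shows "openin (kify X) U \<longleftrightarrow> U \<subseteq> topspace X \<and>
     (\<forall>(K::'a set set topology) v.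
        compact_space K \<and> Hausdorff_space K \<and> continuous_map K X v
        \<longrightarrow> openin K {k \<in> topspace K. v k \<in> U})"
  unfolding kify_def by (subst topology_inverse'[OF istopology_kify]) simp

lemma openin_imp_openin_kify: "openin X U \<Longrightarrow> openin (kify X) U"
  unfolding openin_kify by (auto simp: openin_subset openin_continuous_map_preimage)

lemma topspace_kify [simp]: "topspace (kify X) = topspace X"
proof
  show "topspace (kify X) \<subseteq> topspace X"
    using openin_kify[of X "topspace (kify X)"] by simp
  show "topspace X \<subseteq> topspace (kify X)"
    by (meson openin_imp_openin_kify openin_subset openin_topspace)
qed

lemma continuous_map_from_kify: "continuous_map A (kify Z) f \<Longrightarrow> continuous_map A Z f"
  by (simp add: continuous_map_def openin_imp_openin_kify)

text \<open>Test spaces in \<open>kify\<close> and \<open>weak_Hausdorff\<close> must have points in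
  \<open>'a set set\<close>. A compact Hausdorff space of another type is moved there along an
  injection \<open>j\<close>; the copy carries the pullback topology along the inverse of
  \<open>j\<close>.\<close>

lemma homeomorphic_copy:
  assumes "inj_on j (topspace K)"
  obtains K' where "homeomorphic_maps K K' j (inv_into (topspace K) j)"
proof
  let ?g = "inv_into (topspace K) j"
  let ?K = "pullback_topology (j ` topspace K) ?g K"
  have top: "topspace ?K = j ` topspace K"
    using assms by (auto simp: topspace_pullback_topology)
  have "continuous_map K ?K j"
  proof (rule continuous_map_pullback')
    show "continuous_map K K (?g \<circ> j)"
      by (rule continuous_map_eq[OF continuous_map_id]) (simp add: assms)
  qed auto
  moreover have "continuous_map ?K K ?g"
    using continuous_map_pullback[OF continuous_map_id, of "j ` topspace K" ?g K] by simp
  ultimately show "homeomorphic_maps K ?K j ?g"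
    using assms by (auto simp: homeomorphic_maps_def top)
qed

lemma weak_Hausdorff_closed_image_aux:
  fixes X :: "'a topology" and K :: "'c topology" and j :: "'c \<Rightarrow> 'a set set"
  assumes "weak_Hausdorff X" "compact_space K" "Hausdorff_space K" "continuous_map K X v"
    and "inj_on j (topspace K)"
  shows "closedin X (v ` topspace K)"
proof -
  let ?g = "inv_into (topspace K) j"
  obtain K' where K': "homeomorphic_maps K K' j ?g"
    using homeomorphic_copy[OF assms(5)] .
  then have h: "K homeomorphic_space K'" by (meson homeomorphic_space_def)
  have img: "?g ` topspace K' = topspace K"
    using K' homeomorphic_imp_surjective_map homeomorphic_maps_map by blast
  have "continuous_map K' X (v \<circ> ?g)"
    using K' assms(4) by (auto simp: homeomorphic_maps_def intro: continuous_map_compose)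
  moreover have "compact_space K'" "Hausdorff_space K'"
    using assms(2,3) h homeomorphic_compact_space homeomorphic_Hausdorff_space by blast+
  ultimately have "closedin X ((v \<circ> ?g) ` topspace K')"
    using assms(1) unfolding weak_Hausdorff_def by blast
  then show ?thesis by (metis image_comp img)
qed

text \<open>
  A set with one point in each fibre has a closure whose points are determined by the traces of
  their neighbourhoods, so test spaces of arbitrary type reduce to those over \<open>'a set set\<close>.
\<close>

lemma weak_Hausdorff_closed_image:
  fixes X :: "'a topology" and K :: "'c topology"
  assumes "weak_Hausdorff X" "compact_space K" "Hausdorff_space K" "continuous_map K X v"
  shows "closedin X (v ` topspace K)"
proof -
  obtain S where S: "S \<subseteq> topspace K" "inj_on v S" "v ` S = v ` topspace K"
    by (metis subset_image_inj order_refl)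
  define T where "T = K closure_of S"
  have T: "closedin K T" "S \<subseteq> T" "T \<subseteq> topspace K"
    using S by (auto simp: T_def closure_of_subset closure_of_subset_topspace)
  \<comment> \<open>The traces are recorded through their images in \<open>X\<close>, which gives a
    value in \<open>'a set set\<close>; as \<open>v\<close> is injective on \<open>S\<close>, the
    image determines the trace.\<close>
  define j where "j y = (\<lambda>N. v ` (N \<inter> S)) ` {N. openin K N \<and> y \<in> N}" for y
  have "inj_on j T"
  proof (rule inj_onI, rule ccontr)
    fix y z assume yz: "y \<in> T" "z \<in> T" "j y = j z" "y \<noteq> z"
    then obtain M N where MN: "openin K M" "openin K N" "y \<in> M" "z \<in> N" "disjnt M N"
      using assms(3) T(3) unfolding Hausdorff_space_def by (metis subsetD)
    then have "v ` (M \<inter> S) \<in> j z" using yz(3) unfolding j_def by blast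
    then obtain L where L: "openin K L" "z \<in> L" "v ` (M \<inter> S) = v ` (L \<inter> S)"
      unfolding j_def by blast
    then have "M \<inter> S = L \<inter> S" using S(2) by (simp add: inj_on_image_eq_iff)
    \<comment> \<open>\<open>z\<close> lies in the closure of \<open>S\<close>, so
      \<open>L \<inter> N\<close> meets \<open>S\<close>; such a point lies in
      \<open>L \<inter> S = M \<inter> S\<close>, although \<open>M\<close> and \<open>N\<close> are
      disjoint.\<close>
    moreover have "openin K (L \<inter> N)" "z \<in> L \<inter> N" using L MN by auto
    then obtain s where "s \<in> S" "s \<in> L \<inter> N"
      using yz(2) unfolding T_def in_closure_of by blast
    ultimately show False using MN(5) by (auto simp: disjnt_iff)
  qed
  moreover have "topspace (subtopology K T) = T" using T topspace_subtopology_subset by blast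
  moreover have "compact_space (subtopology K T)"
    using T(1) assms(2) closedin_compact_space compact_space_subtopology by blast
  moreover have "Hausdorff_space (subtopology K T)" "continuous_map (subtopology K T) X v"
    using assms Hausdorff_space_subtopology continuous_map_from_subtopology by blast+
  ultimately have "closedin X (v ` T)"
    using weak_Hausdorff_closed_image_aux[OF assms(1)] by metis
  \<comment> \<open>\<open>S\<close> already attains every value of \<open>v\<close>, so passing to
    its closure does not change the image.\<close>
  moreover have "v ` T = v ` topspace K" using S T by blast
  ultimately show ?thesis by simp
qed

lemma weak_Hausdorff_t1: "weak_Hausdorff X \<Longrightarrow> t1_space X"
  unfolding t1_space_closedin_singleton
proof
  fix x assume X: "weak_Hausdorff X" "x \<in> topspace X"
  have "Hausdorff_space (subtopology X {x})"
    by (simp add: Hausdorff_space_def)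
  moreover have "compact_space (subtopology X {x})"
    using X by (simp add: compact_space_subtopology)
  ultimately show "closedin X {x}"
    using weak_Hausdorff_closed_image[OF X(1), of "subtopology X {x}" id] X(2)
    by simp
qed

text \<open>Closed subsets of \<open>K\<close> are again compact Hausdorff, so \<open>v\<close> is a
  closed map onto its image. Normality passes along closed continuous surjections, and a normal
  space with closed points is Hausdorff.\<close>

lemma weak_Hausdorff_image:
  assumes "weak_Hausdorff X" "compact_space K" "Hausdorff_space K" "continuous_map K X v"
  shows "compactin X (v ` topspace K)" "Hausdorff_space (subtopology X (v ` topspace K))"
proof -
  let ?L = "subtopology X (v ` topspace K)"
  have sub: "v ` topspace K \<subseteq> topspace X"
    using assms(4) by (simp add: continuous_map_image_subset_topspace)
  show "compactin X (v ` topspace K)"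
    by (metis assms(2,4) compact_space_def image_compactin)
  have "closed_map K ?L v"
    unfolding closed_map_def
  proof (intro allI impI)
    fix C assume C: "closedin K C"
    have top: "topspace (subtopology K C) = C"
      using closedin_subset[OF C] by (simp add: Int_absorb1)
    have "closedin X (v ` topspace (subtopology K C))"
    proof (rule weak_Hausdorff_closed_image[OF assms(1)])
      show "compact_space (subtopology K C)"
        using C assms(2) closedin_compact_space compact_space_subtopology by blast
    qed (use assms Hausdorff_space_subtopology continuous_map_from_subtopology in blast)+
    then show "closedin ?L (v ` C)"
      using C closedin_subset[OF C] sub unfolding top by (auto simp: closedin_subtopology)
  qed
  moreover have "continuous_map K ?L v"
    using assms(4) by (simp add: continuous_map_into_subtopology)
  moreover have "normal_space K" using assms(2,3) compact_Hausdorff_or_regular_imp_normal_space by blast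
  moreover have "v ` topspace K = topspace ?L" using sub by auto
  ultimately have "normal_space ?L" using normal_space_continuous_closed_map_image by blast
  moreover have "t1_space ?L" using weak_Hausdorff_t1[OF assms(1)] t1_space_subtopology by blast
  ultimately show "Hausdorff_space ?L" using normal_t1_imp_Hausdorff_space by blast
qed

lemma weak_HausdorffI:
  assumes "\<And>K v. \<lbrakk>compact_space K; Hausdorff_space K; continuous_map K X v\<rbrakk> \<Longrightarrow> closedin X (v ` topspace (K :: 'a set set topology))"
  shows "weak_Hausdorff (X :: 'a topology)"
  using assms unfolding weak_Hausdorff_def by blast

lemma Hausdorff_imp_weak_Hausdorff: "Hausdorff_space X \<Longrightarrow> weak_Hausdorff X"
  by (meson weak_HausdorffI compactin_imp_closedin image_compactin compact_space_def)

text \<open>Injectivity identifies the image of a test space in \<open>Z\<close> with the preimage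
  under \<open>j\<close> of its image in \<open>Y\<close>. This covers subspaces and, with
  \<open>j\<close> the identity function, finer topologies.\<close>

lemma weak_Hausdorff_injective:
  assumes Y: "weak_Hausdorff Y" and j: "continuous_map Z Y j" and inj: "inj_on j (topspace Z)"
  shows "weak_Hausdorff Z"
proof (rule weak_HausdorffI)
  fix K v assume K: "compact_space K" "Hausdorff_space K" "continuous_map K Z v"
  then have "closedin Y ((j \<circ> v) ` topspace K)"
    by (intro weak_Hausdorff_closed_image[OF Y] continuous_map_compose[OF _ j])
  then have "closedin Z {z \<in> topspace Z. j z \<in> (j \<circ> v) ` topspace K}"
    using j closedin_continuous_map_preimage by blast
  moreover have "{z \<in> topspace Z. j z \<in> (j \<circ> v) ` topspace K} = v ` topspace K"
    using continuous_map_image_subset_topspace[OF K(3)] inj_onD[OF inj] by fastforce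
  ultimately show "closedin Z (v ` topspace K)" by simp
qed

lemma weak_Hausdorff_subtopology: "weak_Hausdorff X \<Longrightarrow> weak_Hausdorff (subtopology X S)"
  by (rule weak_Hausdorff_injective[OF _ continuous_map_from_subtopology[OF continuous_map_id]]) auto

text \<open>The two projections of a test space have closed Hausdorff images, whose product is a
  closed Hausdorff subspace; the image of the test space is compact in it, hence closed.\<close>

lemma weak_Hausdorff_prod:
  assumes "weak_Hausdorff X" "weak_Hausdorff Y"
  shows "weak_Hausdorff (prod_topology X Y)"
proof (rule weak_HausdorffI)
  fix K v assume K: "compact_space K" "Hausdorff_space K" "continuous_map K (prod_topology X Y) v"
  then have c: "continuous_map K X (fst \<circ> v)" "continuous_map K Y (snd \<circ> v)"
    by (auto simp: continuous_map_pairwise)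
  let ?A = "(fst \<circ> v) ` topspace K" and ?B = "(snd \<circ> v) ` topspace K"
  note A = weak_Hausdorff_closed_image[OF assms(1) K(1,2) c(1)] weak_Hausdorff_image[OF assms(1) K(1,2) c(1)]
  note B = weak_Hausdorff_closed_image[OF assms(2) K(1,2) c(2)] weak_Hausdorff_image[OF assms(2) K(1,2) c(2)]
  let ?P = "subtopology (prod_topology X Y) (?A \<times> ?B)"
  have cl: "closedin (prod_topology X Y) (?A \<times> ?B)" using A(1) B(1) by (simp add: closedin_prod_Times_iff)
  have "Hausdorff_space ?P"
    using A(3) B(3) by (simp add: subtopology_Times Hausdorff_space_prod_topology)
  moreover have "compactin ?P (v ` topspace K)"
  proof (rule image_compactin)
    show "compactin K (topspace K)" using K(1) by (simp add: compact_space_def)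
    show "continuous_map K ?P v"
      using K(3) by (force intro: continuous_map_into_subtopology simp: mem_Times_iff)
  qed
  ultimately have "closedin ?P (v ` topspace K)" by (rule compactin_imp_closedin)
  then show "closedin (prod_topology X Y) (v ` topspace K)"
    using cl closedin_trans_full by blast
qed

lemma weak_Hausdorff_product:
  assumes "\<And>i. i \<in> I \<Longrightarrow> weak_Hausdorff (X i)"
  shows "weak_Hausdorff (product_topology X I)"
proof (rule weak_HausdorffI)
  fix K v assume K: "compact_space K" "Hausdorff_space K" "continuous_map K (product_topology X I) v"
  have c: "continuous_map K (X i) (\<lambda>k. v k i)" if "i \<in> I" for i
    using K(3) that by (simp add: continuous_map_componentwise)
  let ?A = "\<lambda>i. (\<lambda>k. v k i) ` topspace K"
  let ?P = "subtopology (product_topology X I) (Pi\<^sub>E I ?A)"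
  have A: "closedin (X i) (?A i)" "Hausdorff_space (subtopology (X i) (?A i))" if "i \<in> I" for i
    using weak_Hausdorff_closed_image[OF assms K(1,2) c] weak_Hausdorff_image[OF assms K(1,2) c] that
    by auto
  have cl: "closedin (product_topology X I) (Pi\<^sub>E I ?A)" using A(1) by (simp add: closedin_product_topology)
  have "Hausdorff_space ?P"
    using A(2) by (simp add: subtopology_product_topology Hausdorff_space_product_topology)
  moreover have "compactin ?P (v ` topspace K)"
  proof (rule image_compactin)
    show "compactin K (topspace K)" using K(1) by (simp add: compact_space_def)
    have "v k \<in> extensional I" if "k \<in> topspace K" for k
      using K(3) that by (auto simp: continuous_map_componentwise)
    then show "continuous_map K ?P v"
      using K(3) by (auto intro!: continuous_map_into_subtopology simp: PiE_def)
  qed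
  ultimately have "closedin ?P (v ` topspace K)" by (rule compactin_imp_closedin)
  then show "closedin (product_topology X I) (v ` topspace K)"
    using cl closedin_trans_full by blast
qed

text \<open>A compact Hausdorff subspace \<open>S\<close> becomes a test space once each point
  \<open>x\<close> is recoded as \<open>{{x}}\<close>, and its inclusion becomes a test map.\<close>

lemma openin_kify_subspace:
  fixes X :: "'a topology"
  assumes U: "openin (kify X) U" and S: "compactin X S" "Hausdorff_space (subtopology X S)"
  shows "openin (subtopology X S) (S \<inter> U)"
proof -
  let ?S = "subtopology X S" and ?j = "\<lambda>x. {{x}}"
  let ?g = "inv_into (topspace ?S) ?j"
  have top: "topspace ?S = S"
    using compactin_subset_topspace[OF S(1)] by (simp add: Int_absorb1)
  obtain K' where K': "homeomorphic_maps ?S K' ?j ?g"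
    using homeomorphic_copy[of ?j ?S] by (auto simp: inj_on_def)
  then have h: "?S homeomorphic_space K'" by (meson homeomorphic_space_def)
  have "continuous_map K' X ?g"
    using K' by (auto simp: homeomorphic_maps_def continuous_map_in_subtopology)
  moreover have "compact_space K'" "Hausdorff_space K'"
    using S h homeomorphic_compact_space homeomorphic_Hausdorff_space compact_space_subtopology by blast+
  ultimately have "openin K' {k \<in> topspace K'. ?g k \<in> U}"
    using U unfolding openin_kify by blast
  moreover have j: "continuous_map ?S K' ?j"
    using K' by (simp add: homeomorphic_maps_def)
  ultimately have "openin ?S {x \<in> topspace ?S. ?j x \<in> {k \<in> topspace K'. ?g k \<in> U}}"
    by (rule openin_continuous_map_preimage[rotated])
  moreover have "?g (?j x) = x" if "x \<in> S" for x
    using K' that unfolding homeomorphic_maps_def top by blast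
  then have "{x \<in> topspace ?S. ?j x \<in> {k \<in> topspace K'. ?g k \<in> U}} = S \<inter> U"
    using continuous_map_funspace[OF j] unfolding top by auto
  ultimately show ?thesis by (simp only:)
qed

text \<open>Here \<open>A\<close> may have any type: \<open>f\<close> factors through its image, a
  compact Hausdorff subspace of \<open>Z\<close>, to which \<open>openin_kify_subspace\<close>
  applies.\<close>

lemma openin_kify_preimage:
  assumes Z: "weak_Hausdorff Z" and A: "compact_space A" "Hausdorff_space A"
    and f: "continuous_map A Z f" and U: "openin (kify Z) U"
  shows "openin A {a \<in> topspace A. f a \<in> U}"
proof -
  let ?L = "f ` topspace A"
  have "openin (subtopology Z ?L) (?L \<inter> U)"
    using openin_kify_subspace[OF U] weak_Hausdorff_image[OF Z A f] by blast
  moreover have "continuous_map A (subtopology Z ?L) f"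
    using f by (simp add: continuous_map_into_subtopology)
  ultimately have "openin A {a \<in> topspace A. f a \<in> ?L \<inter> U}"
    by (rule openin_continuous_map_preimage[rotated])
  moreover have "{a \<in> topspace A. f a \<in> ?L \<inter> U} = {a \<in> topspace A. f a \<in> U}" by auto
  ultimately show ?thesis by simp
qed

lemma continuous_map_into_kify:
  assumes "weak_Hausdorff Z" "compact_space A" "Hausdorff_space A" "continuous_map A Z f"
  shows "continuous_map A (kify Z) f"
  using assms openin_kify_preimage[OF assms] by (simp add: continuous_map_def)

text \<open>The converse of \<open>openin_kify_subspace\<close>, since every test map factors
  through its image, a compact Hausdorff subspace.\<close>

lemma openin_kifyI:
  assumes X: "weak_Hausdorff X" and U: "U \<subseteq> topspace X"
    and S: "\<And>S. \<lbrakk>compactin X S; Hausdorff_space (subtopology X S)\<rbrakk> \<Longrightarrow> openin (subtopology X S) (S \<inter> U)"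
  shows "openin (kify X) U"
  unfolding openin_kify
proof (intro conjI U allI impI, elim conjE)
  fix K :: "'a set set topology" and v
  assume K: "compact_space K" "Hausdorff_space K" "continuous_map K X v"
  let ?L = "v ` topspace K"
  have "openin (subtopology X ?L) (?L \<inter> U)"
    using S weak_Hausdorff_image[OF X K] by blast
  moreover have "continuous_map K (subtopology X ?L) v"
    using K(3) by (simp add: continuous_map_into_subtopology)
  ultimately have "openin K {a \<in> topspace K. v a \<in> ?L \<inter> U}"
    by (rule openin_continuous_map_preimage[rotated])
  moreover have "{a \<in> topspace K. v a \<in> ?L \<inter> U} = {a \<in> topspace K. v a \<in> U}" by auto
  ultimately show "openin K {k \<in> topspace K. v k \<in> U}" by simp
qed

lemma cgwh_weak_Hausdorff: "cgwh X \<Longrightarrow> weak_Hausdorff X"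
  by (simp add: cgwh_def)

lemma cgwh_openinI:
  assumes "cgwh X" "U \<subseteq> topspace X"
    and "\<And>S. \<lbrakk>compactin X S; Hausdorff_space (subtopology X S)\<rbrakk> \<Longrightarrow> openin (subtopology X S) (S \<inter> U)"
  shows "openin X U"
  using openin_kifyI[of X U] assms by (simp add: cgwh_def)

section \<open>Mapping spaces\<close>

text \<open>A tube argument. Around \<open>a\<close> there is a closed, hence compact, neighbourhood
  \<open>N\<close> with \<open>N \<times> {x} \<subseteq> U\<close>, and the set \<open>W\<close> of
  all \<open>y\<close> with \<open>N \<times> {y} \<subseteq> U\<close> is open because its trace on
  each compact Hausdorff subspace of \<open>X\<close> is open.\<close>

lemma openin_prod_cgwhI:
  assumes A: "compact_space A" "Hausdorff_space A" and X: "cgwh X"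
    and U: "U \<subseteq> topspace A \<times> topspace X"
    and S: "\<And>S. \<lbrakk>compactin X S; Hausdorff_space (subtopology X S)\<rbrakk>
      \<Longrightarrow> openin (prod_topology A (subtopology X S)) (U \<inter> (topspace A \<times> S))"
  shows "openin (prod_topology A X) U"
  unfolding openin_prod_topology_alt
proof (intro allI impI)
  fix a x assume ax: "(a, x) \<in> U"
  then have a: "a \<in> topspace A" and x: "x \<in> topspace X" using U by auto
  \<comment> \<open>A one-point subspace is compact Hausdorff, so the hypothesis makes the slice of
    \<open>U\<close> over \<open>x\<close> open in \<open>A\<close>.\<close>
  have "Hausdorff_space (subtopology X {x})"
    by (simp add: Hausdorff_space_def)
  then have "openin (prod_topology A (subtopology X {x})) (U \<inter> (topspace A \<times> {x}))"
    using S x by simp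
  moreover have "continuous_map A (prod_topology A (subtopology X {x})) (\<lambda>b. (b, x))"
    using x by (intro continuous_map_pairedI) auto
  ultimately have "openin A {b \<in> topspace A. (b, x) \<in> U \<inter> (topspace A \<times> {x})}"
    by (rule openin_continuous_map_preimage[rotated])
  moreover have "regular_space A" using A compact_Hausdorff_imp_regular_space by blast
  ultimately obtain M N where M: "openin A M" "closedin A N" "a \<in> M" "M \<subseteq> N"
      "N \<subseteq> {b \<in> topspace A. (b, x) \<in> U \<inter> (topspace A \<times> {x})}"
    using ax a unfolding neighbourhood_base_of_closedin[symmetric] neighbourhood_base_of
    by (metis (no_types, lifting) IntI SigmaI insertI1 mem_Collect_eq)
  have Nsub: "N \<subseteq> topspace A" using M(2) closedin_subset by blast
  have cN: "compact_space (subtopology A N)"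
    using M(2) A(1) closedin_compact_space compact_space_subtopology by blast
  define W where "W = {y \<in> topspace X. N \<times> {y} \<subseteq> U}"
  have "openin X W"
  proof (rule cgwh_openinI[OF X])
    fix T assume T: "compactin X T" "Hausdorff_space (subtopology X T)"
    have sub: "T \<subseteq> topspace X" using T(1) compactin_subset_topspace by blast
    have "openin (prod_topology A (subtopology X T)) (U \<inter> (topspace A \<times> T))"
      using S T by blast
    then have "openin (subtopology (prod_topology A (subtopology X T)) (N \<times> topspace X))
        (U \<inter> (topspace A \<times> T) \<inter> (N \<times> topspace X))"
      by (rule openin_subtopology_Int)
    moreover have "subtopology (prod_topology A (subtopology X T)) (N \<times> topspace X)
        = prod_topology (subtopology A N) (subtopology X T)"
      using sub by (simp add: prod_topology_subtopology subtopology_subtopology Times_Int_Times Int_absorb1 Int_absorb2)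
    moreover have "U \<inter> (topspace A \<times> T) \<inter> (N \<times> topspace X) = U \<inter> (N \<times> T)"
      using sub Nsub by auto
    ultimately have "openin (prod_topology (subtopology A N) (subtopology X T)) (U \<inter> (N \<times> T))"
      by simp
    then have "closedin (prod_topology (subtopology A N) (subtopology X T)) (N \<times> T - U \<inter> (N \<times> T))"
      using sub Nsub by (metis (no_types) Int_absorb1 closedin_diff closedin_topspace topspace_prod_topology topspace_subtopology)
    \<comment> \<open>Projection along the compact \<open>N\<close> is a closed map; it takes the
      complement of \<open>U\<close> to the points of \<open>T\<close> outside
      \<open>W\<close>.\<close>
    then have "closedin (subtopology X T) (snd ` (N \<times> T - U \<inter> (N \<times> T)))"
      using closed_map_snd[OF cN] unfolding closed_map_def by blast
    then have "openin (subtopology X T) (T - snd ` (N \<times> T - U \<inter> (N \<times> T)))"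
      using sub by (metis Int_absorb1 openin_diff openin_topspace topspace_subtopology)
    moreover have "T - snd ` (N \<times> T - U \<inter> (N \<times> T)) = T \<inter> W"
      using sub unfolding W_def by force
    ultimately show "openin (subtopology X T) (T \<inter> W)" by simp
  qed (auto simp: W_def)
  moreover have "x \<in> W" using x M(5) by (auto simp: W_def)
  moreover have "M \<times> W \<subseteq> U" using M(4) by (auto simp: W_def)
  ultimately show "\<exists>M W. openin A M \<and> openin X W \<and> a \<in> M \<and> x \<in> W \<and> M \<times> W \<subseteq> U"
    using M(1,3) by blast
qed

text \<open>A k-open set meets each compact Hausdorff subspace \<open>topspace A \<times> S\<close>
  in an open set, which is what \<open>openin_prod_cgwhI\<close> asks for. This turns the
  \<open>kprod\<close> of \<open>ind_lev\<close> into an ordinary product.\<close>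

lemma kify_prod_cgwh:
  assumes A: "compact_space A" "Hausdorff_space A" and X: "cgwh X"
  shows "kify (prod_topology A X) = prod_topology A X"
  unfolding topology_eq
proof (intro allI iffI openin_imp_openin_kify)
  fix U assume U: "openin (kify (prod_topology A X)) U"
  show "openin (prod_topology A X) U"
  proof (rule openin_prod_cgwhI[OF A X])
    show "U \<subseteq> topspace A \<times> topspace X"
      using openin_subset[OF U] by simp
    fix S assume S: "compactin X S" "Hausdorff_space (subtopology X S)"
    let ?T = "topspace A \<times> S"
    have eq: "subtopology (prod_topology A X) ?T = prod_topology A (subtopology X S)"
      by (simp add: subtopology_Times)
    have "openin (subtopology (prod_topology A X) ?T) (?T \<inter> U)"
    proof (rule openin_kify_subspace[OF U])
      show "compactin (prod_topology A X) ?T"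
        using A(1) S(1) by (simp add: compactin_Times compact_space_def)
      show "Hausdorff_space (subtopology (prod_topology A X) ?T)"
        using A(2) S(2) unfolding eq by (simp add: Hausdorff_space_prod_topology)
    qed
    then show "openin (prod_topology A (subtopology X S)) (U \<inter> (topspace A \<times> S))"
      unfolding eq by (simp add: Int_commute)
  qed
qed

section \<open>The exponential law with compact Hausdorff parameters\<close>

lemma topspace_compact_open [simp]: "topspace (compact_open X Y) = cont_maps X Y"
proof -
  let ?B = "{{f \<in> cont_maps X Y. f ` K \<subseteq> U} | K U.
        compactin X K \<and> Hausdorff_space (subtopology X K) \<and> openin Y U}"
  \<comment> \<open>With \<open>K\<close> empty the subbasic set is all of
    \<open>cont_maps X Y\<close>.\<close>
  have "{f \<in> cont_maps X Y. f ` {} \<subseteq> topspace Y} \<in> ?B"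
    by (intro CollectI exI[of _ "{}"] exI[of _ "topspace Y"]) (simp add: Hausdorff_space_def)
  then have "\<Union>?B = cont_maps X Y" by fastforce
  then show ?thesis by (simp add: compact_open_def)
qed

lemma openin_compact_open:
  assumes "compactin X K" "Hausdorff_space (subtopology X K)" "openin Y U"
  shows "openin (compact_open X Y) {f \<in> cont_maps X Y. f ` K \<subseteq> U}"
  unfolding compact_open_def by (rule topology_generated_by_Basis) (use assms in blast)

lemma continuous_map_compact_open_eval:
  assumes "x \<in> topspace X"
  shows "continuous_map (compact_open X Y) Y (\<lambda>f. f x)"
  unfolding continuous_map_def
proof (intro conjI allI impI)
  show "(\<lambda>f. f x) \<in> topspace (compact_open X Y) \<rightarrow> topspace Y"
    using assms by (auto simp: cont_maps_def continuous_map_def)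
  fix U assume "openin Y U"
  moreover have "Hausdorff_space (subtopology X {x})" by (simp add: Hausdorff_space_def)
  ultimately have "openin (compact_open X Y) {f \<in> cont_maps X Y. f ` {x} \<subseteq> U}"
    using assms by (intro openin_compact_open) auto
  then show "openin (compact_open X Y) {f \<in> topspace (compact_open X Y). f x \<in> U}"
    by simp
qed

text \<open>The compact-open topology is finer than that of pointwise convergence, which sits in a
  power of \<open>Y\<close>.\<close>

lemma weak_Hausdorff_compact_open:
  assumes "weak_Hausdorff Y"
  shows "weak_Hausdorff (compact_open X Y)"
proof (rule weak_Hausdorff_injective[of _ _ "\<lambda>f. f"])
  show "weak_Hausdorff (product_topology (\<lambda>_. Y) (topspace X))"
    using assms by (rule weak_Hausdorff_product)
  show "continuous_map (compact_open X Y) (product_topology (\<lambda>_. Y) (topspace X)) (\<lambda>f. f)"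
    by (auto simp: continuous_map_componentwise continuous_map_compact_open_eval cont_maps_def)
qed auto

text \<open>By \<open>openin_prod_cgwhI\<close>, openness is to be checked only over a compact
  Hausdorff subspace \<open>S\<close> of \<open>X\<close>. There \<open>x\<close> has a compact
  neighbourhood \<open>N\<close> that \<open>\<alpha> a\<close> sends into \<open>W\<close>, and the
  maps sending \<open>N\<close> into \<open>W\<close> form a subbasic open set.\<close>

lemma continuous_map_uncurry:
  assumes A: "compact_space A" "Hausdorff_space A" and X: "cgwh X"
    and \<alpha>: "continuous_map A (compact_open X Y) \<alpha>"
  shows "continuous_map (prod_topology A X) Y (\<lambda>(a, x). \<alpha> a x)"
  unfolding continuous_map_def
proof (intro conjI allI impI)
  have cont: "continuous_map X Y (\<alpha> a)" if "a \<in> topspace A" for a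
    using \<alpha> that by (auto simp: continuous_map_def cont_maps_def)
  then show "(\<lambda>(a, x). \<alpha> a x) \<in> topspace (prod_topology A X) \<rightarrow> topspace Y"
    by (auto simp: continuous_map_def)
  fix W assume W: "openin Y W"
  let ?U = "{p \<in> topspace (prod_topology A X). (\<lambda>(a, x). \<alpha> a x) p \<in> W}"
  show "openin (prod_topology A X) ?U"
  proof (rule openin_prod_cgwhI[OF A X])
    fix S assume S: "compactin X S" "Hausdorff_space (subtopology X S)"
    have sub: "S \<subseteq> topspace X" using S(1) compactin_subset_topspace by blast
    have reg: "regular_space (subtopology X S)"
      using S compact_Hausdorff_imp_regular_space compact_space_subtopology by blast
    show "openin (prod_topology A (subtopology X S)) (?U \<inter> (topspace A \<times> S))"
      unfolding openin_prod_topology_alt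
    proof (intro allI impI)
      fix a x assume "(a, x) \<in> ?U \<inter> (topspace A \<times> S)"
      then have ax: "a \<in> topspace A" "x \<in> S" "\<alpha> a x \<in> W" by auto
      have "continuous_map (subtopology X S) Y (\<alpha> a)"
        using cont ax(1) continuous_map_from_subtopology by blast
      then have "openin (subtopology X S) {z \<in> topspace (subtopology X S). \<alpha> a z \<in> W}"
        using W by (rule openin_continuous_map_preimage)
      moreover have "x \<in> {z \<in> topspace (subtopology X S). \<alpha> a z \<in> W}" using ax sub by auto
      ultimately obtain M N where M: "openin (subtopology X S) M" "closedin (subtopology X S) N"
          "x \<in> M" "M \<subseteq> N" "N \<subseteq> {z \<in> topspace (subtopology X S). \<alpha> a z \<in> W}"
        using reg unfolding neighbourhood_base_of_closedin[symmetric] neighbourhood_base_of by meson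
      have NS: "N \<subseteq> S" using M(5) by auto
      have "compactin X N"
        using M(2) S(1) NS by (metis closedin_compact_space compact_space_subtopology compactin_subtopology)
      moreover have "Hausdorff_space (subtopology X N)"
        using S(2) NS by (metis Hausdorff_space_subtopology inf.absorb_iff2 subtopology_subtopology)
      ultimately have "openin (compact_open X Y) {f \<in> cont_maps X Y. f ` N \<subseteq> W}"
        using W by (intro openin_compact_open)
      then have "openin A {b \<in> topspace A. \<alpha> b \<in> {f \<in> cont_maps X Y. f ` N \<subseteq> W}}" (is "openin A ?B")
        using \<alpha> openin_continuous_map_preimage by blast
      moreover have "a \<in> ?B"
        using \<alpha> ax(1) M(5) by (auto simp: continuous_map_def)
      moreover have "?B \<times> M \<subseteq> ?U \<inter> (topspace A \<times> S)"
        using M(4) NS sub by (auto simp: image_subset_iff)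
      ultimately show "\<exists>B M. openin A B \<and> openin (subtopology X S) M \<and> a \<in> B \<and> x \<in> M \<and>
          B \<times> M \<subseteq> ?U \<inter> (topspace A \<times> S)"
        using M(1,3) by blast
    qed
  qed auto
qed

text \<open>The parameters whose map fails to send \<open>K\<close> into \<open>U\<close> form the
  projection, along the compact \<open>K\<close>, of the closed set where the joint map takes values
  outside \<open>U\<close>.\<close>

lemma continuous_map_curry:
  assumes \<beta>: "continuous_map (prod_topology A X) Y (\<lambda>(a, x). \<alpha> a x)"
    and ext: "\<And>a. a \<in> topspace A \<Longrightarrow> \<alpha> a \<in> extensional (topspace X)"
  shows "continuous_map A (compact_open X Y) \<alpha>"
proof -
  have cont: "\<alpha> a \<in> cont_maps X Y" if "a \<in> topspace A" for a
  proof -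
    have "continuous_map X (prod_topology A X) (\<lambda>x. (a, x))"
      using that by (intro continuous_map_pairedI) auto
    from continuous_map_compose[OF this \<beta>] show ?thesis
      using ext that by (simp add: cont_maps_def o_def)
  qed
  show ?thesis
    unfolding compact_open_def continuous_on_generated_topo_iff
  proof (intro conjI allI impI)
    show "\<alpha> ` topspace A \<subseteq> \<Union>{{f \<in> cont_maps X Y. f ` K \<subseteq> U} | K U.
        compactin X K \<and> Hausdorff_space (subtopology X K) \<and> openin Y U}"
      using cont topspace_compact_open[of X Y] unfolding compact_open_def by auto
    fix B assume "B \<in> {{f \<in> cont_maps X Y. f ` K \<subseteq> U} | K U.
        compactin X K \<and> Hausdorff_space (subtopology X K) \<and> openin Y U}"
    then obtain K U where B: "B = {f \<in> cont_maps X Y. f ` K \<subseteq> U}" and K: "compactin X K" and U: "openin Y U"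
      by blast
    have sub: "K \<subseteq> topspace X" using K compactin_subset_topspace by blast
    have "continuous_map (prod_topology A (subtopology X K)) Y (\<lambda>(a, x). \<alpha> a x)"
      using continuous_map_from_subtopology[OF \<beta>, of "topspace A \<times> K"] by (simp add: subtopology_Times)
    then have "closedin (prod_topology A (subtopology X K))
        {p \<in> topspace (prod_topology A (subtopology X K)). (\<lambda>(a, x). \<alpha> a x) p \<in> topspace Y - U}" (is "closedin _ ?C")
      by (rule closedin_continuous_map_preimage) (simp add: U closedin_diff)
    moreover have "compact_space (subtopology X K)" using K compact_space_subtopology by blast
    ultimately have "closedin A (fst ` ?C)"
      using closed_map_fst unfolding closed_map_def by blast
    then have "openin A (topspace A - fst ` ?C)" by blast
    moreover have Y: "\<alpha> a x \<in> topspace Y" if "a \<in> topspace A" "x \<in> K" for a x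
      using cont[OF that(1)] sub that(2) by (auto simp: cont_maps_def continuous_map_def)
    have "fst ` ?C = {a \<in> topspace A. \<exists>x \<in> K. \<alpha> a x \<notin> U}"
    proof (intro equalityI subsetI)
      fix a assume "a \<in> {a \<in> topspace A. \<exists>x \<in> K. \<alpha> a x \<notin> U}"
      then obtain x where "a \<in> topspace A" "x \<in> K" "\<alpha> a x \<notin> U" by blast
      then have "(a, x) \<in> ?C" using Y sub by auto
      then show "a \<in> fst ` ?C" by (metis fst_conv image_eqI)
    qed auto
    then have "topspace A - fst ` ?C = \<alpha> -` B \<inter> topspace A"
      using cont by (auto simp: B image_subset_iff)
    ultimately show "openin A (\<alpha> -` B \<inter> topspace A)" by simp
  qed
qed

lemma topspace_based_map_space [simp]:
  "topspace (based_map_space X x Y y) = {f \<in> cont_maps X Y. f x = y}"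
  by (auto simp: based_map_space_def)

text \<open>A map from a compact Hausdorff space to a weak Hausdorff space stays continuous after
  k-ification of the target, so the \<open>kify\<close> in \<open>based_map_space\<close> is
  harmless and currying gives the rest.\<close>

lemma continuous_map_based_map_space_iff:
  assumes A: "compact_space A" "Hausdorff_space A" and X: "cgwh X" and Y: "weak_Hausdorff Y"
  shows "continuous_map A (based_map_space X x Y y) \<alpha> \<longleftrightarrow>
    (\<forall>a \<in> topspace A. \<alpha> a \<in> extensional (topspace X) \<and> \<alpha> a x = y) \<and>
    continuous_map (prod_topology A X) Y (\<lambda>(a, x). \<alpha> a x)"  (is "?L \<longleftrightarrow> ?R")
proof
  assume L: ?L
  then have "continuous_map A (compact_open X Y) \<alpha>"
    unfolding based_map_space_def by (meson continuous_map_from_kify continuous_map_in_subtopology)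
  then have "continuous_map (prod_topology A X) Y (\<lambda>(a, x). \<alpha> a x)"
    by (rule continuous_map_uncurry[OF A X])
  with L show ?R
    using continuous_map_funspace[OF L] by (auto simp: cont_maps_def)
next
  assume R: ?R
  then have "continuous_map A (compact_open X Y) \<alpha>"
    by (intro continuous_map_curry) auto
  then have "continuous_map A (subtopology (compact_open X Y) {f. f x = y}) \<alpha>"
    using R by (intro continuous_map_into_subtopology) auto
  then show ?L
    unfolding based_map_space_def
    by (intro continuous_map_into_kify[OF _ A] weak_Hausdorff_subtopology weak_Hausdorff_compact_open Y)
qed

section \<open>Quotients of products with a compact space\<close>

lemma istopology_quot:
  "istopology (\<lambda>U. U \<subseteq> q ` topspace X \<and> openin X {x \<in> topspace X. q x \<in> U})"
proof -
  have 1: "openin X {x \<in> topspace X. q x \<in> S \<inter> T}"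
    if "openin X {x \<in> topspace X. q x \<in> S}" "openin X {x \<in> topspace X. q x \<in> T}" for S T
    using openin_Int[OF that] by (rule back_subst) auto
  have 2: "openin X {x \<in> topspace X. q x \<in> \<Union>\<K>}"
    if "\<And>S. S \<in> \<K> \<Longrightarrow> openin X {x \<in> topspace X. q x \<in> S}" for \<K>
  proof -
    have "openin X (\<Union>S\<in>\<K>. {x \<in> topspace X. q x \<in> S})"
      using that by (intro openin_Union) auto
    then show ?thesis by (rule back_subst) auto
  qed
  show ?thesis
    unfolding istopology_def by (intro conjI allI impI 1 2) (auto simp del: Union_iff)
qed

lemma openin_quot_topology:
  "openin (quot_topology X q) U \<longleftrightarrow> U \<subseteq> q ` topspace X \<and> openin X {x \<in> topspace X. q x \<in> U}"
  unfolding quot_topology_def by (subst topology_inverse'[OF istopology_quot]) simp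

lemma topspace_quot_topology [simp]: "topspace (quot_topology X q) = q ` topspace X"
proof
  show "topspace (quot_topology X q) \<subseteq> q ` topspace X"
    using openin_quot_topology[of X q "topspace (quot_topology X q)"] by simp
  have "{x \<in> topspace X. q x \<in> q ` topspace X} = topspace X" by auto
  then have "openin (quot_topology X q) (q ` topspace X)" by (simp add: openin_quot_topology)
  then show "q ` topspace X \<subseteq> topspace (quot_topology X q)" by (rule openin_subset)
qed

lemma quotient_map_quot_topology: "quotient_map X (quot_topology X q) q"
  unfolding quotient_map_def by (auto simp: openin_quot_topology)

text \<open>
  Over a test space \<open>K\<close> of the quotient, the pullback of the proper map \<open>q\<close> is compact, and it
  injects into \<open>K \<times> G\<close>, so it is again a test space.
\<close>

lemma cgwh_quot_topology:
  fixes q :: "'g \<times> 'x \<Rightarrow> 'y"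
  assumes G: "compact_space G" "Hausdorff_space G" and X: "cgwh X"
    and closed: "\<And>C. closedin (prod_topology G X) C \<Longrightarrow>
      closedin (prod_topology G X) {p \<in> topspace (prod_topology G X). q p \<in> q ` C}"
    and fibre: "\<And>p. p \<in> topspace (prod_topology G X) \<Longrightarrow>
      compactin (prod_topology G X) {p' \<in> topspace (prod_topology G X). q p' = q p}"
    and inj: "\<And>g x x'. \<lbrakk>g \<in> topspace G; x \<in> topspace X; x' \<in> topspace X; q (g, x) = q (g, x')\<rbrakk> \<Longrightarrow> x = x'"
  shows "cgwh (quot_topology (prod_topology G X) q)"
proof -
  let ?P = "prod_topology G X"
  let ?Q = "quot_topology ?P q"
  note quot = quotient_map_quot_topology[of ?P q]
  have cq: "continuous_map ?P ?Q q" using quot by (rule quotient_imp_continuous_map)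
  have closedQ: "closedin ?Q D" if "D \<subseteq> topspace ?Q" "closedin ?P {p \<in> topspace ?P. q p \<in> D}" for D
    using quot that unfolding quotient_map_closedin by blast
  have "closed_map ?P ?Q q"
    unfolding closed_map_def
  proof (intro allI impI)
    fix C assume C: "closedin ?P C"
    then have "q ` C \<subseteq> topspace ?Q" using closedin_subset[OF C] by auto
    then show "closedin ?Q (q ` C)" using closed[OF C] by (rule closedQ)
  qed
  then have proper: "proper_map ?P ?Q q"
    unfolding proper_map_def using fibre by auto
  have wP: "weak_Hausdorff ?P"
    using weak_Hausdorff_prod Hausdorff_imp_weak_Hausdorff G(2) cgwh_weak_Hausdorff X by blast
  have wQ: "weak_Hausdorff ?Q"
  proof (rule weak_HausdorffI)
    fix K :: "'y set set topology" and v
    assume K: "compact_space K" "Hausdorff_space K" "continuous_map K ?Q v"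
    \<comment> \<open>The preimage of the graph \<open>?\<Gamma>\<close> under \<open>?f\<close> is
      the pullback of \<open>v\<close> and \<open>q\<close>; it is compact because
      \<open>?f\<close>, a product of proper maps, is proper.\<close>
    let ?f = "\<lambda>(k, p). (k, q p)"
    let ?\<Gamma> = "(\<lambda>k. (k, v k)) ` topspace K"
    have "proper_map (prod_topology K ?P) (prod_topology K ?Q) ?f"
      using proper proper_map_prod[of K ?P K ?Q "\<lambda>k. k" q] proper_map_id[of K]
      by (simp add: id_def)
    moreover have "compactin (prod_topology K ?Q) ?\<Gamma>"
    proof (rule image_compactin)
      show "compactin K (topspace K)" using K(1) by (simp add: compact_space_def)
      show "continuous_map K (prod_topology K ?Q) (\<lambda>k. (k, v k))"
        using K(3) by (intro continuous_map_pairedI) auto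
    qed
    ultimately have "compactin (prod_topology K ?P) {z \<in> topspace (prod_topology K ?P). ?f z \<in> ?\<Gamma>}"
      (is "compactin _ ?S") by (rule compactin_proper_map_preimage)
    then have cT: "compact_space (subtopology (prod_topology K ?P) ?S)"
      by (rule compact_space_subtopology)
    let ?T = "subtopology (prod_topology K ?P) ?S"
    have top: "topspace ?T = ?S" by (simp add: Int_absorb1)
    have cs: "continuous_map ?T ?P snd"
      by (intro continuous_map_from_subtopology continuous_map_snd)
    \<comment> \<open>\<open>X\<close> itself need not be Hausdorff. On the pullback,
      \<open>k\<close> determines the class \<open>v k\<close> of \<open>(g, x)\<close>, and this
      class together with \<open>g\<close> determines \<open>x\<close> by
      \<open>inj\<close>.\<close>
    have "Hausdorff_space ?T"
    proof (rule Hausdorff_space_injective_preimage)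
      show "Hausdorff_space (prod_topology K G)"
        using K(2) G(2) by (simp add: Hausdorff_space_prod_topology)
      show "continuous_map ?T (prod_topology K G) (\<lambda>z. (fst z, fst (snd z)))"
        using continuous_map_compose[OF cs continuous_map_fst]
        by (intro continuous_map_pairedI continuous_map_from_subtopology[OF continuous_map_fst]) (simp add: o_def)
      show "inj_on (\<lambda>z. (fst z, fst (snd z))) (topspace ?T)"
        unfolding top by (rule inj_onI) (auto dest: inj)
    qed
    moreover note cs
    ultimately have "closedin ?P (snd ` topspace ?T)"
      by (rule weak_Hausdorff_closed_image[OF wP cT])
    moreover have "snd ` topspace ?T = {p \<in> topspace ?P. q p \<in> v ` topspace K}"
      unfolding top by force
    ultimately have "closedin ?P {p \<in> topspace ?P. q p \<in> v ` topspace K}" by simp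
    with continuous_map_image_subset_topspace[OF K(3)] show "closedin ?Q (v ` topspace K)"
      by (rule closedQ)
  qed
  moreover have "kify ?Q = ?Q"
    unfolding topology_eq
  proof (intro allI iffI openin_imp_openin_kify)
    fix U assume U: "openin (kify ?Q) U"
    \<comment> \<open>The test spaces for \<open>?P\<close> have another type than those for
      \<open>?Q\<close>; \<open>openin_kify_preimage\<close> applies to them because
      \<open>?Q\<close> is already known to be weak Hausdorff.\<close>
    have "openin (kify ?P) {p \<in> topspace ?P. q p \<in> U}"
      unfolding openin_kify
    proof (intro conjI allI impI)
      fix K :: "('g \<times> 'x) set set topology" and w
      assume "compact_space K \<and> Hausdorff_space K \<and> continuous_map K ?P w"
      then have K: "compact_space K" "Hausdorff_space K" "continuous_map K ?P w" by auto
      have "openin K {k \<in> topspace K. (q \<circ> w) k \<in> U}"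
        using wQ K(1,2) continuous_map_compose[OF K(3) cq] U by (rule openin_kify_preimage)
      moreover have "{k \<in> topspace K. (q \<circ> w) k \<in> U} = {k \<in> topspace K. w k \<in> {p \<in> topspace ?P. q p \<in> U}}"
        using continuous_map_funspace[OF K(3)] by auto
      ultimately show "openin K {k \<in> topspace K. w k \<in> {p \<in> topspace ?P. q p \<in> U}}" by simp
    qed auto
    then have "openin ?P {p \<in> topspace ?P. q p \<in> U}"
      by (simp add: kify_prod_cgwh[OF G X])
    moreover have "U \<subseteq> topspace ?Q" using openin_subset[OF U] by simp
    ultimately show "openin ?Q U" by (simp add: openin_quot_topology)
  qed
  ultimately show ?thesis by (simp add: cgwh_def)
qed

section \<open>The morphism spaces are compact Hausdorff\<close>

text \<open>Unlike \<open>vec_infty F\<close> it imposes no finite support, so it is closed in the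
  product topology; it is the domain on which the projections below are linear.\<close>

definition vec_F :: "complex set \<Rightarrow> vec set" where
  "vec_F F = {v. \<forall>i. v i \<in> F}"

lemma closed_vec_F:
  assumes "F = \<real> \<or> F = UNIV"
  shows "closed (vec_F F)"
proof -
  have "closed F" using assms closed_complex_Reals by auto
  then have "closed {v :: vec. v i \<in> F}" for i
    by (rule closed_vimage[unfolded vimage_def]) (rule continuous_on_product_coordinates)
  then show ?thesis unfolding vec_F_def by (rule closed_Collect_all)
qed

text \<open>If \<open>B\<close> spans \<open>V\<close>, such a \<open>P\<close> retracts
  \<open>vec_F F\<close> onto \<open>V\<close> continuously and linearly, which displays
  \<open>V\<close> as a set of fixed points.\<close>

definition vec_projection :: "complex set \<Rightarrow> vec set \<Rightarrow> vec set \<Rightarrow> (vec \<Rightarrow> vec) \<Rightarrow> bool" where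
  "vec_projection F V B P \<longleftrightarrow> (\<forall>i. continuous_on UNIV (\<lambda>v. P v i)) \<and>
     (\<forall>v \<in> vec_F F. \<forall>w \<in> vec_F F. P (\<lambda>i. v i + w i) = (\<lambda>i. P v i + P w i)) \<and>
     (\<forall>a \<in> F. \<forall>v \<in> vec_F F. P (\<lambda>i. a * v i) = (\<lambda>i. a * P v i)) \<and>
     (\<forall>v \<in> vec_F F. P v \<in> V) \<and> (\<forall>b \<in> B. P b = b)"

text \<open>Gaussian elimination, one vector at a time: if \<open>P\<close> does not yet fix the new
  vector \<open>b\<close>, the residue \<open>c = b - P b\<close> is a nonzero element of
  \<open>V\<close>, and \<open>P\<close> is corrected by a multiple of \<open>c\<close>.\<close>

lemma fd_spaces_projection:
  assumes F: "F = \<real> \<or> F = UNIV" and V: "V \<in> fd_spaces F" and B: "finite B" "B \<subseteq> V"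
  shows "\<exists>P. vec_projection F V B P"
  using B
proof (induction B)
  case empty
  have "(\<lambda>i. 0) \<in> V" using V by (simp add: fd_spaces_def)
  then show ?case by (intro exI[of _ "\<lambda>v i. 0"]) (auto simp: vec_projection_def)
next
  case (insert b B)
  then obtain P where proj: "vec_projection F V B P" by auto
  then have P: "\<And>i. continuous_on UNIV (\<lambda>v. P v i)"
      "\<And>v w. v \<in> vec_F F \<Longrightarrow> w \<in> vec_F F \<Longrightarrow> P (\<lambda>i. v i + w i) = (\<lambda>i. P v i + P w i)"
      "\<And>a v. a \<in> F \<Longrightarrow> v \<in> vec_F F \<Longrightarrow> P (\<lambda>i. a * v i) = (\<lambda>i. a * P v i)"
      "\<And>v. v \<in> vec_F F \<Longrightarrow> P v \<in> V" "\<And>x. x \<in> B \<Longrightarrow> P x = x"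
    by (simp_all add: vec_projection_def)
  have add: "(\<lambda>i. v i + w i) \<in> V" if "v \<in> V" "w \<in> V" for v w using V that by (simp add: fd_spaces_def)
  have scale: "(\<lambda>i. a * v i) \<in> V" if "a \<in> F" "v \<in> V" for a v using V that by (simp add: fd_spaces_def)
  have VF: "V \<subseteq> vec_F F" using V by (auto simp: fd_spaces_def vec_infty_def vec_F_def)
  have F_ops: "-1 \<in> F" "x \<in> F \<Longrightarrow> y \<in> F \<Longrightarrow> x - y \<in> F" "x \<in> F \<Longrightarrow> y \<in> F \<Longrightarrow> x / y \<in> F" for x y
    using F by (auto intro: Reals_diff Reals_divide)
  have bV: "b \<in> V" using insert.prems by simp
  define c where "c i = b i - P b i" for i
  have "(\<lambda>i. b i + (-1) * P b i) \<in> V"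
    using add[OF bV scale[OF F_ops(1)]] P(4) VF bV by blast
  then have cV: "c \<in> V" by (simp add: c_def[abs_def])
  show ?case
  proof (cases "\<exists>i. c i \<noteq> 0")
    case False
    then have "P b = b" by (auto simp: c_def)
    then show ?thesis using proj by (intro exI[of _ P]) (simp add: vec_projection_def)
  next
    case True
    then obtain k where k: "c k \<noteq> 0" by blast
    \<comment> \<open>The coefficient is the \<open>k\<close>-th coordinate of
      \<open>v - P v\<close> divided by that of \<open>c\<close>. It is 1 at \<open>v = b\<close>,
      giving \<open>P b + c = b\<close>, and 0 at the vectors that \<open>P\<close> already
      fixes.\<close>
    let ?P = "\<lambda>v i. P v i + (v k - P v k) / c k * c i"
    have "continuous_on UNIV (\<lambda>v. ?P v i)" for i
      using k by (intro continuous_intros P(1) continuous_on_product_coordinates) auto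
    moreover have "?P (\<lambda>i. v i + w i) = (\<lambda>i. ?P v i + ?P w i)" if "v \<in> vec_F F" "w \<in> vec_F F" for v w
      using k by (auto simp: P(2)[OF that] field_simps)
    moreover have "?P (\<lambda>i. a * v i) = (\<lambda>i. a * ?P v i)" if "a \<in> F" "v \<in> vec_F F" for a v
      using k by (auto simp: P(3)[OF that] field_simps)
    moreover have "?P v \<in> V" if "v \<in> vec_F F" for v
    proof (intro add scale P(4) that cV F_ops)
      show "v k \<in> F" "P v k \<in> F" "c k \<in> F"
        using that cV P(4)[OF that] VF by (auto simp: vec_F_def)
    qed
    moreover have "?P x = x" if "x \<in> insert b B" for x
      using that k P(5) by (auto simp: c_def)
    ultimately show ?thesis by (intro exI[of _ ?P]) (simp add: vec_projection_def)
  qed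
qed

lemma fd_spaces_spanning:
  assumes "V \<in> fd_spaces F"
  shows "\<exists>B. finite B \<and> B \<subseteq> V \<and>
      (\<forall>v \<in> V. \<exists>c. (\<forall>b \<in> B. c b \<in> F) \<and> v = (\<lambda>i. \<Sum>b\<in>B. c b * b i))"
  using assms by (simp add: fd_spaces_def)

text \<open>\<open>V\<close> consists of the points of the closed set \<open>vec_F F\<close> that a
  continuous projection fixes.\<close>

lemma closed_fd_spaces:
  assumes F: "F = \<real> \<or> F = UNIV" and V: "V \<in> fd_spaces F"
  shows "closed V"
proof -
  have VF: "V \<subseteq> vec_F F" using V by (auto simp: fd_spaces_def vec_infty_def vec_F_def)
  obtain B where "finite B \<and> B \<subseteq> V \<and>
      (\<forall>v \<in> V. \<exists>c. (\<forall>b \<in> B. c b \<in> F) \<and> v = (\<lambda>i. \<Sum>b\<in>B. c b * b i))"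
    using fd_spaces_spanning[OF V] ..
  then have B: "finite B" "B \<subseteq> V"
      "\<And>v. v \<in> V \<Longrightarrow> \<exists>c. (\<forall>b \<in> B. c b \<in> F) \<and> v = (\<lambda>i. \<Sum>b\<in>B. c b * b i)"
    by simp_all
  obtain P where "vec_projection F V B P"
    using fd_spaces_projection[OF F V B(1,2)] by blast
  then have P: "\<And>i. continuous_on UNIV (\<lambda>v. P v i)"
      "\<And>v w. v \<in> vec_F F \<Longrightarrow> w \<in> vec_F F \<Longrightarrow> P (\<lambda>i. v i + w i) = (\<lambda>i. P v i + P w i)"
      "\<And>a v. a \<in> F \<Longrightarrow> v \<in> vec_F F \<Longrightarrow> P (\<lambda>i. a * v i) = (\<lambda>i. a * P v i)"
      "\<And>v. v \<in> vec_F F \<Longrightarrow> P v \<in> V" "\<And>x. x \<in> B \<Longrightarrow> P x = x"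
    by (simp_all add: vec_projection_def)
  have "P (\<lambda>i. \<Sum>b\<in>C. c b * b i) = (\<lambda>i. \<Sum>b\<in>C. c b * b i) \<and> (\<lambda>i. \<Sum>b\<in>C. c b * b i) \<in> V"
    if "finite C" "C \<subseteq> B" "\<forall>b \<in> B. c b \<in> F" for C c
    using that
  proof (induction C)
    case empty
    have "(\<lambda>i. 0) \<in> V" using V by (simp add: fd_spaces_def)
    moreover have "0 \<in> F" using F by auto
    \<comment> \<open>Homogeneity with the scalar 0 shows that \<open>P\<close> sends the zero
      vector to itself.\<close>
    moreover have "P (\<lambda>i. 0 * 0) = (\<lambda>i. 0 * P (\<lambda>i. 0) i)"
      using calculation VF by (intro P(3)) auto
    ultimately show ?case by simp
  next
    case (insert b C)
    then have b: "b \<in> V" "c b \<in> F" "b \<in> B" using B(2) by auto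
    then have cb: "(\<lambda>i. c b * b i) \<in> V" using V by (simp add: fd_spaces_def)
    have s: "(\<lambda>i. \<Sum>b\<in>C. c b * b i) \<in> V" using insert by auto
    have "(\<lambda>i. c b * b i + (\<Sum>b\<in>C. c b * b i)) \<in> V"
      using V cb s by (simp add: fd_spaces_def)
    moreover have "P (\<lambda>i. c b * b i + (\<Sum>b\<in>C. c b * b i)) = (\<lambda>i. c b * b i + (\<Sum>b\<in>C. c b * b i))"
      using P(2)[of "\<lambda>i. c b * b i" "\<lambda>i. \<Sum>b\<in>C. c b * b i"] P(3)[OF b(2), of b] P(5)[OF b(3)] insert b cb s VF
      by (auto simp: subset_iff)
    ultimately show ?case using insert.hyps by simp
  qed
  then have retract: "P v = v" if "v \<in> V" for v
    using B(1) B(3)[OF that] by auto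
  have "V = vec_F F \<inter> {v. \<forall>i. P v i = v i}"
  proof (intro equalityI subsetI)
    fix v assume "v \<in> vec_F F \<inter> {v. \<forall>i. P v i = v i}"
    then have "P v \<in> V" "P v = v" using P(4) by auto
    then show "v \<in> V" by simp
  qed (use retract VF in auto)
  moreover have "closed {v. \<forall>i. P v i = v i}"
    by (intro closed_Collect_all closed_Collect_eq P(1) continuous_on_product_coordinates)
  ultimately show ?thesis using closed_vec_F[OF F] by (metis closed_Int)
qed

text \<open>A finite spanning set of finitely supported vectors bounds all supports at once. The
  bound rewrites \<open>ip\<close>, whose range of summation depends on its first argument, as a sum
  over a fixed range, which is visibly continuous.\<close>

lemma fd_spaces_support:
  assumes "V \<in> fd_spaces F"
  shows "\<exists>n. \<forall>v \<in> V. \<forall>i\<ge>n. v i = 0"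
proof -
  obtain B where "finite B \<and> B \<subseteq> V \<and>
      (\<forall>v \<in> V. \<exists>c. (\<forall>b \<in> B. c b \<in> F) \<and> v = (\<lambda>i. \<Sum>b\<in>B. c b * b i))"
    using fd_spaces_spanning[OF assms] ..
  then have B: "finite B" "B \<subseteq> V"
      "\<And>v. v \<in> V \<Longrightarrow> \<exists>c. (\<forall>b \<in> B. c b \<in> F) \<and> v = (\<lambda>i. \<Sum>b\<in>B. c b * b i)"
    by simp_all
  have "finite (\<Union>b\<in>B. {i. b i \<noteq> 0})"
    using B(1,2) assms by (auto simp: fd_spaces_def vec_infty_def)
  then obtain n where n: "\<And>i. i \<in> (\<Union>b\<in>B. {i. b i \<noteq> 0}) \<Longrightarrow> i < n"
    unfolding finite_nat_set_iff_bounded by blast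
  have "v i = 0" if v: "v \<in> V" and i: "n \<le> i" for v i
  proof -
    have "b i = 0" if "b \<in> B" for b using n[of i] that i by force
    then show ?thesis using B(3)[OF v] by (auto intro!: sum.neutral)
  qed
  then show ?thesis by blast
qed

section \<open>Compactness in finite-dimensional inner product spaces\<close>

lemma ip_eq_sum:
  assumes "\<And>i. n \<le> i \<Longrightarrow> v i = 0"
  shows "ip v w = (\<Sum>i<n. v i * cnj (w i))"
  unfolding ip_def using assms
  by (intro sum.mono_neutral_cong_left) (auto simp: not_less[symmetric])

lemma compact_vec_box: "compact {w :: vec. \<forall>i. w i \<in> cball (x i) r}"
proof -
  have "compactin (product_topology (\<lambda>i. euclidean) UNIV) (Pi\<^sub>E UNIV (\<lambda>i. cball (x i :: complex) r))"
    by (simp add: compactin_PiE)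
  moreover have "{w :: vec. \<forall>i. w i \<in> cball (x i) r} = Pi\<^sub>E UNIV (\<lambda>i. cball (x i) r)" by auto
  ultimately show ?thesis by (simp add: euclidean_product_topology)
qed

lemma locally_compact_fd_spaces:
  assumes F: "F = \<real> \<or> F = UNIV" and V: "V \<in> fd_spaces F"
  shows "locally_compact_space (top_of_set V)"
  unfolding locally_compact_space_def
proof
  fix x assume "x \<in> topspace (top_of_set V)"
  then have x: "x \<in> V" by simp
  obtain n where n: "\<And>v i. v \<in> V \<Longrightarrow> n \<le> i \<Longrightarrow> v i = 0"
    using fd_spaces_support[OF V] by metis
  \<comment> \<open>\<open>?U\<close> restricts only finitely many coordinates and so is open in the
    product topology; the remaining coordinates vanish on \<open>V\<close>, so
    \<open>V \<inter> ?U\<close> still lies in the box.\<close>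
  let ?K = "V \<inter> {w. \<forall>i. w i \<in> cball (x i) 1}" and ?U = "{w :: vec. \<forall>i\<in>{..<n}. w i \<in> ball (x i) 1}"
  have "open {w :: vec. w i \<in> ball (x i) 1}" for i
    by (rule open_vimage[unfolded vimage_def]) (auto intro: continuous_on_product_coordinates)
  then have "open (\<Inter>i\<in>{..<n}. {w :: vec. w i \<in> ball (x i) 1})" by (intro open_INT) auto
  moreover have "(\<Inter>i\<in>{..<n}. {w :: vec. w i \<in> ball (x i) 1}) = ?U" by auto
  ultimately have "open ?U" by simp
  then have "openin (top_of_set V) (V \<inter> ?U)" by (simp add: openin_open_Int)
  moreover have "compact ?K" using closed_fd_spaces[OF F V] compact_vec_box by (simp add: closed_Int_compact)
  then have "compactin (top_of_set V) ?K" by (auto simp: compactin_subtopology)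
  moreover have "x \<in> V \<inter> ?U" using x by simp
  moreover have "V \<inter> ?U \<subseteq> ?K"
  proof
    fix w assume w: "w \<in> V \<inter> ?U"
    have "w i \<in> cball (x i) 1" for i
      using w x n[of w i] n[of x i] by (cases "i < n") (auto simp: less_imp_le)
    then show "w \<in> ?K" using w by simp
  qed
  ultimately show "\<exists>U K. openin (top_of_set V) U \<and> compactin (top_of_set V) K \<and> x \<in> U \<and> U \<subseteq> K"
    by blast
qed

text \<open>An isometry sends \<open>u\<close> into the level set at \<open>c = ip u u\<close>;
  compactness of these sets is what makes the bundle over the isometries locally compact.\<close>

lemma compact_norm_level:
  assumes F: "F = \<real> \<or> F = UNIV" and V: "V \<in> fd_spaces F"
  shows "compact {v \<in> V. ip v v = c}"
proof -
  obtain n where n: "\<And>v i. v \<in> V \<Longrightarrow> n \<le> i \<Longrightarrow> v i = 0"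
    using fd_spaces_support[OF V] by metis
  let ?S = "{v. (\<Sum>i<n. v i * cnj (v i)) = c}"
  have ip: "ip v v = (\<Sum>i<n. v i * cnj (v i))" if "v \<in> V" for v
    using n[OF that] by (rule ip_eq_sum)
  have "closed ?S"
    by (intro closed_Collect_eq continuous_intros continuous_on_product_coordinates)
  moreover have eq: "{v \<in> V. ip v v = c} = V \<inter> ?S" using ip by auto
  ultimately have "closed {v \<in> V. ip v v = c}" using closed_fd_spaces[OF F V] by (simp add: closed_Int)
  \<comment> \<open>The square of each \<open>norm (v i)\<close> is at most the norm of
    \<open>ip v v\<close>, whence the radius of the box.\<close>
  moreover have "{v \<in> V. ip v v = c} \<subseteq> {w. \<forall>i. w i \<in> cball ((\<lambda>i. 0) i) (sqrt (norm c))}"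
  proof clarsimp
    fix v i assume v: "v \<in> V" and c: "c = ip v v"
    have "(norm (v i))\<^sup>2 \<le> (\<Sum>i<n. (norm (v i))\<^sup>2)"
    proof (cases "i < n")
      case True then show ?thesis by (intro member_le_sum) auto
    next
      case False then show ?thesis using n[OF v, of i] by (simp add: sum_nonneg)
    qed
    also have "\<dots> = norm (of_real (\<Sum>i<n. (norm (v i))\<^sup>2) :: complex)"
      by (simp add: sum_nonneg del: of_real_sum)
    also have "of_real (\<Sum>i<n. (norm (v i))\<^sup>2) = ip v v"
      unfolding ip[OF v] of_real_sum by (intro sum.cong refl complex_norm_square)
    finally show "norm (v i) \<le> sqrt (norm (ip v v))" by (rule real_le_rsqrt)
  qed
  ultimately show ?thesis
    using closed_Int_compact[OF _ compact_vec_box[of "\<lambda>i. 0" "sqrt (norm c)"], of "{v \<in> V. ip v v = c}"]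
    by (simp only: Int_absorb2)
qed

lemma closedin_Collect_ball:
  assumes "\<And>i. i \<in> I \<Longrightarrow> closedin X {x \<in> topspace X. P i x}"
  shows "closedin X {x \<in> topspace X. \<forall>i\<in>I. P i x}"
proof -
  have "closedin X (\<Inter>(insert (topspace X) ((\<lambda>i. {x \<in> topspace X. P i x}) ` I)))"
    using assms by (intro closedin_Inter) auto
  moreover have "\<Inter>(insert (topspace X) ((\<lambda>i. {x \<in> topspace X. P i x}) ` I)) = {x \<in> topspace X. \<forall>i\<in>I. P i x}"
    by auto
  ultimately show ?thesis by simp
qed

lemma closedin_Collect_conj:
  assumes "closedin X {x \<in> topspace X. P x}" "closedin X {x \<in> topspace X. Q x}"
  shows "closedin X {x \<in> topspace X. P x \<and> Q x}"
proof -
  have "{x \<in> topspace X. P x \<and> Q x} = {x \<in> topspace X. P x} \<inter> {x \<in> topspace X. Q x}" by auto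
  then show ?thesis using assms by (simp add: closedin_Int)
qed

lemma closedin_Collect_vec_eq:
  assumes "\<And>i. continuous_map X euclidean (\<lambda>x. f x i)" "\<And>i. continuous_map X euclidean (\<lambda>x. g x i)"
  shows "closedin X {x \<in> topspace X. f x = (g x :: vec)}"
proof -
  have "closedin X {x \<in> topspace X. \<forall>i\<in>UNIV. f x i = g x i}"
    using assms by (intro closedin_Collect_ball closedin_continuous_maps_eq[where Y = euclidean]) auto
  then show ?thesis by (simp add: fun_eq_iff)
qed

lemma None_in_J1: "None \<in> topspace (J1 F U V)"
  by (simp add: J1_def)

text \<open>A one-point compactification is Hausdorff exactly if the space is locally compact
  Hausdorff. The ambient power of \<open>V\<close> is in general too large to be locally compact,
  but the bundle is closed in the product of the compact level sets, one for each \<open>u\<close>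
  in \<open>U\<close>, with the locally compact \<open>V\<close>.\<close>

lemma compact_Hausdorff_J1:
  assumes F: "F = \<real> \<or> F = UNIV" and U: "U \<in> fd_spaces F" and V: "V \<in> fd_spaces F"
  shows "compact_space (J1 F U V)" "Hausdorff_space (J1 F U V)"
proof -
  show "compact_space (J1 F U V)"
    by (simp add: J1_def compact_space_Alexandroff_compactification)
  obtain n where n: "\<And>v i. v \<in> V \<Longrightarrow> n \<le> i \<Longrightarrow> v i = 0"
    using fd_spaces_support[OF V] by metis
  let ?M = "product_topology (\<lambda>_. top_of_set V) U"
  let ?X = "prod_topology ?M (top_of_set V)"
  let ?E = "\<lambda>u. {v \<in> V. ip v v = ip u u}"
  define S where "S = {(f, x). f \<in> isometries F U V \<and> x \<in> V \<and> (\<forall>u \<in> U. ip x (f u) = 0)}"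
  have J1b: "J1_bundle F U V = subtopology ?X S" by (simp add: J1_bundle_def S_def)
  have top: "topspace ?X = (U \<rightarrow>\<^sub>E V) \<times> V" by simp
  have cf: "continuous_map ?X euclidean (\<lambda>p. fst p u i)" if "u \<in> U" for u i
  proof -
    have "continuous_map ?X (top_of_set V) (\<lambda>p. fst p u)"
      using continuous_map_compose[OF continuous_map_fst continuous_map_product_projection[OF that]]
      by (simp add: o_def)
    moreover have "continuous_map (top_of_set V) euclidean (\<lambda>v. v i)"
      by (auto intro: continuous_on_product_coordinates continuous_on_subset)
    ultimately have "continuous_map ?X euclidean ((\<lambda>v. v i) \<circ> (\<lambda>p. fst p u))"
      by (rule continuous_map_compose)
    then show ?thesis by (simp add: o_def)
  qed
  have cx: "continuous_map ?X euclidean (\<lambda>p. snd p i)" for i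
  proof -
    have "continuous_map (top_of_set V) euclidean (\<lambda>v. v i)"
      by (auto intro: continuous_on_product_coordinates continuous_on_subset)
    from continuous_map_compose[OF continuous_map_snd this] show ?thesis by (simp add: o_def)
  qed
  have ip: "ip v w = (\<Sum>i<n. v i * cnj (w i))" if "v \<in> V" for v w
    using n[OF that] by (rule ip_eq_sum)
  have U_ops: "\<And>v w. v \<in> U \<Longrightarrow> w \<in> U \<Longrightarrow> (\<lambda>i. v i + w i) \<in> U" "\<And>a v. a \<in> F \<Longrightarrow> v \<in> U \<Longrightarrow> (\<lambda>i. a * v i) \<in> U"
    using U by (auto simp: fd_spaces_def)
  have cnj: "continuous_map ?X euclidean (\<lambda>p. cnj (f p))" if "continuous_map ?X euclidean f" for f
    using continuous_map_compose[OF that, of euclidean cnj] by (auto simp: o_def intro: continuous_intros)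
  have ipf: "(\<forall>v \<in> U. \<forall>w \<in> U. ip (f v) (f w) = ip v w) \<longleftrightarrow>
      (\<forall>v \<in> U. \<forall>w \<in> U. (\<Sum>i<n. f v i * cnj (f w i)) = ip v w)" if "f \<in> U \<rightarrow>\<^sub>E V" for f
    by (intro ball_cong refl) (simp add: ip[OF PiE_mem[OF that]])
  have mult: "continuous_map ?X euclidean (\<lambda>p. f p * g p :: complex)"
    if "continuous_map ?X euclidean f" "continuous_map ?X euclidean g" for f g
    using that by (simp add: continuous_map_atin tendsto_mult)
  \<comment> \<open>Every defining condition becomes an equation between continuous functions of
    \<open>p\<close>; the sum over a fixed range replaces \<open>ip\<close> where its first argument
    varies.\<close>
  have S_eq: "S = {p \<in> topspace ?X. (\<forall>v \<in> U. \<forall>w \<in> U. fst p (\<lambda>i. v i + w i) = (\<lambda>i. fst p v i + fst p w i)) \<and>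
     (\<forall>a \<in> F. \<forall>v \<in> U. fst p (\<lambda>i. a * v i) = (\<lambda>i. a * fst p v i)) \<and>
     (\<forall>v \<in> U. \<forall>w \<in> U. (\<Sum>i<n. fst p v i * cnj (fst p w i)) = ip v w) \<and>
     (\<forall>u \<in> U. (\<Sum>i<n. snd p i * cnj (fst p u i)) = 0)}"
    (is "S = ?R")
  proof (rule Set.set_eqI)
    fix p :: "(vec \<Rightarrow> vec) \<times> vec"
    obtain f x where p: "p = (f, x)" by (cases p)
    show "p \<in> S \<longleftrightarrow> p \<in> ?R"
    proof (cases "f \<in> U \<rightarrow>\<^sub>E V \<and> x \<in> V")
      case True
      then show ?thesis unfolding p S_def isometries_def mem_Collect_eq top
        by (simp add: ipf ip conj_assoc)
    next
      case False
      then show ?thesis unfolding p S_def isometries_def mem_Collect_eq top by (simp; blast)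
    qed
  qed
  have "closedin ?X S"
    unfolding S_eq
    by (intro closedin_Collect_conj closedin_Collect_ball closedin_Collect_vec_eq
        closedin_continuous_maps_eq[where Y = euclidean] continuous_map_sum mult cnj cf cx
        continuous_map_add U_ops) (auto simp: cf)
  have sub: "S \<subseteq> Pi\<^sub>E U ?E \<times> V"
    unfolding S_def isometries_def by (auto simp: PiE_iff extensional_def)
  let ?Y = "prod_topology (product_topology (\<lambda>u. top_of_set (?E u)) U) (top_of_set V)"
  have Y: "?Y = subtopology ?X (Pi\<^sub>E U ?E \<times> V)"
    by (simp add: subtopology_Times subtopology_product_topology subtopology_subtopology Int_absorb1)
  have "compact_space (product_topology (\<lambda>u. top_of_set (?E u)) U)"
    using compact_norm_level[OF F V] by (simp add: compact_space_product_topology compact_space_subtopology)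
  then have "locally_compact_space (product_topology (\<lambda>u. top_of_set (?E u)) U)"
    by (rule compact_imp_locally_compact_space)
  then have "locally_compact_space ?Y"
    using locally_compact_fd_spaces[OF F V] by (simp add: locally_compact_space_prod_topology)
  moreover have "closedin ?Y S"
    unfolding Y by (rule closedin_subset_topspace) fact+
  ultimately have "locally_compact_space (subtopology ?Y S)" by (rule locally_compact_space_closed_subset)
  moreover have "subtopology ?Y S = J1_bundle F U V"
    unfolding Y J1b subtopology_subtopology using sub by (simp add: Int_absorb1)
  ultimately have "locally_compact_space (J1_bundle F U V)" by simp
  moreover have "Hausdorff_space (J1_bundle F U V)"
    unfolding J1b by (simp add: Hausdorff_space_subtopology Hausdorff_space_prod_topology Hausdorff_space_product_topology)
  ultimately show "Hausdorff_space (J1 F U V)"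
    by (simp add: J1_def Hausdorff_space_Alexandroff_compactification)
qed

section \<open>Lifting properties under adjunctions\<close>

lemma has_llp_left_adjoint:
  assumes adj: "adjoint_pair C D Lo Lm Ro Rm"
    and A: "A \<in> Ob C" and B: "B \<in> Ob C" and i: "i \<in> Mor C A B"
    and X: "X \<in> Ob D" and Y: "Y \<in> Ob D" and p: "p \<in> Mor D X Y"
    and llp: "has_llp C A B i (Ro X) (Ro Y) (Rm X Y p)"
  shows "has_llp D (Lo A) (Lo B) (Lm A B i) X Y p"
proof -
  have catC: "is_category C" and catD: "is_category D"
    and L: "is_functor C D Lo Lm" and R: "is_functor D C Ro Rm"
    using adj unfolding adjoint_pair_def by blast+
  obtain \<phi> where bij: "\<And>X Y. X \<in> Ob C \<Longrightarrow> Y \<in> Ob D \<Longrightarrow> bij_betw (\<phi> X Y) (Mor D (Lo X) Y) (Mor C X (Ro Y))"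
    and nat: "\<And>X X' Y Y' a f b. \<lbrakk>X \<in> Ob C; X' \<in> Ob C; Y \<in> Ob D; Y' \<in> Ob D;
         a \<in> Mor C X' X; f \<in> Mor D (Lo X) Y; b \<in> Mor D Y Y'\<rbrakk> \<Longrightarrow>
           \<phi> X' Y' (Cmp D (Lo X') Y Y' b (Cmp D (Lo X') (Lo X) Y f (Lm X' X a)))
           = Cmp C X' (Ro Y) (Ro Y') (Rm Y Y' b) (Cmp C X' X (Ro Y) (\<phi> X Y f) a)"
    using adj unfolding adjoint_pair_def by metis
  have LO: "Lo Z \<in> Ob D" if "Z \<in> Ob C" for Z using L that by (simp add: is_functor_def)
  have RO: "Ro Z \<in> Ob C" if "Z \<in> Ob D" for Z using R that by (simp add: is_functor_def)
  have Lid: "Lm Z Z (Idt C Z) = Idt D (Lo Z)" if "Z \<in> Ob C" for Z using L that by (simp add: is_functor_def)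
  have Rid: "Rm Z Z (Idt D Z) = Idt C (Ro Z)" if "Z \<in> Ob D" for Z using R that by (simp add: is_functor_def)
  have Lm: "Lm Z W f \<in> Mor D (Lo Z) (Lo W)" if "Z \<in> Ob C" "W \<in> Ob C" "f \<in> Mor C Z W" for Z W f
    using L that by (simp add: is_functor_def)
  have idC: "Idt C Z \<in> Mor C Z Z" if "Z \<in> Ob C" for Z using catC that by (simp add: is_category_def)
  have idD: "Idt D Z \<in> Mor D Z Z" if "Z \<in> Ob D" for Z using catD that by (simp add: is_category_def)
  have unitC: "Cmp C Z Z W f (Idt C Z) = f" "Cmp C Z W W (Idt C W) f = f"
    if "Z \<in> Ob C" "W \<in> Ob C" "f \<in> Mor C Z W" for Z W f
    using catC that by (simp_all add: is_category_def)
  have unitD: "Cmp D Z Z W f (Idt D Z) = f" "Cmp D Z W W (Idt D W) f = f"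
    if "Z \<in> Ob D" "W \<in> Ob D" "f \<in> Mor D Z W" for Z W f
    using catD that by (simp_all add: is_category_def)
  have cmpC: "Cmp C Z W T g f \<in> Mor C Z T"
    if "Z \<in> Ob C" "W \<in> Ob C" "T \<in> Ob C" "f \<in> Mor C Z W" "g \<in> Mor C W T" for Z W T f g
    using catC that by (simp add: is_category_def)
  have cmpD: "Cmp D Z W T g f \<in> Mor D Z T"
    if "Z \<in> Ob D" "W \<in> Ob D" "T \<in> Ob D" "f \<in> Mor D Z W" "g \<in> Mor D W T" for Z W T f g
    using catD that by (simp add: is_category_def)
  have phi: "\<phi> Z W f \<in> Mor C Z (Ro W)" if "Z \<in> Ob C" "W \<in> Ob D" "f \<in> Mor D (Lo Z) W" for Z W f
    using bij[OF that(1,2)] that(3) by (rule bij_betwE[rule_format])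
  \<comment> \<open>\<open>adjoint_pair\<close> states naturality in both variables at once; an
    identity in place of \<open>a\<close> gives \<open>post\<close>, an identity in place of
    \<open>b\<close> gives \<open>pre\<close>.\<close>
  have post: "\<phi> Z Y (Cmp D (Lo Z) X Y p f) = Cmp C Z (Ro X) (Ro Y) (Rm X Y p) (\<phi> Z X f)"
    if "Z \<in> Ob C" "f \<in> Mor D (Lo Z) X" for Z f
    using nat[OF that(1) that(1) X Y idC[OF that(1)] that(2) p]
    by (simp add: Lid that unitD(1)[OF LO[OF that(1)] X] unitC(1)[OF that(1) RO[OF X]] phi X)
  have pre: "\<phi> A W (Cmp D (Lo A) (Lo B) W f (Lm A B i)) = Cmp C A B (Ro W) (\<phi> B W f) i"
    if "W \<in> Ob D" "f \<in> Mor D (Lo B) W" for W f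
    using nat[OF B A that(1) that(1) i that(2) idD[OF that(1)]]
    by (simp add: Rid that LO A B RO phi i Lm cmpC cmpD unitC(2) unitD(2))
  show ?thesis
    unfolding has_llp_def
  proof (intro ballI impI)
    fix u v assume u: "u \<in> Mor D (Lo A) X" and v: "v \<in> Mor D (Lo B) Y"
      and sq: "Cmp D (Lo A) X Y p u = Cmp D (Lo A) (Lo B) Y v (Lm A B i)"
    have "Cmp C A (Ro X) (Ro Y) (Rm X Y p) (\<phi> A X u) = Cmp C A B (Ro Y) (\<phi> B Y v) i"
      using post[OF A u] pre[OF Y v] sq by simp
    then obtain h where h: "h \<in> Mor C B (Ro X)" "Cmp C A B (Ro X) h i = \<phi> A X u"
        "Cmp C B (Ro X) (Ro Y) (Rm X Y p) h = \<phi> B Y v"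
      using llp phi[OF A X u] phi[OF B Y v] unfolding has_llp_def by blast
    obtain k where k: "k \<in> Mor D (Lo B) X" "\<phi> B X k = h"
      using bij_betw_imp_surj_on[OF bij[OF B X]] h(1) by (metis imageE)
    \<comment> \<open>Both triangles are checked on transposes, which suffices because
      \<open>\<phi>\<close> is injective.\<close>
    have "\<phi> A X (Cmp D (Lo A) (Lo B) X k (Lm A B i)) = \<phi> A X u"
      using pre[OF X k(1)] k(2) h(2) by simp
    then have "Cmp D (Lo A) (Lo B) X k (Lm A B i) = u"
      using bij[OF A X] u cmpD[OF LO[OF A] LO[OF B] X Lm[OF A B i] k(1)]
      by (meson bij_betw_def inj_onD)
    moreover have "\<phi> B Y (Cmp D (Lo B) X Y p k) = \<phi> B Y v"
      using post[OF B k(1)] k(2) h(3) by simp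
    then have "Cmp D (Lo B) X Y p k = v"
      using bij[OF B Y] v cmpD[OF LO[OF B] X Y k(1) p]
      by (meson bij_betw_def inj_onD)
    ultimately show "\<exists>h\<in>Mor D (Lo B) X. Cmp D (Lo A) (Lo B) X h (Lm A B i) = u \<and> Cmp D (Lo B) X Y p h = v"
      using k(1) by blast
  qed
qed

section \<open>The category of G-spectra\<close>

lemma continuous_map_fst': "continuous_map Z (prod_topology X Y) f \<Longrightarrow> continuous_map Z X (\<lambda>z. fst (f z))"
  by (drule continuous_map_compose[OF _ continuous_map_fst]) (simp add: o_def)

lemma continuous_map_snd': "continuous_map Z (prod_topology X Y) f \<Longrightarrow> continuous_map Z Y (\<lambda>z. snd (f z))"
  by (drule continuous_map_compose[OF _ continuous_map_snd]) (simp add: o_def)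

lemma continuous_map_joint:
  assumes "continuous_map (prod_topology A X) Y (\<lambda>(a, x). f a x)"
    and "continuous_map Z A \<alpha>" "continuous_map Z X \<beta>"
  shows "continuous_map Z Y (\<lambda>z. f (\<alpha> z) (\<beta> z))"
  using continuous_map_compose[OF continuous_map_pairedI[OF assms(2,3)] assms(1)]
  by (simp add: o_def)

lemma topspace_lev_maps:
  "topspace (lev_maps \<Theta> U \<Psi> V) = {f \<in> extensional (topspace (lev \<Theta> U)).
     continuous_map (lev \<Theta> U) (lev \<Psi> V) f \<and> f (bas \<Theta> U) = bas \<Psi> V}"
  by (auto simp: lev_maps_def cont_maps_def)

lemma spectrum_maps_iff:
  "f \<in> spectrum_maps F \<Theta> \<Psi> \<longleftrightarrow> f \<in> extensional (fd_spaces F) \<and>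
     (\<forall>V \<in> fd_spaces F. f V \<in> extensional (topspace (lev \<Theta> V)) \<and>
        continuous_map (lev \<Theta> V) (lev \<Psi> V) (f V) \<and> f V (bas \<Theta> V) = bas \<Psi> V) \<and>
     (\<forall>U \<in> fd_spaces F. \<forall>V \<in> fd_spaces F. \<forall>a \<in> topspace (J1 F U V). \<forall>x \<in> topspace (lev \<Theta> U).
       f V (act \<Theta> U V a x) = act \<Psi> U V a (f U x))"
  by (simp add: spectrum_maps_def topspace_lev_maps PiE_iff) blast

lemma spectrum_maps_in:
  "\<lbrakk>f \<in> spectrum_maps F \<Theta> \<Psi>; V \<in> fd_spaces F; x \<in> topspace (lev \<Theta> V)\<rbrakk> \<Longrightarrow> f V x \<in> topspace (lev \<Psi> V)"
  by (auto simp: spectrum_maps_iff continuous_map_def Pi_iff)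

lemma spectrum_family_eqI:
  assumes "f \<in> extensional (fd_spaces F)" "\<And>V. V \<in> fd_spaces F \<Longrightarrow> f V \<in> extensional (topspace (lev \<Theta> V))"
    and "g \<in> extensional (fd_spaces F)" "\<And>V. V \<in> fd_spaces F \<Longrightarrow> g V \<in> extensional (topspace (lev \<Theta> V))"
    and "\<And>V x. V \<in> fd_spaces F \<Longrightarrow> x \<in> topspace (lev \<Theta> V) \<Longrightarrow> f V x = g V x"
  shows "f = g"
proof (rule extensionalityI[OF assms(1,3)])
  fix V assume "V \<in> fd_spaces F"
  then show "f V = g V" using assms by (intro extensionalityI[where A = "topspace (lev \<Theta> V)"]) auto
qed

lemma spectrum_maps_eqI:
  assumes "f \<in> spectrum_maps F \<Theta> \<Psi>" "g \<in> spectrum_maps F \<Theta> \<Psi>'"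
    and "\<And>V x. V \<in> fd_spaces F \<Longrightarrow> x \<in> topspace (lev \<Theta> V) \<Longrightarrow> f V x = g V x"
  shows "f = g"
  by (rule spectrum_family_eqI[OF _ _ _ _ assms(3)]) (use assms(1,2) in \<open>auto simp: spectrum_maps_iff\<close>)

lemma spectrum_comp_extensional:
  "spectrum_comp F \<Theta> g f \<in> extensional (fd_spaces F)"
  "V \<in> fd_spaces F \<Longrightarrow> spectrum_comp F \<Theta> g f V \<in> extensional (topspace (lev \<Theta> V))"
  by (auto simp: spectrum_comp_def)

lemma spectrum_comp_apply:
  "\<lbrakk>V \<in> fd_spaces F; x \<in> topspace (lev \<Theta> V)\<rbrakk> \<Longrightarrow> spectrum_comp F \<Theta> g f V x = g V (f V x)"
  by (simp add: spectrum_comp_def compose_def)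

lemma spectrum_comp_eq_iff:
  "spectrum_comp F \<Theta> g f = spectrum_comp F \<Theta> g' f' \<longleftrightarrow>
     (\<forall>V \<in> fd_spaces F. \<forall>x \<in> topspace (lev \<Theta> V). g V (f V x) = g' V (f' V x))"
proof
  assume "spectrum_comp F \<Theta> g f = spectrum_comp F \<Theta> g' f'"
  then show "\<forall>V \<in> fd_spaces F. \<forall>x \<in> topspace (lev \<Theta> V). g V (f V x) = g' V (f' V x)"
    by (metis spectrum_comp_apply)
next
  assume "\<forall>V \<in> fd_spaces F. \<forall>x \<in> topspace (lev \<Theta> V). g V (f V x) = g' V (f' V x)"
  then show "spectrum_comp F \<Theta> g f = spectrum_comp F \<Theta> g' f'"
    by (intro spectrum_family_eqI[where \<Theta> = \<Theta> and F = F] spectrum_comp_extensional)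
      (simp_all add: spectrum_comp_apply)
qed

lemma spectrum_comp_in:
  assumes f: "f \<in> spectrum_maps F \<Theta> \<Psi>" and g: "g \<in> spectrum_maps F \<Psi> \<Phi>"
    and \<Theta>: "\<And>V. V \<in> fd_spaces F \<Longrightarrow> bas \<Theta> V \<in> topspace (lev \<Theta> V)"
      "\<And>U V a x. \<lbrakk>U \<in> fd_spaces F; V \<in> fd_spaces F; a \<in> topspace (J1 F U V); x \<in> topspace (lev \<Theta> U)\<rbrakk>
        \<Longrightarrow> act \<Theta> U V a x \<in> topspace (lev \<Theta> V)"
  shows "spectrum_comp F \<Theta> g f \<in> spectrum_maps F \<Theta> \<Phi>"
  unfolding spectrum_maps_iff
proof (intro conjI ballI spectrum_comp_extensional)
  fix V assume V: "V \<in> fd_spaces F"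
  show "continuous_map (lev \<Theta> V) (lev \<Phi> V) (spectrum_comp F \<Theta> g f V)"
  proof (rule continuous_map_eq)
    show "continuous_map (lev \<Theta> V) (lev \<Phi> V) (g V \<circ> f V)"
      using f g V by (intro continuous_map_compose[where X' = "lev \<Psi> V"]) (auto simp: spectrum_maps_iff)
  qed (simp add: spectrum_comp_apply V)
  show "spectrum_comp F \<Theta> g f V (bas \<Theta> V) = bas \<Phi> V"
    using f g V by (simp add: spectrum_comp_apply \<Theta> spectrum_maps_iff)
next
  fix U V a x assume *: "U \<in> fd_spaces F" "V \<in> fd_spaces F" "a \<in> topspace (J1 F U V)" "x \<in> topspace (lev \<Theta> U)"
  then have "f U x \<in> topspace (lev \<Psi> U)" using f by (simp add: spectrum_maps_in)
  then show "spectrum_comp F \<Theta> g f V (act \<Theta> U V a x) = act \<Phi> U V a (spectrum_comp F \<Theta> g f U x)"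
    using f g * by (simp add: spectrum_comp_apply \<Theta> spectrum_maps_iff)
qed

lemma gspectrum_maps_iff:
  "f \<in> gspectrum_maps F G \<Theta> \<Psi> \<longleftrightarrow> f \<in> spectrum_maps F \<Theta> \<Psi> \<and>
     (\<forall>g \<in> carrier G. \<forall>V \<in> fd_spaces F. \<forall>x \<in> topspace (lev \<Theta> V). f V (gact \<Theta> g V x) = gact \<Psi> g V (f V x))"
  by (simp add: gspectrum_maps_def spectrum_comp_eq_iff)

section \<open>Structure maps and group actions as jointly continuous maps\<close>

lemma
  assumes "is_spectrum F \<Theta>" and V: "V \<in> fd_spaces F"
  shows spectrum_cgwh: "cgwh (lev \<Theta> V)"
    and spectrum_bas: "bas \<Theta> V \<in> topspace (lev \<Theta> V)"
    and spectrum_act_id: "x \<in> topspace (lev \<Theta> V) \<Longrightarrow> act \<Theta> V V (J1_id V) x = x"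
  using assms by (simp_all add: is_spectrum_def)

lemma
  assumes \<Theta>: "is_spectrum F \<Theta>" and U: "U \<in> fd_spaces F" and V: "V \<in> fd_spaces F"
  shows spectrum_act_None: "x \<in> topspace (lev \<Theta> U) \<Longrightarrow> act \<Theta> U V None x = bas \<Theta> V"
    and spectrum_act_comp: "\<lbrakk>W \<in> fd_spaces F; a \<in> topspace (J1 F U V); b \<in> topspace (J1 F V W); x \<in> topspace (lev \<Theta> U)\<rbrakk>
      \<Longrightarrow> act \<Theta> U W (J1_comp U b a) x = act \<Theta> V W b (act \<Theta> U V a x)"
    and spectrum_act_in: "\<lbrakk>a \<in> topspace (J1 F U V); x \<in> topspace (lev \<Theta> U)\<rbrakk> \<Longrightarrow> act \<Theta> U V a x \<in> topspace (lev \<Theta> V)"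
    and spectrum_act_bas: "a \<in> topspace (J1 F U V) \<Longrightarrow> act \<Theta> U V a (bas \<Theta> U) = bas \<Theta> V"
    and spectrum_act_joint: "F = \<real> \<or> F = UNIV \<Longrightarrow>
      continuous_map (prod_topology (J1 F U V) (lev \<Theta> U)) (lev \<Theta> V) (\<lambda>(a, x). act \<Theta> U V a x)"
proof -
  have cont: "continuous_map (J1 F U V) (lev_maps \<Theta> U \<Theta> V) (act \<Theta> U V)"
    using assms by (simp add: is_spectrum_def)
  show "x \<in> topspace (lev \<Theta> U) \<Longrightarrow> act \<Theta> U V None x = bas \<Theta> V"
    using assms by (simp add: is_spectrum_def)
  show "\<lbrakk>W \<in> fd_spaces F; a \<in> topspace (J1 F U V); b \<in> topspace (J1 F V W); x \<in> topspace (lev \<Theta> U)\<rbrakk>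
      \<Longrightarrow> act \<Theta> U W (J1_comp U b a) x = act \<Theta> V W b (act \<Theta> U V a x)"
    using assms by (simp add: is_spectrum_def compose_def)
  have lm: "act \<Theta> U V a \<in> topspace (lev_maps \<Theta> U \<Theta> V)" if "a \<in> topspace (J1 F U V)" for a
    using continuous_map_funspace[OF cont] that by blast
  show "\<lbrakk>a \<in> topspace (J1 F U V); x \<in> topspace (lev \<Theta> U)\<rbrakk> \<Longrightarrow> act \<Theta> U V a x \<in> topspace (lev \<Theta> V)"
    using lm[of a] by (auto simp: topspace_lev_maps continuous_map_def Pi_iff)
  show "a \<in> topspace (J1 F U V) \<Longrightarrow> act \<Theta> U V a (bas \<Theta> U) = bas \<Theta> V"
    using lm by (simp add: topspace_lev_maps)
  assume F: "F = \<real> \<or> F = UNIV"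
  show "continuous_map (prod_topology (J1 F U V) (lev \<Theta> U)) (lev \<Theta> V) (\<lambda>(a, x). act \<Theta> U V a x)"
    using cont continuous_map_based_map_space_iff[OF compact_Hausdorff_J1[OF F U V]
        spectrum_cgwh[OF \<Theta> U] cgwh_weak_Hausdorff[OF spectrum_cgwh[OF \<Theta> V]]]
    by (simp add: lev_maps_def)
qed

text \<open>\<open>ext\<close> is asked for every \<open>a\<close>, also outside the morphism space.
  In this way the equations for \<open>J1_id V\<close> and \<open>J1_comp U b a\<close> follow
  pointwise, without a proof that these are points of a morphism space.\<close>

lemma is_spectrumI:
  assumes F: "F = \<real> \<or> F = UNIV"
    and cgwh: "\<And>V. V \<in> fd_spaces F \<Longrightarrow> cgwh (lev \<Theta> V)"
    and bas: "\<And>V. V \<in> fd_spaces F \<Longrightarrow> bas \<Theta> V \<in> topspace (lev \<Theta> V)"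
    and ext: "\<And>U V a. \<lbrakk>U \<in> fd_spaces F; V \<in> fd_spaces F\<rbrakk> \<Longrightarrow> act \<Theta> U V a \<in> extensional (topspace (lev \<Theta> U))"
    and act_bas: "\<And>U V a. \<lbrakk>U \<in> fd_spaces F; V \<in> fd_spaces F; a \<in> topspace (J1 F U V)\<rbrakk> \<Longrightarrow> act \<Theta> U V a (bas \<Theta> U) = bas \<Theta> V"
    and joint: "\<And>U V. \<lbrakk>U \<in> fd_spaces F; V \<in> fd_spaces F\<rbrakk> \<Longrightarrow>
      continuous_map (prod_topology (J1 F U V) (lev \<Theta> U)) (lev \<Theta> V) (\<lambda>(a, x). act \<Theta> U V a x)"
    and None: "\<And>U V x. \<lbrakk>U \<in> fd_spaces F; V \<in> fd_spaces F; x \<in> topspace (lev \<Theta> U)\<rbrakk> \<Longrightarrow> act \<Theta> U V None x = bas \<Theta> V"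
    and id: "\<And>V x. \<lbrakk>V \<in> fd_spaces F; x \<in> topspace (lev \<Theta> V)\<rbrakk> \<Longrightarrow> act \<Theta> V V (J1_id V) x = x"
    and comp: "\<And>U V W a b x. \<lbrakk>U \<in> fd_spaces F; V \<in> fd_spaces F; W \<in> fd_spaces F;
      a \<in> topspace (J1 F U V); b \<in> topspace (J1 F V W); x \<in> topspace (lev \<Theta> U)\<rbrakk>
      \<Longrightarrow> act \<Theta> U W (J1_comp U b a) x = act \<Theta> V W b (act \<Theta> U V a x)"
  shows "is_spectrum F \<Theta>"
  unfolding is_spectrum_def
proof (intro conjI ballI cgwh bas)
  fix U V assume U: "U \<in> fd_spaces F" and V: "V \<in> fd_spaces F"
  show "continuous_map (J1 F U V) (lev_maps \<Theta> U \<Theta> V) (act \<Theta> U V)"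
    unfolding lev_maps_def
      continuous_map_based_map_space_iff[OF compact_Hausdorff_J1[OF F U V] cgwh[OF U] cgwh_weak_Hausdorff[OF cgwh[OF V]]]
    using ext act_bas joint U V by blast
  show "act \<Theta> U V None = restrict (\<lambda>x. bas \<Theta> V) (topspace (lev \<Theta> U))"
    by (rule extensionalityI[OF ext[OF U V]]) (simp_all add: None U V)
  fix W a b assume *: "W \<in> fd_spaces F" "a \<in> topspace (J1 F U V)" "b \<in> topspace (J1 F V W)"
  show "act \<Theta> U W (J1_comp U b a) = compose (topspace (lev \<Theta> U)) (act \<Theta> V W b) (act \<Theta> U V a)"
    by (rule extensionalityI[OF ext[OF U *(1)]]) (simp_all add: comp U V * compose_def)
next
  fix V assume V: "V \<in> fd_spaces F"
  show "act \<Theta> V V (J1_id V) = restrict (\<lambda>x. x) (topspace (lev \<Theta> V))"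
    by (rule extensionalityI[OF ext[OF V V]]) (simp_all add: id V)
qed

text \<open>No group axioms are included: this is the point-set information that turns continuity of
  an action into joint continuity, and it is established for both \<open>G\<close> and
  \<open>subgroup_of G H\<close>.\<close>

definition compact_Hausdorff_group :: "'g topgroup \<Rightarrow> bool" where
  "compact_Hausdorff_group G \<longleftrightarrow>
     compact_space (gtop G) \<and> Hausdorff_space (gtop G) \<and> topspace (gtop G) = carrier G"

lemma gspectrum_spectrum: "is_gspectrum F G \<Theta> \<Longrightarrow> is_spectrum F \<Theta>"
  by (simp add: is_gspectrum_def)

lemma
  assumes \<Theta>: "is_gspectrum F G \<Theta>"
  shows gact_spectrum_map: "g \<in> carrier G \<Longrightarrow> gact \<Theta> g \<in> spectrum_maps F \<Theta> \<Theta>"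
    and gact_in: "\<lbrakk>g \<in> carrier G; V \<in> fd_spaces F; x \<in> topspace (lev \<Theta> V)\<rbrakk> \<Longrightarrow> gact \<Theta> g V x \<in> topspace (lev \<Theta> V)"
    and gact_bas: "\<lbrakk>g \<in> carrier G; V \<in> fd_spaces F\<rbrakk> \<Longrightarrow> gact \<Theta> g V (bas \<Theta> V) = bas \<Theta> V"
    and gact_act: "\<lbrakk>g \<in> carrier G; U \<in> fd_spaces F; V \<in> fd_spaces F; a \<in> topspace (J1 F U V); x \<in> topspace (lev \<Theta> U)\<rbrakk>
      \<Longrightarrow> gact \<Theta> g V (act \<Theta> U V a x) = act \<Theta> U V a (gact \<Theta> g U x)"
    and gact_one: "\<lbrakk>V \<in> fd_spaces F; x \<in> topspace (lev \<Theta> V)\<rbrakk> \<Longrightarrow> gact \<Theta> \<one>\<^bsub>G\<^esub> V x = x"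
    and gact_mult: "\<lbrakk>g \<in> carrier G; h \<in> carrier G; V \<in> fd_spaces F; x \<in> topspace (lev \<Theta> V)\<rbrakk>
      \<Longrightarrow> gact \<Theta> (g \<otimes>\<^bsub>G\<^esub> h) V x = gact \<Theta> g V (gact \<Theta> h V x)"
proof -
  show m: "gact \<Theta> g \<in> spectrum_maps F \<Theta> \<Theta>" if "g \<in> carrier G" for g
    using \<Theta> that by (simp add: is_gspectrum_def)
  then show "\<lbrakk>g \<in> carrier G; V \<in> fd_spaces F; x \<in> topspace (lev \<Theta> V)\<rbrakk> \<Longrightarrow> gact \<Theta> g V x \<in> topspace (lev \<Theta> V)"
    by (meson spectrum_maps_in)
  show "\<lbrakk>g \<in> carrier G; V \<in> fd_spaces F\<rbrakk> \<Longrightarrow> gact \<Theta> g V (bas \<Theta> V) = bas \<Theta> V"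
    "\<lbrakk>g \<in> carrier G; U \<in> fd_spaces F; V \<in> fd_spaces F; a \<in> topspace (J1 F U V); x \<in> topspace (lev \<Theta> U)\<rbrakk>
      \<Longrightarrow> gact \<Theta> g V (act \<Theta> U V a x) = act \<Theta> U V a (gact \<Theta> g U x)"
    using m[of g] by (simp_all add: spectrum_maps_iff)
  show "\<lbrakk>V \<in> fd_spaces F; x \<in> topspace (lev \<Theta> V)\<rbrakk> \<Longrightarrow> gact \<Theta> \<one>\<^bsub>G\<^esub> V x = x"
    using \<Theta> by (simp add: is_gspectrum_def spectrum_id_def)
  show "\<lbrakk>g \<in> carrier G; h \<in> carrier G; V \<in> fd_spaces F; x \<in> topspace (lev \<Theta> V)\<rbrakk>
      \<Longrightarrow> gact \<Theta> (g \<otimes>\<^bsub>G\<^esub> h) V x = gact \<Theta> g V (gact \<Theta> h V x)"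
    using \<Theta> by (simp add: is_gspectrum_def spectrum_comp_apply)
qed

lemma gact_joint:
  assumes G: "compact_Hausdorff_group G" and \<Theta>: "is_gspectrum F G \<Theta>" and V: "V \<in> fd_spaces F"
  shows "continuous_map (prod_topology (gtop G) (lev \<Theta> V)) (lev \<Theta> V) (\<lambda>(g, x). gact \<Theta> g V x)"
proof -
  have "continuous_map (gtop G) (lev_maps \<Theta> V \<Theta> V) (\<lambda>g. gact \<Theta> g V)"
    using \<Theta> V by (simp add: is_gspectrum_def)
  moreover have "cgwh (lev \<Theta> V)" using \<Theta> V gspectrum_spectrum spectrum_cgwh by blast
  ultimately show ?thesis
    using continuous_map_based_map_space_iff[of "gtop G" "lev \<Theta> V" "lev \<Theta> V" "bas \<Theta> V" "bas \<Theta> V" "\<lambda>g. gact \<Theta> g V"] G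
    by (simp add: compact_Hausdorff_group_def lev_maps_def cgwh_weak_Hausdorff)
qed

lemma is_gspectrumI:
  assumes G: "compact_Hausdorff_group G" and \<Theta>: "is_spectrum F \<Theta>" and one: "\<one>\<^bsub>G\<^esub> \<in> carrier G"
    and closed: "\<And>g h. \<lbrakk>g \<in> carrier G; h \<in> carrier G\<rbrakk> \<Longrightarrow> g \<otimes>\<^bsub>G\<^esub> h \<in> carrier G"
    and maps: "\<And>g. g \<in> carrier G \<Longrightarrow> gact \<Theta> g \<in> spectrum_maps F \<Theta> \<Theta>"
    and unit: "\<And>V x. \<lbrakk>V \<in> fd_spaces F; x \<in> topspace (lev \<Theta> V)\<rbrakk> \<Longrightarrow> gact \<Theta> \<one>\<^bsub>G\<^esub> V x = x"
    and mult: "\<And>g h V x. \<lbrakk>g \<in> carrier G; h \<in> carrier G; V \<in> fd_spaces F; x \<in> topspace (lev \<Theta> V)\<rbrakk>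
      \<Longrightarrow> gact \<Theta> (g \<otimes>\<^bsub>G\<^esub> h) V x = gact \<Theta> g V (gact \<Theta> h V x)"
    and joint: "\<And>V. V \<in> fd_spaces F \<Longrightarrow>
      continuous_map (prod_topology (gtop G) (lev \<Theta> V)) (lev \<Theta> V) (\<lambda>(g, x). gact \<Theta> g V x)"
  shows "is_gspectrum F G \<Theta>"
  unfolding is_gspectrum_def
proof (intro conjI ballI \<Theta> maps)
  show "gact \<Theta> \<one>\<^bsub>G\<^esub> = spectrum_id F \<Theta>"
    using maps[OF one] unit
    by (intro spectrum_family_eqI[where \<Theta> = \<Theta> and F = F]) (auto simp: spectrum_maps_iff spectrum_id_def)
  show "gact \<Theta> (g \<otimes>\<^bsub>G\<^esub> h) = spectrum_comp F \<Theta> (gact \<Theta> g) (gact \<Theta> h)"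
    if "g \<in> carrier G" "h \<in> carrier G" for g h
    using maps[OF closed[OF that]] mult[OF that]
    by (intro spectrum_family_eqI[where \<Theta> = \<Theta> and F = F] spectrum_comp_extensional)
      (auto simp: spectrum_maps_iff spectrum_comp_apply)
  fix V assume V: "V \<in> fd_spaces F"
  have "cgwh (lev \<Theta> V)" using \<Theta> V spectrum_cgwh by blast
  then show "continuous_map (gtop G) (lev_maps \<Theta> V \<Theta> V) (\<lambda>g. gact \<Theta> g V)"
    using continuous_map_based_map_space_iff[of "gtop G" "lev \<Theta> V" "lev \<Theta> V" "bas \<Theta> V" "bas \<Theta> V" "\<lambda>g. gact \<Theta> g V"]
      G joint[OF V] maps V
    by (simp add: compact_Hausdorff_group_def lev_maps_def cgwh_weak_Hausdorff spectrum_maps_iff)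
qed

text \<open>The lifting property reads only \<open>Mor\<close> and \<open>Cmp\<close>, so it means
  the same before and after \<open>with_cofibrations\<close> overwrites \<open>Cof\<close>.\<close>

lemma Sp_G_simps:
  "Ob (Sp_G F G) = {\<Theta>. is_gspectrum F G \<Theta>}"
  "Mor (Sp_G F G) = gspectrum_maps F G"
  "Cmp (Sp_G F G) \<Theta> \<Psi> \<Phi> g f = spectrum_comp F \<Theta> g f"
  "Idt (Sp_G F G) = spectrum_id F"
  "Weq (Sp_G F G) \<Theta> \<Psi> = {f \<in> gspectrum_maps F G \<Theta> \<Psi>. pi_isomorphism F \<Theta> \<Psi> f}"
  "Fib (Sp_G F G) \<Theta> \<Psi> = {f \<in> gspectrum_maps F G \<Theta> \<Psi>. stable_fibration F \<Theta> \<Psi> f}"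
  "Cof (Sp_G F G) \<Theta> \<Psi> = {i \<in> gspectrum_maps F G \<Theta> \<Psi>.
     \<forall>X \<in> Ob (Sp_G F G). \<forall>Y \<in> Ob (Sp_G F G). \<forall>p \<in> Fib (Sp_G F G) X Y \<inter> Weq (Sp_G F G) X Y.
       has_llp (Sp_G F G) \<Theta> \<Psi> i X Y p}"
  by (simp_all add: Sp_G_def with_cofibrations_def has_llp_def)

section \<open>The category axioms\<close>

lemma gspectrum_comp_in:
  assumes \<Theta>: "is_gspectrum F G \<Theta>"
    and f: "f \<in> gspectrum_maps F G \<Theta> \<Psi>" and g: "g \<in> gspectrum_maps F G \<Psi> \<Phi>"
  shows "spectrum_comp F \<Theta> g f \<in> gspectrum_maps F G \<Theta> \<Phi>"
  unfolding gspectrum_maps_iff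
proof (intro conjI ballI)
  note S = gspectrum_spectrum[OF \<Theta>]
  show "spectrum_comp F \<Theta> g f \<in> spectrum_maps F \<Theta> \<Phi>"
    using f g spectrum_bas[OF S] spectrum_act_in[OF S]
    by (intro spectrum_comp_in[where \<Psi> = \<Psi>]) (simp_all add: gspectrum_maps_iff)
  fix k V x assume *: "k \<in> carrier G" "V \<in> fd_spaces F" "x \<in> topspace (lev \<Theta> V)"
  then have "f V x \<in> topspace (lev \<Psi> V)" using f by (auto simp: gspectrum_maps_iff intro: spectrum_maps_in)
  then show "spectrum_comp F \<Theta> g f V (gact \<Theta> k V x) = gact \<Phi> k V (spectrum_comp F \<Theta> g f V x)"
    using * f g by (simp add: spectrum_comp_apply gact_in[OF \<Theta>] gspectrum_maps_iff)
qed

lemma spectrum_id_apply: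
  "\<lbrakk>V \<in> fd_spaces F; x \<in> topspace (lev \<Theta> V)\<rbrakk> \<Longrightarrow> spectrum_id F \<Theta> V x = x"
  by (simp add: spectrum_id_def)

lemma spectrum_id_in:
  assumes "is_gspectrum F G \<Theta>"
  shows "spectrum_id F \<Theta> \<in> gspectrum_maps F G \<Theta> \<Theta>"
proof -
  note S = gspectrum_spectrum[OF assms]
  have "continuous_map (lev \<Theta> V) (lev \<Theta> V) (spectrum_id F \<Theta> V)" if "V \<in> fd_spaces F" for V
    by (rule continuous_map_eq[OF continuous_map_id]) (simp add: spectrum_id_apply that)
  moreover have "spectrum_id F \<Theta> \<in> extensional (fd_spaces F)"
    "V \<in> fd_spaces F \<Longrightarrow> spectrum_id F \<Theta> V \<in> extensional (topspace (lev \<Theta> V))" for V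
    by (auto simp: spectrum_id_def)
  ultimately show ?thesis
    using assms S by (simp add: gspectrum_maps_iff spectrum_maps_iff spectrum_id_apply gact_in
        spectrum_bas spectrum_act_in)
qed

lemma is_category_Sp_G:
  fixes G :: "'g topgroup"
  shows "is_category (Sp_G F G :: (('g, 'u) gspectrum, 'u spectrum_map) model_data)"
  unfolding is_category_def Sp_G_simps mem_Collect_eq
proof (intro conjI ballI)
  show "spectrum_id F \<Theta> \<in> gspectrum_maps F G \<Theta> \<Theta>" if "\<Theta> \<in> {\<Theta>. is_gspectrum F G \<Theta>}" for \<Theta>
    using that spectrum_id_in by blast
  show "spectrum_comp F \<Theta> g f \<in> gspectrum_maps F G \<Theta> \<Phi>"
    if "\<Theta> \<in> {\<Theta>. is_gspectrum F G \<Theta>}" "f \<in> gspectrum_maps F G \<Theta> \<Psi>" "g \<in> gspectrum_maps F G \<Psi> \<Phi>" for \<Theta> \<Psi> \<Phi> f g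
    using that gspectrum_comp_in by blast
  fix \<Theta> \<Psi> :: "('g, 'u) gspectrum" and f assume "f \<in> gspectrum_maps F G \<Theta> \<Psi>"
  then have f: "f \<in> spectrum_maps F \<Theta> \<Psi>" by (simp add: gspectrum_maps_iff)
  then have ext: "f \<in> extensional (fd_spaces F)" "\<And>V. V \<in> fd_spaces F \<Longrightarrow> f V \<in> extensional (topspace (lev \<Theta> V))"
    by (simp_all add: spectrum_maps_iff)
  show "spectrum_comp F \<Theta> f (spectrum_id F \<Theta>) = f"
    by (rule spectrum_family_eqI[OF spectrum_comp_extensional ext])
      (simp_all add: spectrum_comp_apply spectrum_id_apply)
  show "spectrum_comp F \<Theta> (spectrum_id F \<Psi>) f = f"
    by (rule spectrum_family_eqI[OF spectrum_comp_extensional ext])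
      (simp_all add: spectrum_comp_apply spectrum_id_apply spectrum_maps_in[OF f])
next
  fix \<Xi> \<Theta> \<Psi> :: "('g, 'u) gspectrum" and f g h :: "'u spectrum_map"
  assume "f \<in> gspectrum_maps F G \<Xi> \<Theta>"
  then have f: "f \<in> spectrum_maps F \<Xi> \<Theta>" by (simp add: gspectrum_maps_iff)
  show "spectrum_comp F \<Xi> (spectrum_comp F \<Theta> h g) f = spectrum_comp F \<Xi> h (spectrum_comp F \<Xi> g f)"
    unfolding spectrum_comp_eq_iff by (simp add: spectrum_comp_apply spectrum_maps_in[OF f])
qed

section \<open>Induction\<close>

locale spectrum_induction =
  fixes F :: "complex set" and G :: "'g topgroup" (structure) and H :: "'g set"
    and e :: "'g \<times> 'u \<Rightarrow> 'u"
  assumes F: "F = \<real> \<or> F = UNIV"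
    and topological_group: "topological_group G"
    and compact_G: "compact_space (gtop G)"
    and Hausdorff_G: "Hausdorff_space (gtop G)"
    and subgroup_H: "subgroup H G"
    and closed_H: "closedin (gtop G) H"
    and inj_e: "inj_on e (carrier G \<times> UNIV)"
begin

abbreviation K :: "'g topgroup" where "K \<equiv> subgroup_of G H"

lemma K_simps [simp]:
  "carrier K = H" "mult K = mult G" "one K = one G" "gtop K = subtopology (gtop G) H"
  by (simp_all add: subgroup_of_def)

lemma group_G: "group G" and topspace_G [simp]: "topspace (gtop G) = carrier G"
  and continuous_mult: "continuous_map (prod_topology (gtop G) (gtop G)) (gtop G) (\<lambda>(x, y). x \<otimes> y)"
  and continuous_inv: "continuous_map (gtop G) (gtop G) (\<lambda>x. inv x)"
  using topological_group by (simp_all add: topological_group_def)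

sublocale group G by (rule group_G)

lemma H_in: "h \<in> H \<Longrightarrow> h \<in> carrier G"
  using subgroup.mem_carrier[OF subgroup_H] .

lemma H_closed: "\<one> \<in> H" "\<lbrakk>h \<in> H; k \<in> H\<rbrakk> \<Longrightarrow> h \<otimes> k \<in> H" "h \<in> H \<Longrightarrow> inv h \<in> H"
  using subgroup_H by (auto intro: subgroup.one_closed subgroup.m_closed subgroup.m_inv_closed)

lemma compact_Hausdorff_G: "compact_Hausdorff_group G"
  by (simp add: compact_Hausdorff_group_def compact_G Hausdorff_G)

lemma compact_Hausdorff_K: "compact_Hausdorff_group K"
proof -
  have "compact_space (subtopology (gtop G) H)"
    using closed_H compact_G closedin_compact_space compact_space_subtopology by blast
  moreover have "carrier G \<inter> H = H" using H_in by auto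
  ultimately show ?thesis
    by (simp add: compact_Hausdorff_group_def Hausdorff_G Hausdorff_space_subtopology)
qed

section \<open>The identifications on pairs of a group element and a point\<close>

definition equivalent :: "('g, 'u) gspectrum \<Rightarrow> vec set \<Rightarrow> 'g \<times> 'u \<Rightarrow> 'g \<times> 'u \<Rightarrow> bool" where
  "equivalent \<Theta> V p p' \<longleftrightarrow> (snd p = bas \<Theta> V \<and> snd p' = bas \<Theta> V) \<or>
     (\<exists>h \<in> H. fst p' = fst p \<otimes> h \<and> snd p = gact \<Theta> h V (snd p'))"

abbreviation points :: "('g, 'u) gspectrum \<Rightarrow> vec set \<Rightarrow> ('g \<times> 'u) set" where
  "points \<Theta> V \<equiv> carrier G \<times> topspace (lev \<Theta> V)"

abbreviation cls :: "('g, 'u) gspectrum \<Rightarrow> vec set \<Rightarrow> 'g \<times> 'u \<Rightarrow> 'u" where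
  "cls \<equiv> ind_point e G H"

lemma ind_class_eq: "ind_class G H \<Theta> V p = {p' \<in> points \<Theta> V. equivalent \<Theta> V p p'}"
  by (auto simp: ind_class_def equivalent_def split: prod.splits)

context
  fixes \<Theta> :: "('g, 'u) gspectrum" and V
  assumes \<Theta>: "is_gspectrum F K \<Theta>" and V: "V \<in> fd_spaces F"
begin

lemma hact_in: "\<lbrakk>h \<in> H; x \<in> topspace (lev \<Theta> V)\<rbrakk> \<Longrightarrow> gact \<Theta> h V x \<in> topspace (lev \<Theta> V)"
  using gact_in[OF \<Theta> _ V] by simp

lemma hact_bas: "h \<in> H \<Longrightarrow> gact \<Theta> h V (bas \<Theta> V) = bas \<Theta> V"
  using gact_bas[OF \<Theta> _ V] by simp

lemma hact_mult: "\<lbrakk>h \<in> H; k \<in> H; x \<in> topspace (lev \<Theta> V)\<rbrakk> \<Longrightarrow> gact \<Theta> (h \<otimes> k) V x = gact \<Theta> h V (gact \<Theta> k V x)"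
  using gact_mult[OF \<Theta> _ _ V] by simp

lemma hact_one: "x \<in> topspace (lev \<Theta> V) \<Longrightarrow> gact \<Theta> \<one> V x = x"
  using gact_one[OF \<Theta> V] by simp

lemma hact_inv: "\<lbrakk>h \<in> H; x \<in> topspace (lev \<Theta> V)\<rbrakk> \<Longrightarrow> gact \<Theta> (inv h) V (gact \<Theta> h V x) = x"
  using hact_mult[of "inv h" h x] hact_one[of x] H_closed(3) H_in by simp

lemma hact_inv': "\<lbrakk>h \<in> H; x \<in> topspace (lev \<Theta> V)\<rbrakk> \<Longrightarrow> gact \<Theta> h V (gact \<Theta> (inv h) V x) = x"
  using hact_mult[of h "inv h" x] hact_one[of x] H_closed(3) H_in by simp

lemma bas_in: "bas \<Theta> V \<in> topspace (lev \<Theta> V)"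
  using spectrum_bas[OF gspectrum_spectrum[OF \<Theta>] V] .

lemma equivalent_refl: "p \<in> points \<Theta> V \<Longrightarrow> equivalent \<Theta> V p p"
  unfolding equivalent_def using H_closed(1) hact_one
  by (intro disjI2 bexI[of _ \<one>]) auto

lemma equivalent_sym:
  assumes p: "p \<in> points \<Theta> V" "p' \<in> points \<Theta> V" and "equivalent \<Theta> V p p'"
  shows "equivalent \<Theta> V p' p"
  using assms(3) unfolding equivalent_def
proof (elim disjE bexE)
  fix h assume h: "h \<in> H" "fst p' = fst p \<otimes> h \<and> snd p = gact \<Theta> h V (snd p')"
  then have "fst p = fst p' \<otimes> inv h" "snd p' = gact \<Theta> (inv h) V (snd p)"
    using p H_in[OF h(1)] hact_inv[OF h(1)] by (auto simp: m_assoc)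
  then show "snd p' = bas \<Theta> V \<and> snd p = bas \<Theta> V \<or>
    (\<exists>h\<in>H. fst p = fst p' \<otimes> h \<and> snd p' = gact \<Theta> h V (snd p))"
    using H_closed(3)[OF h(1)] by blast
qed simp

text \<open>Two successive translations multiply their elements of \<open>H\<close>. The two clauses
  mix only at the base point, which \<open>H\<close> fixes: if the middle pair lies over it, so do
  the other two.\<close>

lemma equivalent_trans:
  assumes p: "p \<in> points \<Theta> V" "p' \<in> points \<Theta> V" "p'' \<in> points \<Theta> V"
    and "equivalent \<Theta> V p p'" "equivalent \<Theta> V p' p''"
  shows "equivalent \<Theta> V p p''"
proof (cases "snd p' = bas \<Theta> V")
  case True
  have "snd p = bas \<Theta> V"
    using assms(4) True hact_bas by (auto simp: equivalent_def)
  moreover have "equivalent \<Theta> V p'' p'" using equivalent_sym[OF p(2,3) assms(5)] .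
  then have "snd p'' = bas \<Theta> V"
    using True hact_bas by (auto simp: equivalent_def)
  ultimately show ?thesis by (simp add: equivalent_def)
next
  case False
  then obtain h k where h: "h \<in> H" "fst p' = fst p \<otimes> h" "snd p = gact \<Theta> h V (snd p')"
      and k: "k \<in> H" "fst p'' = fst p' \<otimes> k" "snd p' = gact \<Theta> k V (snd p'')"
    using assms(4,5) by (auto simp: equivalent_def)
  then have "fst p'' = fst p \<otimes> (h \<otimes> k)" "snd p = gact \<Theta> (h \<otimes> k) V (snd p'')"
    using p H_in hact_mult[OF h(1) k(1)] by (auto simp: m_assoc)
  then show ?thesis using H_closed(2)[OF h(1) k(1)] by (auto simp: equivalent_def)
qed

text \<open>Equal codes mean equal chosen representatives, as \<open>e\<close> is injective, and a
  common representative links the two classes. Conversely, equal classes lead to the same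
  choice.\<close>

lemma cls_eq_iff:
  assumes p: "p \<in> points \<Theta> V" "p' \<in> points \<Theta> V"
  shows "cls \<Theta> V p = cls \<Theta> V p' \<longleftrightarrow> equivalent \<Theta> V p p'"
proof
  let ?s = "\<lambda>p. SOME q. q \<in> ind_class G H \<Theta> V p"
  have s: "?s p \<in> ind_class G H \<Theta> V p" if "p \<in> points \<Theta> V" for p
    by (rule someI[of _ p]) (use that equivalent_refl in \<open>auto simp: ind_class_eq\<close>)
  assume "cls \<Theta> V p = cls \<Theta> V p'"
  then have "e (?s p) = e (?s p')" by (simp add: ind_point_def)
  moreover have "?s p \<in> carrier G \<times> UNIV" "?s p' \<in> carrier G \<times> UNIV"
    using s[OF p(1)] s[OF p(2)] by (auto simp: ind_class_eq)
  ultimately have "?s p = ?s p'" using inj_e by (meson inj_onD)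
  then have s: "?s p \<in> points \<Theta> V" "equivalent \<Theta> V p (?s p)" "equivalent \<Theta> V p' (?s p)"
    using s[OF p(1)] s[OF p(2)] by (simp_all add: ind_class_eq)
  show "equivalent \<Theta> V p p'"
    by (rule equivalent_trans[OF p(1) s(1) p(2) s(2) equivalent_sym[OF p(2) s(1,3)]])
next
  assume r: "equivalent \<Theta> V p p'"
  have "equivalent \<Theta> V p q \<longleftrightarrow> equivalent \<Theta> V p' q" if q: "q \<in> points \<Theta> V" for q
    using equivalent_trans[OF p q r] equivalent_trans[OF p(2,1) q equivalent_sym[OF p r]] by (rule iffI[rotated])
  then have "ind_class G H \<Theta> V p = ind_class G H \<Theta> V p'"
    unfolding ind_class_eq by (intro Collect_cong conj_cong refl)
  then show "cls \<Theta> V p = cls \<Theta> V p'" by (simp add: ind_point_def)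
qed

section \<open>The quotient at one level\<close>

lemma cgwh_lev: "cgwh (lev \<Theta> V)"
  using spectrum_cgwh[OF gspectrum_spectrum[OF \<Theta>] V] .

lemma ind_lev_eq: "ind_lev e G H \<Theta> V = quot_topology (prod_topology (gtop G) (lev \<Theta> V)) (cls \<Theta> V)"
  by (simp add: ind_lev_def kprod_def kify_prod_cgwh[OF compact_G Hausdorff_G cgwh_lev])

lemma topspace_ind_lev: "topspace (ind_lev e G H \<Theta> V) = cls \<Theta> V ` points \<Theta> V"
  by (simp add: ind_lev_eq)

lemma cls_in: "\<lbrakk>g \<in> carrier G; x \<in> topspace (lev \<Theta> V)\<rbrakk> \<Longrightarrow> cls \<Theta> V (g, x) \<in> topspace (ind_lev e G H \<Theta> V)"
  by (simp add: topspace_ind_lev)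

lemma quotient_map_cls:
  "quotient_map (prod_topology (gtop G) (lev \<Theta> V)) (ind_lev e G H \<Theta> V) (cls \<Theta> V)"
  unfolding ind_lev_eq by (rule quotient_map_quot_topology)

lemma continuous_map_cls:
  "continuous_map (prod_topology (gtop G) (lev \<Theta> V)) (ind_lev e G H \<Theta> V) (cls \<Theta> V)"
  by (rule quotient_imp_continuous_map[OF quotient_map_cls])

lemma continuous_map_hact:
  "continuous_map (prod_topology (subtopology (gtop G) H) (lev \<Theta> V)) (lev \<Theta> V) (\<lambda>(h, x). gact \<Theta> h V x)"
  using gact_joint[OF compact_Hausdorff_K \<Theta> V] by simp

text \<open>For fixed \<open>(g, x)\<close> with \<open>x\<close> not the base point,
  \<open>h \<mapsto> (g h, inv h x)\<close> runs through the class of \<open>(g, x)\<close>.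
  Continuity in all variables lets the compactness of \<open>H\<close> control classes and
  saturations.\<close>

lemma continuous_map_orbit:
  "continuous_map (prod_topology (subtopology (gtop G) H) (prod_topology (gtop G) (lev \<Theta> V)))
     (prod_topology (gtop G) (lev \<Theta> V)) (\<lambda>z. (fst (snd z) \<otimes> fst z, gact \<Theta> (inv (fst z)) V (snd (snd z))))"
proof -
  let ?K = "subtopology (gtop G) H"
  let ?Z = "prod_topology ?K (prod_topology (gtop G) (lev \<Theta> V))"
  have 1: "continuous_map ?Z ?K fst" and 2: "continuous_map ?Z (gtop G) (\<lambda>z. fst (snd z))"
    and 3: "continuous_map ?Z (lev \<Theta> V) (\<lambda>z. snd (snd z))"
    by (auto intro: continuous_map_fst continuous_map_snd continuous_map_fst' continuous_map_snd')
  have "continuous_map ?K ?K (\<lambda>h. inv h)"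
    using H_closed(3) by (intro continuous_map_into_subtopology continuous_map_from_subtopology continuous_inv) auto
  then have 4: "continuous_map ?Z ?K (\<lambda>z. inv (fst z))"
    using continuous_map_compose[OF 1] by (simp add: o_def)
  have 5: "continuous_map ?Z (gtop G) fst"
    using 1 by (simp add: continuous_map_in_subtopology)
  show ?thesis
    by (intro continuous_map_pairedI continuous_map_joint[OF continuous_mult] 2 5
        continuous_map_joint[OF continuous_map_hact] 3 4)
qed

lemma equivalent_orbit:
  assumes "p \<in> points \<Theta> V" "p' \<in> points \<Theta> V" "snd p \<noteq> bas \<Theta> V \<or> snd p' \<noteq> bas \<Theta> V"
  shows "equivalent \<Theta> V p p' \<longleftrightarrow> (\<exists>h \<in> H. p' = (fst p \<otimes> h, gact \<Theta> (inv h) V (snd p)))"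
  using assms hact_inv hact_inv' by (auto simp: equivalent_def prod_eq_iff)

lemma closedin_bas: "closedin (prod_topology (gtop G) (lev \<Theta> V)) (carrier G \<times> {bas \<Theta> V})"
  using weak_Hausdorff_t1[OF cgwh_weak_Hausdorff[OF cgwh_lev]] bas_in
  by (metis closedin_prod_Times_iff closedin_topspace t1_space_closedin_singleton topspace_G)

text \<open>The saturation of a closed \<open>C\<close> is the projection, along the compact
  \<open>H\<close>, of the preimage of \<open>C\<close> under the orbit map, possibly together with
  the slice over the base point. A fibre is an orbit of \<open>H\<close> or that slice, hence
  compact. As \<open>H\<close> acts freely on \<open>G\<close>, distinct points over the same
  \<open>g\<close> are never identified except at the base point, where they agree.\<close>

lemma cgwh_ind_lev: "cgwh (ind_lev e G H \<Theta> V)"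
  unfolding ind_lev_eq
proof (rule cgwh_quot_topology[OF compact_G Hausdorff_G cgwh_lev])
  let ?P = "prod_topology (gtop G) (lev \<Theta> V)" and ?K = "subtopology (gtop G) H"
  let ?m = "\<lambda>z. (fst (snd z) \<otimes> fst z, gact \<Theta> (inv (fst z)) V (snd (snd z)))"
  have topK: "topspace ?K = H" and cK: "compact_space ?K"
    using compact_Hausdorff_K by (simp_all add: compact_Hausdorff_group_def)
  have top: "topspace ?P = points \<Theta> V" by simp
  fix C assume C: "closedin ?P C"
  have CP: "C \<subseteq> points \<Theta> V" using closedin_subset[OF C] by simp
  have "closedin (prod_topology ?K ?P) {z \<in> topspace (prod_topology ?K ?P). ?m z \<in> C}"
    by (rule closedin_continuous_map_preimage[OF continuous_map_orbit C])
  then have orbit: "closedin ?P (snd ` {z \<in> topspace (prod_topology ?K ?P). ?m z \<in> C})" (is "closedin ?P ?O")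
    using closed_map_snd[OF cK] unfolding closed_map_def by blast
  \<comment> \<open>The orbit part reaches only pairs whose first coordinates lie in the cosets met
    by \<open>C\<close>; the collapse adds the whole slice over the base point as soon as
    \<open>C\<close> meets it.\<close>
  let ?B = "if C \<inter> (carrier G \<times> {bas \<Theta> V}) = {} then {} else carrier G \<times> {bas \<Theta> V}"
  have "{p \<in> topspace ?P. cls \<Theta> V p \<in> cls \<Theta> V ` C} = ?O \<union> ?B"
  proof (intro equalityI subsetI)
    fix p assume "p \<in> {p \<in> topspace ?P. cls \<Theta> V p \<in> cls \<Theta> V ` C}"
    then obtain c where p: "p \<in> points \<Theta> V" and c: "c \<in> C" "equivalent \<Theta> V p c"
      using cls_eq_iff CP by auto
    have cP: "c \<in> points \<Theta> V" using c CP by blast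
    show "p \<in> ?O \<union> ?B"
    proof (cases "snd p = bas \<Theta> V \<and> snd c = bas \<Theta> V")
      case True
      then have "c \<in> C \<inter> (carrier G \<times> {bas \<Theta> V})" using c cP by (cases c) auto
      moreover have "p \<in> carrier G \<times> {bas \<Theta> V}" using True p by (cases p) auto
      ultimately show ?thesis by auto
    next
      case False
      then obtain h where "h \<in> H" "c = (fst p \<otimes> h, gact \<Theta> (inv h) V (snd p))"
        using equivalent_orbit[OF p cP] c(2) by blast
      then have "(h, p) \<in> {z \<in> topspace (prod_topology ?K ?P). ?m z \<in> C}"
        using p c(1) by (simp add: H_in)
      then have "snd (h, p) \<in> ?O" by (rule imageI)
      then show ?thesis unfolding snd_conv by (rule UnI1)
    qed
  next
    fix p assume "p \<in> ?O \<union> ?B"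
    then show "p \<in> {p \<in> topspace ?P. cls \<Theta> V p \<in> cls \<Theta> V ` C}"
    proof
      assume "p \<in> ?O"
      then obtain z where z: "z \<in> topspace (prod_topology ?K ?P)" "?m z \<in> C" "p = snd z" by blast
      define h where "h = fst z"
      have h: "h \<in> H" and p: "p \<in> points \<Theta> V" using z(1,3) by (auto simp: h_def)
      have c: "?m (h, p) \<in> C" using z(2,3) by (simp add: h_def)
      have "equivalent \<Theta> V p (?m (h, p))"
        using h p hact_inv' by (auto simp: equivalent_def intro!: bexI[of _ h])
      then have "cls \<Theta> V p = cls \<Theta> V (?m (h, p))"
        using cls_eq_iff[OF p] c CP by blast
      then show ?thesis using p c by auto
    next
      assume B: "p \<in> ?B"
      then obtain g where g: "(g, bas \<Theta> V) \<in> C" by (auto split: if_splits)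
      have p: "p \<in> points \<Theta> V" "snd p = bas \<Theta> V" using B bas_in by (auto split: if_splits)
      have "equivalent \<Theta> V p (g, bas \<Theta> V)" using p by (simp add: equivalent_def)
      then have "cls \<Theta> V p = cls \<Theta> V (g, bas \<Theta> V)" using cls_eq_iff[OF p(1)] g CP by blast
      then show ?thesis using p(1) g by auto
    qed
  qed
  moreover have "closedin ?P ?B" using closedin_bas by simp
  ultimately show "closedin ?P {p \<in> topspace ?P. cls \<Theta> V p \<in> cls \<Theta> V ` C}"
    using orbit by (simp add: closedin_Un)
next
  let ?P = "prod_topology (gtop G) (lev \<Theta> V)" and ?K = "subtopology (gtop G) H"
  have topK: "topspace ?K = H" and cK: "compact_space ?K"
    using compact_Hausdorff_K by (simp_all add: compact_Hausdorff_group_def)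
  fix p assume "p \<in> topspace ?P"
  then have p: "p \<in> points \<Theta> V" by simp
  have eq: "{p' \<in> topspace ?P. cls \<Theta> V p' = cls \<Theta> V p} = {p' \<in> points \<Theta> V. equivalent \<Theta> V p p'}"
    using cls_eq_iff[OF p] by (auto dest: sym)
  show "compactin ?P {p' \<in> topspace ?P. cls \<Theta> V p' = cls \<Theta> V p}"
  proof (cases "snd p = bas \<Theta> V")
    case True
    \<comment> \<open>Elements of \<open>H\<close> act bijectively and fix the base point, so only
      the base point is translated to it.\<close>
    then have "{p' \<in> points \<Theta> V. equivalent \<Theta> V p p'} = carrier G \<times> {bas \<Theta> V}"
      using bas_in equivalent_sym[OF p] hact_bas p
      by (auto simp: equivalent_def) (metis hact_inv hact_bas H_closed(3))
    moreover have "compactin ?P (carrier G \<times> {bas \<Theta> V})"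
      using compact_G bas_in by (simp add: compactin_Times compact_space_def)
    ultimately show ?thesis unfolding eq by simp
  next
    case False
    let ?o = "\<lambda>h. (fst p \<otimes> h, gact \<Theta> (inv h) V (snd p))"
    have c: "continuous_map ?K ?P ?o"
    proof -
      have "continuous_map ?K (prod_topology ?K ?P) (\<lambda>h. (h, p))"
        using p by (intro continuous_map_pairedI) auto
      from continuous_map_compose[OF this continuous_map_orbit] show ?thesis by (simp add: o_def)
    qed
    have "{p' \<in> points \<Theta> V. equivalent \<Theta> V p p'} = ?o ` H"
    proof (intro equalityI subsetI)
      fix p' assume "p' \<in> {p' \<in> points \<Theta> V. equivalent \<Theta> V p p'}"
      then show "p' \<in> ?o ` H" using equivalent_orbit[OF p, of p'] False by blast
    next
      fix p' assume p': "p' \<in> ?o ` H"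
      have "p' \<in> points \<Theta> V"
        using p' continuous_map_image_subset_topspace[OF c] unfolding topK by auto
      then show "p' \<in> {p' \<in> points \<Theta> V. equivalent \<Theta> V p p'}"
        using equivalent_orbit[OF p, of p'] False p' by blast
    qed
    moreover have "compactin ?P (?o ` H)"
      using cK unfolding compact_space_def topK by (rule image_compactin[OF _ c])
    ultimately show ?thesis unfolding eq by simp
  qed
next
  fix g x x' assume *: "g \<in> topspace (gtop G)" "x \<in> topspace (lev \<Theta> V)" "x' \<in> topspace (lev \<Theta> V)"
    "cls \<Theta> V (g, x) = cls \<Theta> V (g, x')"
  then have "equivalent \<Theta> V (g, x) (g, x')" using cls_eq_iff by simp
  then consider "x = bas \<Theta> V" "x' = bas \<Theta> V" | h where "h \<in> H" "g = g \<otimes> h" "x = gact \<Theta> h V x'"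
    by (auto simp: equivalent_def)
  then show "x = x'"
  proof cases
    case 2
    then have "h = \<one>" using * H_in by (metis l_cancel_one' topspace_G)
    then show ?thesis using 2 hact_one * by simp
  qed simp
qed

section \<open>Maps out of the quotient\<close>

lemma ind_lift_apply:
  assumes r: "\<And>p p'. \<lbrakk>p \<in> points \<Theta> V; p' \<in> points \<Theta> V; equivalent \<Theta> V p p'\<rbrakk> \<Longrightarrow> r p = r p'"
    and p: "p \<in> points \<Theta> V"
  shows "ind_lift e G H \<Theta> V r (cls \<Theta> V p) = r p"
proof -
  \<comment> \<open>\<open>inv_into\<close> may pick a representative other than \<open>p\<close>;
    it lies in the same class, and \<open>r\<close> does not distinguish the two.\<close>
  let ?p = "inv_into (points \<Theta> V) (cls \<Theta> V) (cls \<Theta> V p)"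
  have q: "?p \<in> points \<Theta> V" "cls \<Theta> V ?p = cls \<Theta> V p"
    using p by (auto intro: inv_into_into f_inv_into_f)
  have "r ?p = r p"
    by (rule r[OF q(1) p]) (use cls_eq_iff[OF q(1) p] q(2) in simp)
  then show ?thesis using p by (simp add: ind_lift_def topspace_ind_lev)
qed

lemma ind_lift_extensional: "ind_lift e G H \<Theta> V r \<in> extensional (topspace (ind_lev e G H \<Theta> V))"
  by (simp add: ind_lift_def)

lemma continuous_map_ind_lift:
  assumes r: "\<And>p p'. \<lbrakk>p \<in> points \<Theta> V; p' \<in> points \<Theta> V; equivalent \<Theta> V p p'\<rbrakk> \<Longrightarrow> r p = r p'"
    and cont: "continuous_map (prod_topology (gtop G) (lev \<Theta> V)) Y r"
  shows "continuous_map (ind_lev e G H \<Theta> V) Y (ind_lift e G H \<Theta> V r)"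
proof (rule continuous_compose_quotient_map[OF quotient_map_cls])
  show "continuous_map (prod_topology (gtop G) (lev \<Theta> V)) Y (ind_lift e G H \<Theta> V r \<circ> cls \<Theta> V)"
    by (rule continuous_map_eq[OF cont]) (simp add: ind_lift_apply[OF r])
qed

text \<open>The product of a quotient map with the identity of a locally compact Hausdorff space is
  again a quotient map, so joint continuity can be checked before passing to classes.\<close>

lemma continuous_map_ind_lift_joint:
  assumes A: "compact_space A" "Hausdorff_space A"
    and r: "\<And>a p p'. \<lbrakk>a \<in> topspace A; p \<in> points \<Theta> V; p' \<in> points \<Theta> V; equivalent \<Theta> V p p'\<rbrakk> \<Longrightarrow> r a p = r a p'"
    and cont: "continuous_map (prod_topology A (prod_topology (gtop G) (lev \<Theta> V))) Y (\<lambda>z. r (fst z) (snd z))"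
  shows "continuous_map (prod_topology A (ind_lev e G H \<Theta> V)) Y (\<lambda>(a, y). ind_lift e G H \<Theta> V (r a) y)"
proof (rule continuous_compose_quotient_map)
  show "quotient_map (prod_topology A (prod_topology (gtop G) (lev \<Theta> V))) (prod_topology A (ind_lev e G H \<Theta> V))
      (\<lambda>(a, p). (a, cls \<Theta> V p))"
    using A compact_imp_locally_compact_space by (intro quotient_map_prod_right quotient_map_cls) auto
  show "continuous_map (prod_topology A (prod_topology (gtop G) (lev \<Theta> V))) Y
      ((\<lambda>(a, y). ind_lift e G H \<Theta> V (r a) y) \<circ> (\<lambda>(a, p). (a, cls \<Theta> V p)))"
    by (rule continuous_map_eq[OF cont]) (auto simp: ind_lift_apply[OF r])
qed

end

end

section \<open>Induced spectra\<close>

context spectrum_induction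
begin

text \<open>One computation for the structure maps, where \<open>\<Theta> = \<Psi>\<close>, and for
  the induced maps, where \<open>U = V\<close>: a based \<open>H\<close>-equivariant
  \<open>\<phi>\<close> respects both clauses of \<open>equivalent\<close>.\<close>

lemma
  assumes \<Theta>: "is_gspectrum F K \<Theta>" and \<Psi>: "is_gspectrum F K \<Psi>"
    and U: "U \<in> fd_spaces F" and V: "V \<in> fd_spaces F"
    and \<phi>: "\<And>x. x \<in> topspace (lev \<Theta> U) \<Longrightarrow> \<phi> x \<in> topspace (lev \<Psi> V)" "\<phi> (bas \<Theta> U) = bas \<Psi> V"
      "\<And>h x. h \<in> H \<Longrightarrow> x \<in> topspace (lev \<Theta> U) \<Longrightarrow> \<phi> (gact \<Theta> h U x) = gact \<Psi> h V (\<phi> x)"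
  shows ind_lift_snd_respects: "\<lbrakk>p \<in> points \<Theta> U; p' \<in> points \<Theta> U; equivalent \<Theta> U p p'\<rbrakk> \<Longrightarrow>
      (\<lambda>(g, x). cls \<Psi> V (g, \<phi> x)) p = (\<lambda>(g, x). cls \<Psi> V (g, \<phi> x)) p'"
    and ind_lift_snd_apply: "\<lbrakk>g \<in> carrier G; x \<in> topspace (lev \<Theta> U)\<rbrakk> \<Longrightarrow>
      ind_lift e G H \<Theta> U (\<lambda>(g, x). cls \<Psi> V (g, \<phi> x)) (cls \<Theta> U (g, x)) = cls \<Psi> V (g, \<phi> x)"
proof -
  show r: "(\<lambda>(g, x). cls \<Psi> V (g, \<phi> x)) p = (\<lambda>(g, x). cls \<Psi> V (g, \<phi> x)) p'"
    if p: "p \<in> points \<Theta> U" "p' \<in> points \<Theta> U" and eq: "equivalent \<Theta> U p p'" for p p'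
  proof -
    obtain g x g' x' where pq: "p = (g, x)" "p' = (g', x')" by (cases p, cases p')
    have "equivalent \<Psi> V (g, \<phi> x) (g', \<phi> x')"
      using eq p \<phi> unfolding pq equivalent_def by auto
    then have "cls \<Psi> V (g, \<phi> x) = cls \<Psi> V (g', \<phi> x')"
      using p \<phi>(1) by (subst cls_eq_iff[OF \<Psi> V]) (auto simp: pq)
    then show ?thesis by (simp add: pq)
  qed
  show "ind_lift e G H \<Theta> U (\<lambda>(g, x). cls \<Psi> V (g, \<phi> x)) (cls \<Theta> U (g, x)) = cls \<Psi> V (g, \<phi> x)"
    if "g \<in> carrier G" "x \<in> topspace (lev \<Theta> U)"
    using ind_lift_apply[OF \<Theta> U r, where p = "(g, x)"] that by simp
qed

lemma ind_ob_simps [simp]: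
  "lev (ind_ob F e G H \<Theta>) = ind_lev e G H \<Theta>"
  "bas (ind_ob F e G H \<Theta>) V = cls \<Theta> V (\<one>, bas \<Theta> V)"
  by (simp_all add: ind_ob_def)

lemma cls_bas:
  assumes "is_gspectrum F K \<Theta>" "V \<in> fd_spaces F" "g \<in> carrier G" "g' \<in> carrier G"
  shows "cls \<Theta> V (g, bas \<Theta> V) = cls \<Theta> V (g', bas \<Theta> V)"
  using assms by (subst cls_eq_iff) (auto simp: equivalent_def bas_in)

lemma cls_hact:
  assumes \<Theta>: "is_gspectrum F K \<Theta>" and V: "V \<in> fd_spaces F"
    and "g \<in> carrier G" "h \<in> H" "x \<in> topspace (lev \<Theta> V)"
  shows "cls \<Theta> V (g, gact \<Theta> h V x) = cls \<Theta> V (g \<otimes> h, x)"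
  using assms by (subst cls_eq_iff[OF \<Theta> V]) (auto simp: equivalent_def H_in hact_in)

lemma ind_lev_cases:
  assumes "is_gspectrum F K \<Theta>" "V \<in> fd_spaces F" "y \<in> topspace (lev (ind_ob F e G H \<Theta>) V)"
  shows "\<exists>g x. g \<in> carrier G \<and> x \<in> topspace (lev \<Theta> V) \<and> y = cls \<Theta> V (g, x)"
  using assms by (auto simp: topspace_ind_lev)

context
  fixes \<Theta> :: "('g, 'u) gspectrum"
  assumes \<Theta>: "is_gspectrum F K \<Theta>"
begin

lemma ind_act_respects:
  assumes "U \<in> fd_spaces F" "V \<in> fd_spaces F" "a \<in> topspace (J1 F U V)"
    and "p \<in> points \<Theta> U" "p' \<in> points \<Theta> U" "equivalent \<Theta> U p p'"
  shows "(\<lambda>(g, x). cls \<Theta> V (g, act \<Theta> U V a x)) p = (\<lambda>(g, x). cls \<Theta> V (g, act \<Theta> U V a x)) p'"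
  using assms(4-6)
  by (rule ind_lift_snd_respects[OF \<Theta> \<Theta> assms(1,2), rotated -3])
    (simp_all add: spectrum_act_in[OF gspectrum_spectrum[OF \<Theta>]] spectrum_act_bas[OF gspectrum_spectrum[OF \<Theta>]] gact_act[OF \<Theta>] assms)

lemma ind_act_apply:
  assumes "U \<in> fd_spaces F" "V \<in> fd_spaces F" "a \<in> topspace (J1 F U V)" "g \<in> carrier G" "x \<in> topspace (lev \<Theta> U)"
  shows "act (ind_ob F e G H \<Theta>) U V a (cls \<Theta> U (g, x)) = cls \<Theta> V (g, act \<Theta> U V a x)"
  using ind_lift_apply[OF \<Theta> assms(1) ind_act_respects[OF assms(1-3)], where p = "(g, x)"] assms(4,5)
  by (simp add: ind_ob_def)

lemma is_spectrum_ind: "is_spectrum F (ind_ob F e G H \<Theta>)"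
proof (rule is_spectrumI[OF F])
  fix U V assume U: "U \<in> fd_spaces F" and V: "V \<in> fd_spaces F"
  let ?J = "J1 F U V" and ?PU = "prod_topology (gtop G) (lev \<Theta> U)"
  show "cgwh (lev (ind_ob F e G H \<Theta>) V)"
    using cgwh_ind_lev[OF \<Theta> V] by simp
  show "bas (ind_ob F e G H \<Theta>) V \<in> topspace (lev (ind_ob F e G H \<Theta>) V)"
    using cls_in[OF \<Theta> V] bas_in[OF \<Theta> V] by simp
  show "act (ind_ob F e G H \<Theta>) U V a \<in> extensional (topspace (lev (ind_ob F e G H \<Theta>) U))" for a
    using ind_lift_extensional[OF \<Theta> U] by (simp add: ind_ob_def)
  show "act (ind_ob F e G H \<Theta>) U V a (bas (ind_ob F e G H \<Theta>) U) = bas (ind_ob F e G H \<Theta>) V"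
    if "a \<in> topspace ?J" for a
    using ind_act_apply[OF U V that one_closed bas_in[OF \<Theta> U]] spectrum_act_bas[OF gspectrum_spectrum[OF \<Theta>] U V that] by simp
  have "continuous_map (prod_topology ?J (ind_lev e G H \<Theta> U)) (ind_lev e G H \<Theta> V)
      (\<lambda>(a, y). ind_lift e G H \<Theta> U (\<lambda>(g, x). cls \<Theta> V (g, act \<Theta> U V a x)) y)"
  proof (rule continuous_map_ind_lift_joint[OF \<Theta> U compact_Hausdorff_J1[OF F U V] ind_act_respects[OF U V]])
    let ?Z = "prod_topology ?J ?PU"
    have 1: "continuous_map ?Z ?J fst" and 2: "continuous_map ?Z (gtop G) (\<lambda>z. fst (snd z))"
      and 3: "continuous_map ?Z (lev \<Theta> U) (\<lambda>z. snd (snd z))"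
      by (auto intro: continuous_map_fst continuous_map_snd continuous_map_fst' continuous_map_snd')
    have "continuous_map ?Z (prod_topology (gtop G) (lev \<Theta> V)) (\<lambda>z. (fst (snd z), act \<Theta> U V (fst z) (snd (snd z))))"
      by (intro continuous_map_pairedI 2 continuous_map_joint[OF spectrum_act_joint[OF gspectrum_spectrum[OF \<Theta>] U V F]] 1 3)
    from continuous_map_compose[OF this continuous_map_cls[OF \<Theta> V]]
    show "continuous_map ?Z (ind_lev e G H \<Theta> V) (\<lambda>z. (\<lambda>(g, x). cls \<Theta> V (g, act \<Theta> U V (fst z) x)) (snd z))"
      by (simp add: o_def case_prod_beta)
  qed
  then show "continuous_map (prod_topology ?J (lev (ind_ob F e G H \<Theta>) U)) (lev (ind_ob F e G H \<Theta>) V)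
      (\<lambda>(a, x). act (ind_ob F e G H \<Theta>) U V a x)"
    by (simp add: ind_ob_def)
  show "act (ind_ob F e G H \<Theta>) U V None y = bas (ind_ob F e G H \<Theta>) V"
    if yin: "y \<in> topspace (lev (ind_ob F e G H \<Theta>) U)" for y
  proof -
    obtain g x where y: "g \<in> carrier G" "x \<in> topspace (lev \<Theta> U)" "y = cls \<Theta> U (g, x)"
      using ind_lev_cases[OF \<Theta> U yin] by blast
    show ?thesis
      using ind_act_apply[OF U V None_in_J1 y(1,2)] spectrum_act_None[OF gspectrum_spectrum[OF \<Theta>] U V y(2)]
        cls_bas[OF \<Theta> V y(1) one_closed] by (simp add: y(3))
  qed
  show "act (ind_ob F e G H \<Theta>) V V (J1_id V) y = y" if yin: "y \<in> topspace (lev (ind_ob F e G H \<Theta>) V)" for y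
  proof -
    obtain g x where y: "g \<in> carrier G" "x \<in> topspace (lev \<Theta> V)" "y = cls \<Theta> V (g, x)"
      using ind_lev_cases[OF \<Theta> V yin] by blast
    \<comment> \<open>\<open>ind_act_apply\<close> would ask that \<open>J1_id V\<close> be a point
      of the morphism space. That it acts as the identity is already enough to see that the formula
      respects classes.\<close>
    have "ind_lift e G H \<Theta> V (\<lambda>(g, x). cls \<Theta> V (g, act \<Theta> V V (J1_id V) x)) (cls \<Theta> V (g, x)) =
        cls \<Theta> V (g, act \<Theta> V V (J1_id V) x)"
      by (rule ind_lift_snd_apply[OF \<Theta> \<Theta> V V])
        (simp_all add: spectrum_act_id[OF gspectrum_spectrum[OF \<Theta>] V] bas_in[OF \<Theta> V] hact_in[OF \<Theta> V] y)
    then show ?thesis by (simp add: ind_ob_def y spectrum_act_id[OF gspectrum_spectrum[OF \<Theta>] V])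
  qed
  fix W a b y
  assume W: "W \<in> fd_spaces F" and a: "a \<in> topspace ?J" and b: "b \<in> topspace (J1 F V W)"
    and yin: "y \<in> topspace (lev (ind_ob F e G H \<Theta>) U)"
  obtain g x where y: "g \<in> carrier G" "x \<in> topspace (lev \<Theta> U)" "y = cls \<Theta> U (g, x)"
    using ind_lev_cases[OF \<Theta> U yin] by blast
  note S = gspectrum_spectrum[OF \<Theta>]
  note comp = spectrum_act_comp[OF S U V W a b]
  \<comment> \<open>As for \<open>J1_id V\<close>, membership of the composite in
    \<open>J1 F U W\<close> is avoided: \<open>comp\<close> replaces it by two successive structure
    maps, each of them based and equivariant.\<close>
  have "ind_lift e G H \<Theta> U (\<lambda>(g, x). cls \<Theta> W (g, act \<Theta> U W (J1_comp U b a) x)) (cls \<Theta> U (g, x)) =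
      cls \<Theta> W (g, act \<Theta> U W (J1_comp U b a) x)"
    by (rule ind_lift_snd_apply[OF \<Theta> \<Theta> U W])
      (simp_all add: comp bas_in[OF \<Theta> U] hact_in[OF \<Theta> U] y spectrum_act_in[OF S U V a] spectrum_act_in[OF S V W b]
        spectrum_act_bas[OF S U V a] spectrum_act_bas[OF S V W b]
        gact_act[OF \<Theta> _ U V a, symmetric] gact_act[OF \<Theta> _ V W b, symmetric])
  then have "act (ind_ob F e G H \<Theta>) U W (J1_comp U b a) y = cls \<Theta> W (g, act \<Theta> U W (J1_comp U b a) x)"
    by (simp add: ind_ob_def y)
  then show "act (ind_ob F e G H \<Theta>) U W (J1_comp U b a) y =
      act (ind_ob F e G H \<Theta>) V W b (act (ind_ob F e G H \<Theta>) U V a y)"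
    using ind_act_apply[OF U V a y(1,2)] ind_act_apply[OF V W b y(1) spectrum_act_in[OF S U V a y(2)]]
    by (simp add: y comp)
qed

text \<open>Left multiplication by \<open>k\<close> commutes with the right multiplications by
  \<open>H\<close> that define the classes.\<close>

lemma ind_gact_respects:
  assumes V: "V \<in> fd_spaces F" and k: "k \<in> carrier G"
    and "p \<in> points \<Theta> V" "p' \<in> points \<Theta> V" "equivalent \<Theta> V p p'"
  shows "(\<lambda>(g, x). cls \<Theta> V (k \<otimes> g, x)) p = (\<lambda>(g, x). cls \<Theta> V (k \<otimes> g, x)) p'"
proof -
  obtain g x g' x' where pq: "p = (g, x)" "p' = (g', x')" by (cases p, cases p')
  have "equivalent \<Theta> V (k \<otimes> g, x) (k \<otimes> g', x')"
    using assms unfolding pq equivalent_def by (auto simp: m_assoc H_in)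
  then have "cls \<Theta> V (k \<otimes> g, x) = cls \<Theta> V (k \<otimes> g', x')"
    using assms by (subst cls_eq_iff[OF \<Theta> V]) (auto simp: pq)
  then show ?thesis by (simp add: pq)
qed

lemma ind_gact_apply:
  assumes "V \<in> fd_spaces F" "k \<in> carrier G" "g \<in> carrier G" "x \<in> topspace (lev \<Theta> V)"
  shows "gact (ind_ob F e G H \<Theta>) k V (cls \<Theta> V (g, x)) = cls \<Theta> V (k \<otimes> g, x)"
  using ind_lift_apply[OF \<Theta> assms(1) ind_gact_respects[OF assms(1,2)], where p = "(g, x)"] assms
  by (simp add: ind_ob_def)

lemma ind_gact_joint:
  assumes V: "V \<in> fd_spaces F"
  shows "continuous_map (prod_topology (gtop G) (ind_lev e G H \<Theta> V)) (ind_lev e G H \<Theta> V)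
    (\<lambda>(k, y). gact (ind_ob F e G H \<Theta>) k V y)"
proof -
  have "continuous_map (prod_topology (gtop G) (ind_lev e G H \<Theta> V)) (ind_lev e G H \<Theta> V)
      (\<lambda>(k, y). ind_lift e G H \<Theta> V (\<lambda>(g, x). cls \<Theta> V (k \<otimes> g, x)) y)"
  proof (rule continuous_map_ind_lift_joint[OF \<Theta> V compact_G Hausdorff_G])
    let ?Z = "prod_topology (gtop G) (prod_topology (gtop G) (lev \<Theta> V))"
    have 1: "continuous_map ?Z (gtop G) fst" and 2: "continuous_map ?Z (gtop G) (\<lambda>z. fst (snd z))"
      and 3: "continuous_map ?Z (lev \<Theta> V) (\<lambda>z. snd (snd z))"
      by (auto intro: continuous_map_fst continuous_map_snd continuous_map_fst' continuous_map_snd')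
    have "continuous_map ?Z (prod_topology (gtop G) (lev \<Theta> V)) (\<lambda>z. (fst z \<otimes> fst (snd z), snd (snd z)))"
      by (intro continuous_map_pairedI continuous_map_joint[OF continuous_mult] 1 2 3)
    from continuous_map_compose[OF this continuous_map_cls[OF \<Theta> V]]
    show "continuous_map ?Z (ind_lev e G H \<Theta> V) (\<lambda>z. (\<lambda>(g, x). cls \<Theta> V (fst z \<otimes> g, x)) (snd z))"
      by (simp add: o_def case_prod_beta)
  qed (use ind_gact_respects[OF V] in simp)
  then show ?thesis using V by (simp add: ind_ob_def)
qed

lemma ind_gact_in:
  assumes k: "k \<in> carrier G"
  shows "gact (ind_ob F e G H \<Theta>) k \<in> spectrum_maps F (ind_ob F e G H \<Theta>) (ind_ob F e G H \<Theta>)"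
  unfolding spectrum_maps_iff
proof (intro conjI ballI)
  show "gact (ind_ob F e G H \<Theta>) k \<in> extensional (fd_spaces F)"
    by (simp add: ind_ob_def)
  fix V assume V: "V \<in> fd_spaces F"
  show "gact (ind_ob F e G H \<Theta>) k V \<in> extensional (topspace (lev (ind_ob F e G H \<Theta>) V))"
    using ind_lift_extensional[OF \<Theta> V] V by (simp add: ind_ob_def)
  have "continuous_map (ind_lev e G H \<Theta> V) (ind_lev e G H \<Theta> V) (\<lambda>y. gact (ind_ob F e G H \<Theta>) k V y)"
    by (rule continuous_map_joint[OF ind_gact_joint[OF V]]) (simp_all add: k)
  then show "continuous_map (lev (ind_ob F e G H \<Theta>) V) (lev (ind_ob F e G H \<Theta>) V) (gact (ind_ob F e G H \<Theta>) k V)"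
    by simp
  show "gact (ind_ob F e G H \<Theta>) k V (bas (ind_ob F e G H \<Theta>) V) = bas (ind_ob F e G H \<Theta>) V"
    using ind_gact_apply[OF V k one_closed bas_in[OF \<Theta> V]] cls_bas[OF \<Theta> V, of "k \<otimes> \<one>" \<one>] k by simp
next
  fix U V a y assume U: "U \<in> fd_spaces F" and V: "V \<in> fd_spaces F" and a: "a \<in> topspace (J1 F U V)"
    and yin: "y \<in> topspace (lev (ind_ob F e G H \<Theta>) U)"
  obtain g x where y: "g \<in> carrier G" "x \<in> topspace (lev \<Theta> U)" "y = cls \<Theta> U (g, x)"
    using ind_lev_cases[OF \<Theta> U yin] by blast
  show "gact (ind_ob F e G H \<Theta>) k V (act (ind_ob F e G H \<Theta>) U V a y) =
      act (ind_ob F e G H \<Theta>) U V a (gact (ind_ob F e G H \<Theta>) k U y)"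
    using ind_act_apply[OF U V a] ind_gact_apply U V k y spectrum_act_in[OF gspectrum_spectrum[OF \<Theta>] U V a] by simp
qed

lemma is_gspectrum_ind: "is_gspectrum F G (ind_ob F e G H \<Theta>)"
proof (rule is_gspectrumI[OF compact_Hausdorff_G is_spectrum_ind one_closed m_closed ind_gact_in])
  fix V assume V: "V \<in> fd_spaces F"
  show "continuous_map (prod_topology (gtop G) (lev (ind_ob F e G H \<Theta>) V)) (lev (ind_ob F e G H \<Theta>) V)
      (\<lambda>(g, x). gact (ind_ob F e G H \<Theta>) g V x)"
    using ind_gact_joint[OF V] by simp
  fix y assume yin: "y \<in> topspace (lev (ind_ob F e G H \<Theta>) V)"
  obtain g x where y: "g \<in> carrier G" "x \<in> topspace (lev \<Theta> V)" "y = cls \<Theta> V (g, x)"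
    using ind_lev_cases[OF \<Theta> V yin] by blast
  show "gact (ind_ob F e G H \<Theta>) \<one> V y = y"
    using ind_gact_apply[OF V one_closed y(1,2)] y by simp
  fix k l assume k: "k \<in> carrier G" "l \<in> carrier G"
  show "gact (ind_ob F e G H \<Theta>) (k \<otimes> l) V y =
      gact (ind_ob F e G H \<Theta>) k V (gact (ind_ob F e G H \<Theta>) l V y)"
    using ind_gact_apply[OF V _ _ y(2)] y k by (simp add: m_assoc)
qed

end

section \<open>Functoriality of induction\<close>

lemma ind_mor_apply:
  assumes \<Theta>: "is_gspectrum F K \<Theta>" and \<Psi>: "is_gspectrum F K \<Psi>" and f: "f \<in> gspectrum_maps F K \<Theta> \<Psi>"
    and V: "V \<in> fd_spaces F" and g: "g \<in> carrier G" and x: "x \<in> topspace (lev \<Theta> V)"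
  shows "ind_mor F e G H \<Theta> \<Psi> f V (cls \<Theta> V (g, x)) = cls \<Psi> V (g, f V x)"
proof -
  have "ind_lift e G H \<Theta> V (\<lambda>(g, x). cls \<Psi> V (g, f V x)) (cls \<Theta> V (g, x)) = cls \<Psi> V (g, f V x)"
    by (rule ind_lift_snd_apply[OF \<Theta> \<Psi> V V])
      (use f V g x in \<open>auto simp: gspectrum_maps_iff spectrum_maps_iff continuous_map_def Pi_iff\<close>)
  then show ?thesis using V by (simp add: ind_mor_def)
qed

lemma ind_mor_in:
  assumes \<Theta>: "is_gspectrum F K \<Theta>" and \<Psi>: "is_gspectrum F K \<Psi>" and f: "f \<in> gspectrum_maps F K \<Theta> \<Psi>"
  shows "ind_mor F e G H \<Theta> \<Psi> f \<in> gspectrum_maps F G (ind_ob F e G H \<Theta>) (ind_ob F e G H \<Psi>)"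
  unfolding gspectrum_maps_iff spectrum_maps_iff
proof (intro conjI ballI)
  have f': "f \<in> spectrum_maps F \<Theta> \<Psi>" using f by (simp add: gspectrum_maps_iff)
  note app = ind_mor_apply[OF \<Theta> \<Psi> f]
  show "ind_mor F e G H \<Theta> \<Psi> f \<in> extensional (fd_spaces F)" by (simp add: ind_mor_def)
  fix V assume V: "V \<in> fd_spaces F"
  show "ind_mor F e G H \<Theta> \<Psi> f V \<in> extensional (topspace (lev (ind_ob F e G H \<Theta>) V))"
    using ind_lift_extensional[OF \<Theta> V] V by (simp add: ind_mor_def)
  show "ind_mor F e G H \<Theta> \<Psi> f V (bas (ind_ob F e G H \<Theta>) V) = bas (ind_ob F e G H \<Psi>) V"
    using app[OF V one_closed bas_in[OF \<Theta> V]] f' V by (simp add: spectrum_maps_iff)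
  have "continuous_map (ind_lev e G H \<Theta> V) (ind_lev e G H \<Psi> V)
      (ind_lift e G H \<Theta> V (\<lambda>(g, x). cls \<Psi> V (g, f V x)))"
  proof (rule continuous_map_ind_lift[OF \<Theta> V])
    show "(\<lambda>(g, x). cls \<Psi> V (g, f V x)) p = (\<lambda>(g, x). cls \<Psi> V (g, f V x)) p'"
      if "p \<in> points \<Theta> V" "p' \<in> points \<Theta> V" "equivalent \<Theta> V p p'" for p p'
      by (rule ind_lift_snd_respects[OF \<Theta> \<Psi> V V _ _ _ that])
        (use f V in \<open>auto simp: gspectrum_maps_iff spectrum_maps_iff continuous_map_def Pi_iff\<close>)
    have "continuous_map (lev \<Theta> V) (lev \<Psi> V) (f V)" using f' V by (simp add: spectrum_maps_iff)
    from continuous_map_compose[OF continuous_map_snd this]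
    have "continuous_map (prod_topology (gtop G) (lev \<Theta> V)) (prod_topology (gtop G) (lev \<Psi> V)) (\<lambda>z. (fst z, f V (snd z)))"
      by (intro continuous_map_pairedI continuous_map_fst) (simp add: o_def)
    from continuous_map_compose[OF this continuous_map_cls[OF \<Psi> V]]
    show "continuous_map (prod_topology (gtop G) (lev \<Theta> V)) (ind_lev e G H \<Psi> V) (\<lambda>(g, x). cls \<Psi> V (g, f V x))"
      by (simp add: o_def case_prod_unfold)
  qed
  then show "continuous_map (lev (ind_ob F e G H \<Theta>) V) (lev (ind_ob F e G H \<Psi>) V) (ind_mor F e G H \<Theta> \<Psi> f V)"
    using V by (simp add: ind_mor_def)
next
  note app = ind_mor_apply[OF \<Theta> \<Psi> f]
  have f': "f \<in> spectrum_maps F \<Theta> \<Psi>" using f by (simp add: gspectrum_maps_iff)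
  fix U V a y assume U: "U \<in> fd_spaces F" and V: "V \<in> fd_spaces F" and a: "a \<in> topspace (J1 F U V)"
    and yin: "y \<in> topspace (lev (ind_ob F e G H \<Theta>) U)"
  obtain g x where y: "g \<in> carrier G" "x \<in> topspace (lev \<Theta> U)" "y = cls \<Theta> U (g, x)"
    using ind_lev_cases[OF \<Theta> U yin] by blast
  have x': "act \<Theta> U V a x \<in> topspace (lev \<Theta> V)" "f U x \<in> topspace (lev \<Psi> U)"
    using spectrum_act_in[OF gspectrum_spectrum[OF \<Theta>] U V a y(2)] spectrum_maps_in[OF f' U y(2)] by auto
  show "ind_mor F e G H \<Theta> \<Psi> f V (act (ind_ob F e G H \<Theta>) U V a y) =
      act (ind_ob F e G H \<Psi>) U V a (ind_mor F e G H \<Theta> \<Psi> f U y)"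
    using ind_act_apply[OF \<Theta> U V a y(1,2)] ind_act_apply[OF \<Psi> U V a y(1) x'(2)]
      app[OF V y(1) x'(1)] app[OF U y(1,2)] f' U V a y(2) by (simp add: y(3) spectrum_maps_iff)
next
  note app = ind_mor_apply[OF \<Theta> \<Psi> f]
  have f': "f \<in> spectrum_maps F \<Theta> \<Psi>" using f by (simp add: gspectrum_maps_iff)
  fix k V y assume k: "k \<in> carrier G" and V: "V \<in> fd_spaces F" and yin: "y \<in> topspace (lev (ind_ob F e G H \<Theta>) V)"
  obtain g x where y: "g \<in> carrier G" "x \<in> topspace (lev \<Theta> V)" "y = cls \<Theta> V (g, x)"
    using ind_lev_cases[OF \<Theta> V yin] by blast
  show "ind_mor F e G H \<Theta> \<Psi> f V (gact (ind_ob F e G H \<Theta>) k V y) =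
      gact (ind_ob F e G H \<Psi>) k V (ind_mor F e G H \<Theta> \<Psi> f V y)"
    using ind_gact_apply[OF \<Theta> V k y(1,2)] ind_gact_apply[OF \<Psi> V k y(1) spectrum_maps_in[OF f' V y(2)]]
      app[OF V _ y(2)] k y(1) by (simp add: y(3))
qed

lemma is_functor_ind:
  "is_functor (Sp_G F K :: (('g, 'u) gspectrum, 'u spectrum_map) model_data) (Sp_G F G)
     (ind_ob F e G H) (ind_mor F e G H)"
  unfolding is_functor_def Sp_G_simps
proof (intro conjI ballI)
  fix \<Theta> :: "('g, 'u) gspectrum" assume "\<Theta> \<in> {\<Theta>. is_gspectrum F K \<Theta>}"
  then have \<Theta>: "is_gspectrum F K \<Theta>" by simp
  then show "ind_ob F e G H \<Theta> \<in> {\<Theta>. is_gspectrum F G \<Theta>}" using is_gspectrum_ind by simp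
  have id: "spectrum_id F \<Theta> \<in> gspectrum_maps F K \<Theta> \<Theta>" using spectrum_id_in[OF \<Theta>] .
  show "ind_mor F e G H \<Theta> \<Theta> (spectrum_id F \<Theta>) = spectrum_id F (ind_ob F e G H \<Theta>)"
  proof (rule spectrum_maps_eqI)
    show "ind_mor F e G H \<Theta> \<Theta> (spectrum_id F \<Theta>) \<in> spectrum_maps F (ind_ob F e G H \<Theta>) (ind_ob F e G H \<Theta>)"
      "spectrum_id F (ind_ob F e G H \<Theta>) \<in> spectrum_maps F (ind_ob F e G H \<Theta>) (ind_ob F e G H \<Theta>)"
      using ind_mor_in[OF \<Theta> \<Theta> id] spectrum_id_in[OF is_gspectrum_ind[OF \<Theta>]] by (auto simp: gspectrum_maps_iff)
    fix V y assume V: "V \<in> fd_spaces F" and yin: "y \<in> topspace (lev (ind_ob F e G H \<Theta>) V)"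
    obtain g x where y: "g \<in> carrier G" "x \<in> topspace (lev \<Theta> V)" "y = cls \<Theta> V (g, x)"
      using ind_lev_cases[OF \<Theta> V yin] by blast
    show "ind_mor F e G H \<Theta> \<Theta> (spectrum_id F \<Theta>) V y = spectrum_id F (ind_ob F e G H \<Theta>) V y"
      using ind_mor_apply[OF \<Theta> \<Theta> id V y(1,2)] spectrum_id_apply[OF V yin] spectrum_id_apply[OF V y(2)]
      by (simp add: y(3))
  qed
next
  fix \<Theta> \<Psi> :: "('g, 'u) gspectrum" and f
  assume "\<Theta> \<in> {\<Theta>. is_gspectrum F K \<Theta>}" "\<Psi> \<in> {\<Theta>. is_gspectrum F K \<Theta>}" "f \<in> gspectrum_maps F K \<Theta> \<Psi>"
  then show "ind_mor F e G H \<Theta> \<Psi> f \<in> gspectrum_maps F G (ind_ob F e G H \<Theta>) (ind_ob F e G H \<Psi>)"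
    using ind_mor_in by simp
next
  fix \<Theta> \<Psi> \<Phi> :: "('g, 'u) gspectrum" and f f'
  assume "\<Theta> \<in> {\<Theta>. is_gspectrum F K \<Theta>}" "\<Psi> \<in> {\<Theta>. is_gspectrum F K \<Theta>}" "\<Phi> \<in> {\<Theta>. is_gspectrum F K \<Theta>}"
    and f: "f \<in> gspectrum_maps F K \<Theta> \<Psi>" and f': "f' \<in> gspectrum_maps F K \<Psi> \<Phi>"
  then have \<Theta>: "is_gspectrum F K \<Theta>" and \<Psi>: "is_gspectrum F K \<Psi>" and \<Phi>: "is_gspectrum F K \<Phi>" by auto
  have ff: "spectrum_comp F \<Theta> f' f \<in> gspectrum_maps F K \<Theta> \<Phi>" using gspectrum_comp_in[OF \<Theta> f f'] .
  have fm: "f \<in> spectrum_maps F \<Theta> \<Psi>" using f by (simp add: gspectrum_maps_iff)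
  show "ind_mor F e G H \<Theta> \<Phi> (spectrum_comp F \<Theta> f' f) =
      spectrum_comp F (ind_ob F e G H \<Theta>) (ind_mor F e G H \<Psi> \<Phi> f') (ind_mor F e G H \<Theta> \<Psi> f)"
  proof (rule spectrum_maps_eqI)
    show "ind_mor F e G H \<Theta> \<Phi> (spectrum_comp F \<Theta> f' f) \<in> spectrum_maps F (ind_ob F e G H \<Theta>) (ind_ob F e G H \<Phi>)"
      "spectrum_comp F (ind_ob F e G H \<Theta>) (ind_mor F e G H \<Psi> \<Phi> f') (ind_mor F e G H \<Theta> \<Psi> f)
        \<in> spectrum_maps F (ind_ob F e G H \<Theta>) (ind_ob F e G H \<Phi>)"
      using ind_mor_in[OF \<Theta> \<Phi> ff]
        gspectrum_comp_in[OF is_gspectrum_ind[OF \<Theta>] ind_mor_in[OF \<Theta> \<Psi> f] ind_mor_in[OF \<Psi> \<Phi> f']]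
      by (auto simp: gspectrum_maps_iff)
    fix V y assume V: "V \<in> fd_spaces F" and yin: "y \<in> topspace (lev (ind_ob F e G H \<Theta>) V)"
    obtain g x where y: "g \<in> carrier G" "x \<in> topspace (lev \<Theta> V)" "y = cls \<Theta> V (g, x)"
      using ind_lev_cases[OF \<Theta> V yin] by blast
    show "ind_mor F e G H \<Theta> \<Phi> (spectrum_comp F \<Theta> f' f) V y =
        spectrum_comp F (ind_ob F e G H \<Theta>) (ind_mor F e G H \<Psi> \<Phi> f') (ind_mor F e G H \<Theta> \<Psi> f) V y"
      unfolding spectrum_comp_apply[OF V yin]
      using ind_mor_apply[OF \<Theta> \<Phi> ff V y(1,2)] ind_mor_apply[OF \<Theta> \<Psi> f V y(1,2)]
        ind_mor_apply[OF \<Psi> \<Phi> f' V y(1) spectrum_maps_in[OF fm V y(2)]]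
      by (simp add: y(3) spectrum_comp_apply[OF V y(2)])
  qed
qed

section \<open>Restriction to the subgroup\<close>

lemma res_ob_simps [simp]:
  "lev (res_ob H \<Psi>) = lev \<Psi>" "bas (res_ob H \<Psi>) = bas \<Psi>" "act (res_ob H \<Psi>) = act \<Psi>"
  "h \<in> H \<Longrightarrow> gact (res_ob H \<Psi>) h = gact \<Psi> h"
  by (simp_all add: res_ob_def)

lemma spectrum_maps_res:
  "spectrum_maps F \<Theta> (res_ob H \<Psi>) = spectrum_maps F \<Theta> \<Psi>"
  "spectrum_maps F (res_ob H \<Theta>) \<Psi> = spectrum_maps F \<Theta> \<Psi>"
  by (auto simp: spectrum_maps_iff)

lemma spectrum_comp_res: "spectrum_comp F (res_ob H \<Theta>) = spectrum_comp F \<Theta>"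
  by (intro ext) (simp add: spectrum_comp_def)

lemma spectrum_id_res: "spectrum_id F (res_ob H \<Theta>) = spectrum_id F \<Theta>"
  by (simp add: spectrum_id_def)

lemma is_gspectrum_res:
  assumes \<Psi>: "is_gspectrum F G \<Psi>"
  shows "is_gspectrum F K (res_ob H \<Psi>)"
proof (rule is_gspectrumI[OF compact_Hausdorff_K])
  show "is_spectrum F (res_ob H \<Psi>)"
    using gspectrum_spectrum[OF \<Psi>] by (simp add: is_spectrum_def lev_maps_def)
  fix V assume V: "V \<in> fd_spaces F"
  have "continuous_map (prod_topology (subtopology (gtop G) H) (lev \<Psi> V)) (lev \<Psi> V) (\<lambda>(g, x). gact \<Psi> g V x)"
    using continuous_map_from_subtopology[OF gact_joint[OF compact_Hausdorff_G \<Psi> V], of "H \<times> topspace (lev \<Psi> V)"]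
    by (simp add: subtopology_Times)
  then have "continuous_map (prod_topology (subtopology (gtop G) H) (lev \<Psi> V)) (lev \<Psi> V)
      (\<lambda>(g, x). gact (res_ob H \<Psi>) g V x)"
    by (rule continuous_map_eq) auto
  then show "continuous_map (prod_topology (gtop K) (lev (res_ob H \<Psi>) V)) (lev (res_ob H \<Psi>) V)
      (\<lambda>(g, x). gact (res_ob H \<Psi>) g V x)"
    by (simp only: K_simps res_ob_simps)
qed (simp_all add: H_closed H_in gact_spectrum_map[OF \<Psi>] gact_one[OF \<Psi>] gact_mult[OF \<Psi>] spectrum_maps_res)

lemma gspectrum_maps_res:
  "f \<in> gspectrum_maps F G \<Theta> \<Psi> \<Longrightarrow> f \<in> gspectrum_maps F K (res_ob H \<Theta>) (res_ob H \<Psi>)"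
  by (simp add: gspectrum_maps_iff spectrum_maps_res H_in)

lemma is_functor_res:
  "is_functor (Sp_G F G) (Sp_G F K :: (('g, 'u) gspectrum, 'u spectrum_map) model_data) (res_ob H) res_mor"
  unfolding is_functor_def Sp_G_simps res_mor_def
  by (auto simp: is_gspectrum_res gspectrum_maps_res spectrum_comp_res spectrum_id_res)

section \<open>The adjunction bijection\<close>

definition transpose_down :: "('g, 'u) gspectrum \<Rightarrow> ('g, 'u) gspectrum \<Rightarrow> 'u spectrum_map \<Rightarrow> 'u spectrum_map" where
  "transpose_down \<Theta> \<Psi> f = (\<lambda>V \<in> fd_spaces F. \<lambda>x \<in> topspace (lev \<Theta> V). f V (cls \<Theta> V (\<one>, x)))"

text \<open>The only possible \<open>G\<close>-map with transpose \<open>f\<close>: equivariance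
  forces \<open>[g, x] = g [1, x]\<close> to go to \<open>g (f x)\<close>.\<close>

definition transpose_up :: "('g, 'u) gspectrum \<Rightarrow> ('g, 'u) gspectrum \<Rightarrow> 'u spectrum_map \<Rightarrow> 'u spectrum_map" where
  "transpose_up \<Theta> \<Psi> f = (\<lambda>V \<in> fd_spaces F. ind_lift e G H \<Theta> V (\<lambda>(g, x). gact \<Psi> g V (f V x)))"

lemma transpose_down_apply:
  "\<lbrakk>V \<in> fd_spaces F; x \<in> topspace (lev \<Theta> V)\<rbrakk> \<Longrightarrow> transpose_down \<Theta> \<Psi> f V x = f V (cls \<Theta> V (\<one>, x))"
  by (simp add: transpose_down_def)

context
  fixes \<Theta> \<Psi> :: "('g, 'u) gspectrum"
  assumes \<Theta>: "is_gspectrum F K \<Theta>" and \<Psi>: "is_gspectrum F G \<Psi>"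
begin

text \<open>Equivariance over \<open>H\<close> comes from
  \<open>h [1, x] = [h, x] = [1, h x]\<close>; the remaining conditions hold because
  \<open>x \<mapsto> [1, x]\<close> is continuous, based and compatible with the structure
  maps.\<close>

lemma transpose_down_in:
  assumes f: "f \<in> gspectrum_maps F G (ind_ob F e G H \<Theta>) \<Psi>"
  shows "transpose_down \<Theta> \<Psi> f \<in> gspectrum_maps F K \<Theta> (res_ob H \<Psi>)"
  unfolding gspectrum_maps_iff spectrum_maps_iff
proof (intro conjI ballI)
  have fm: "f \<in> spectrum_maps F (ind_ob F e G H \<Theta>) \<Psi>" using f by (simp add: gspectrum_maps_iff)
  show "transpose_down \<Theta> \<Psi> f \<in> extensional (fd_spaces F)" by (simp add: transpose_down_def)
  fix V assume V: "V \<in> fd_spaces F"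
  show "transpose_down \<Theta> \<Psi> f V \<in> extensional (topspace (lev \<Theta> V))" using V by (simp add: transpose_down_def)
  show "transpose_down \<Theta> \<Psi> f V (bas \<Theta> V) = bas (res_ob H \<Psi>) V"
    using fm V by (simp add: transpose_down_apply[OF V bas_in[OF \<Theta> V]] spectrum_maps_iff)
  have "continuous_map (lev \<Theta> V) (prod_topology (gtop G) (lev \<Theta> V)) (\<lambda>x. (\<one>, x))"
    by (intro continuous_map_pairedI) auto
  moreover have "continuous_map (ind_lev e G H \<Theta> V) (lev \<Psi> V) (f V)"
    using fm V by (simp add: spectrum_maps_iff)
  ultimately have "continuous_map (lev \<Theta> V) (lev \<Psi> V) (f V \<circ> (cls \<Theta> V \<circ> (\<lambda>x. (\<one>, x))))"
    by (rule continuous_map_compose[OF continuous_map_compose[OF _ continuous_map_cls[OF \<Theta> V]]])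
  then show "continuous_map (lev \<Theta> V) (lev (res_ob H \<Psi>) V) (transpose_down \<Theta> \<Psi> f V)"
    unfolding res_ob_simps by (rule continuous_map_eq) (simp add: transpose_down_apply V)
next
  have fm: "f \<in> spectrum_maps F (ind_ob F e G H \<Theta>) \<Psi>" using f by (simp add: gspectrum_maps_iff)
  fix U V a x assume U: "U \<in> fd_spaces F" and V: "V \<in> fd_spaces F" and a: "a \<in> topspace (J1 F U V)"
    and x: "x \<in> topspace (lev \<Theta> U)"
  have "f V (act (ind_ob F e G H \<Theta>) U V a (cls \<Theta> U (\<one>, x))) = act \<Psi> U V a (f U (cls \<Theta> U (\<one>, x)))"
    using fm U V a cls_in[OF \<Theta> U one_closed x] by (simp add: spectrum_maps_iff)
  then show "transpose_down \<Theta> \<Psi> f V (act \<Theta> U V a x) = act (res_ob H \<Psi>) U V a (transpose_down \<Theta> \<Psi> f U x)"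
    using spectrum_act_in[OF gspectrum_spectrum[OF \<Theta>] U V a x]
    by (simp add: transpose_down_apply U V x ind_act_apply[OF \<Theta> U V a one_closed x])
next
  fix h V x assume "h \<in> carrier K" and V: "V \<in> fd_spaces F" and x: "x \<in> topspace (lev \<Theta> V)"
  then have h: "h \<in> H" by simp
  have "f V (gact (ind_ob F e G H \<Theta>) h V (cls \<Theta> V (\<one>, x))) = gact \<Psi> h V (f V (cls \<Theta> V (\<one>, x)))"
    using f V H_in[OF h] cls_in[OF \<Theta> V one_closed x] by (simp add: gspectrum_maps_iff)
  then show "transpose_down \<Theta> \<Psi> f V (gact \<Theta> h V x) = gact (res_ob H \<Psi>) h V (transpose_down \<Theta> \<Psi> f V x)"
    by (simp add: transpose_down_apply V x h H_in hact_in[OF \<Theta> V] ind_gact_apply[OF \<Theta> V] cls_hact[OF \<Theta> V])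
qed

context
  fixes f
  assumes f: "f \<in> gspectrum_maps F K \<Theta> (res_ob H \<Psi>)"
begin

lemma
  assumes V: "V \<in> fd_spaces F"
  shows up_in: "x \<in> topspace (lev \<Theta> V) \<Longrightarrow> f V x \<in> topspace (lev \<Psi> V)"
    and up_bas: "f V (bas \<Theta> V) = bas \<Psi> V"
    and up_hact: "\<lbrakk>h \<in> H; x \<in> topspace (lev \<Theta> V)\<rbrakk> \<Longrightarrow> f V (gact \<Theta> h V x) = gact \<Psi> h V (f V x)"
    and up_continuous: "continuous_map (lev \<Theta> V) (lev \<Psi> V) (f V)"
proof -
  have fm: "f \<in> spectrum_maps F \<Theta> \<Psi>" using f by (simp add: gspectrum_maps_iff spectrum_maps_res)
  then show "x \<in> topspace (lev \<Theta> V) \<Longrightarrow> f V x \<in> topspace (lev \<Psi> V)" using V by (rule spectrum_maps_in)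
  show "f V (bas \<Theta> V) = bas \<Psi> V" "continuous_map (lev \<Theta> V) (lev \<Psi> V) (f V)"
    using fm V by (simp_all add: spectrum_maps_iff)
  show "\<lbrakk>h \<in> H; x \<in> topspace (lev \<Theta> V)\<rbrakk> \<Longrightarrow> f V (gact \<Theta> h V x) = gact \<Psi> h V (f V x)"
    using f V by (simp add: gspectrum_maps_iff)
qed

text \<open>For a translation by \<open>h\<close>, equivariance of \<open>f\<close> gives
  \<open>g (f (h x')) = (g h) (f x')\<close>; for the collapse both sides are the base point, which
  \<open>f\<close> and the action preserve.\<close>

lemma transpose_up_respects:
  assumes V: "V \<in> fd_spaces F" and "p \<in> points \<Theta> V" "p' \<in> points \<Theta> V" "equivalent \<Theta> V p p'"
  shows "(\<lambda>(g, x). gact \<Psi> g V (f V x)) p = (\<lambda>(g, x). gact \<Psi> g V (f V x)) p'"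
proof -
  obtain g x g' x' where pq: "p = (g, x)" "p' = (g', x')" by (cases p, cases p')
  then have g: "g \<in> carrier G" "g' \<in> carrier G" and x: "x \<in> topspace (lev \<Theta> V)" "x' \<in> topspace (lev \<Theta> V)"
    using assms(2,3) by auto
  consider "x = bas \<Theta> V" "x' = bas \<Theta> V" | h where "h \<in> H" "g' = g \<otimes> h" "x = gact \<Theta> h V x'"
    using assms(4) by (auto simp: equivalent_def pq)
  then show ?thesis
  proof cases
    case 1
    then show ?thesis using g by (simp add: pq up_bas V gact_bas[OF \<Psi>])
  next
    case 2
    then show ?thesis using g x by (simp add: pq up_hact up_in V H_in gact_mult[OF \<Psi>])
  qed
qed

lemma transpose_up_apply:
  assumes "V \<in> fd_spaces F" "g \<in> carrier G" "x \<in> topspace (lev \<Theta> V)"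
  shows "transpose_up \<Theta> \<Psi> f V (cls \<Theta> V (g, x)) = gact \<Psi> g V (f V x)"
  using ind_lift_apply[OF \<Theta> assms(1) transpose_up_respects[OF assms(1)], where p = "(g, x)"] assms
  by (simp add: transpose_up_def)

lemma transpose_up_in: "transpose_up \<Theta> \<Psi> f \<in> gspectrum_maps F G (ind_ob F e G H \<Theta>) \<Psi>"
  unfolding gspectrum_maps_iff spectrum_maps_iff
proof (intro conjI ballI)
  show "transpose_up \<Theta> \<Psi> f \<in> extensional (fd_spaces F)" by (simp add: transpose_up_def)
  fix V assume V: "V \<in> fd_spaces F"
  show "transpose_up \<Theta> \<Psi> f V \<in> extensional (topspace (lev (ind_ob F e G H \<Theta>) V))"
    using ind_lift_extensional[OF \<Theta> V] V by (simp add: transpose_up_def)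
  show "transpose_up \<Theta> \<Psi> f V (bas (ind_ob F e G H \<Theta>) V) = bas \<Psi> V"
    using transpose_up_apply[OF V one_closed bas_in[OF \<Theta> V]] by (simp add: up_bas V gact_bas[OF \<Psi>])
  have "continuous_map (ind_lev e G H \<Theta> V) (lev \<Psi> V) (ind_lift e G H \<Theta> V (\<lambda>(g, x). gact \<Psi> g V (f V x)))"
  proof (rule continuous_map_ind_lift[OF \<Theta> V transpose_up_respects[OF V]])
    have "continuous_map (prod_topology (gtop G) (lev \<Theta> V)) (lev \<Psi> V) (\<lambda>z. f V (snd z))"
      using continuous_map_compose[OF continuous_map_snd up_continuous[OF V]] by (simp add: o_def)
    from continuous_map_joint[OF gact_joint[OF compact_Hausdorff_G \<Psi> V] continuous_map_fst this]
    show "continuous_map (prod_topology (gtop G) (lev \<Theta> V)) (lev \<Psi> V) (\<lambda>(g, x). gact \<Psi> g V (f V x))"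
      by (simp add: case_prod_unfold)
  qed
  then show "continuous_map (lev (ind_ob F e G H \<Theta>) V) (lev \<Psi> V) (transpose_up \<Theta> \<Psi> f V)"
    using V by (simp add: transpose_up_def)
next
  fix U V a y assume U: "U \<in> fd_spaces F" and V: "V \<in> fd_spaces F" and a: "a \<in> topspace (J1 F U V)"
    and yin: "y \<in> topspace (lev (ind_ob F e G H \<Theta>) U)"
  obtain g x where y: "g \<in> carrier G" "x \<in> topspace (lev \<Theta> U)" "y = cls \<Theta> U (g, x)"
    using ind_lev_cases[OF \<Theta> U yin] by blast
  have "f V (act \<Theta> U V a x) = act \<Psi> U V a (f U x)"
    using f U V a y(2) by (simp add: gspectrum_maps_iff spectrum_maps_iff)
  then show "transpose_up \<Theta> \<Psi> f V (act (ind_ob F e G H \<Theta>) U V a y) = act \<Psi> U V a (transpose_up \<Theta> \<Psi> f U y)"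
    using spectrum_act_in[OF gspectrum_spectrum[OF \<Theta>] U V a y(2)] gact_act[OF \<Psi> y(1) U V a up_in[OF U y(2)]]
    by (simp add: y ind_act_apply[OF \<Theta> U V a] transpose_up_apply U V)
next
  fix k V y assume k: "k \<in> carrier G" and V: "V \<in> fd_spaces F" and yin: "y \<in> topspace (lev (ind_ob F e G H \<Theta>) V)"
  obtain g x where y: "g \<in> carrier G" "x \<in> topspace (lev \<Theta> V)" "y = cls \<Theta> V (g, x)"
    using ind_lev_cases[OF \<Theta> V yin] by blast
  show "transpose_up \<Theta> \<Psi> f V (gact (ind_ob F e G H \<Theta>) k V y) = gact \<Psi> k V (transpose_up \<Theta> \<Psi> f V y)"
    using k y(1,2) up_in[OF V y(2)] by (simp add: y(3) ind_gact_apply[OF \<Theta> V] transpose_up_apply V gact_mult[OF \<Psi>])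
qed

lemma transpose_down_up: "transpose_down \<Theta> \<Psi> (transpose_up \<Theta> \<Psi> f) = f"
proof (rule spectrum_maps_eqI)
  show "transpose_down \<Theta> \<Psi> (transpose_up \<Theta> \<Psi> f) \<in> spectrum_maps F \<Theta> (res_ob H \<Psi>)"
    "f \<in> spectrum_maps F \<Theta> (res_ob H \<Psi>)"
    using transpose_down_in[OF transpose_up_in] f by (simp_all add: gspectrum_maps_iff)
  show "transpose_down \<Theta> \<Psi> (transpose_up \<Theta> \<Psi> f) V x = f V x"
    if "V \<in> fd_spaces F" "x \<in> topspace (lev \<Theta> V)" for V x
    using that by (simp add: transpose_down_apply transpose_up_apply gact_one[OF \<Psi>] up_in)
qed

end

text \<open>Every class \<open>[g, x]\<close> is \<open>g [1, x]\<close>, so a \<open>G\<close>-map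
  is determined by its values on the classes \<open>[1, x]\<close>.\<close>

lemma transpose_up_down:
  assumes f: "f \<in> gspectrum_maps F G (ind_ob F e G H \<Theta>) \<Psi>"
  shows "transpose_up \<Theta> \<Psi> (transpose_down \<Theta> \<Psi> f) = f"
proof (rule spectrum_maps_eqI)
  show "transpose_up \<Theta> \<Psi> (transpose_down \<Theta> \<Psi> f) \<in> spectrum_maps F (ind_ob F e G H \<Theta>) \<Psi>"
    "f \<in> spectrum_maps F (ind_ob F e G H \<Theta>) \<Psi>"
    using transpose_up_in[OF transpose_down_in[OF f]] f by (simp_all add: gspectrum_maps_iff)
  fix V y assume V: "V \<in> fd_spaces F" and yin: "y \<in> topspace (lev (ind_ob F e G H \<Theta>) V)"
  obtain g x where y: "g \<in> carrier G" "x \<in> topspace (lev \<Theta> V)" "y = cls \<Theta> V (g, x)"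
    using ind_lev_cases[OF \<Theta> V yin] by blast
  have "f V (gact (ind_ob F e G H \<Theta>) g V (cls \<Theta> V (\<one>, x))) = gact \<Psi> g V (f V (cls \<Theta> V (\<one>, x)))"
    using f V y(1) cls_in[OF \<Theta> V one_closed y(2)] by (simp add: gspectrum_maps_iff)
  then show "transpose_up \<Theta> \<Psi> (transpose_down \<Theta> \<Psi> f) V y = f V y"
    by (simp add: y transpose_up_apply[OF transpose_down_in[OF f]] V transpose_down_apply ind_gact_apply[OF \<Theta> V])
qed

lemma bij_betw_transpose_down:
  "bij_betw (transpose_down \<Theta> \<Psi>) (gspectrum_maps F G (ind_ob F e G H \<Theta>) \<Psi>) (gspectrum_maps F K \<Theta> (res_ob H \<Psi>))"
  by (rule bij_betw_byWitness[where f' = "transpose_up \<Theta> \<Psi>"])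
    (auto simp: transpose_up_down transpose_down_up transpose_down_in transpose_up_in)

end

text \<open>Both sides send \<open>x\<close> to \<open>b (f [1, a x])\<close>, since the induced map
  of \<open>a\<close> takes \<open>[1, x]\<close> to \<open>[1, a x]\<close>.\<close>

lemma transpose_down_natural:
  assumes \<Theta>: "is_gspectrum F K \<Theta>" and \<Theta>': "is_gspectrum F K \<Theta>'"
    and \<Psi>: "is_gspectrum F G \<Psi>" and \<Psi>': "is_gspectrum F G \<Psi>'"
    and a: "a \<in> gspectrum_maps F K \<Theta>' \<Theta>" and f: "f \<in> gspectrum_maps F G (ind_ob F e G H \<Theta>) \<Psi>"
    and b: "b \<in> gspectrum_maps F G \<Psi> \<Psi>'"
  shows "transpose_down \<Theta>' \<Psi>' (spectrum_comp F (ind_ob F e G H \<Theta>') b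
      (spectrum_comp F (ind_ob F e G H \<Theta>') f (ind_mor F e G H \<Theta>' \<Theta> a)))
    = spectrum_comp F \<Theta>' b (spectrum_comp F \<Theta>' (transpose_down \<Theta> \<Psi> f) a)" (is "?l = ?r")
proof (rule spectrum_family_eqI[where \<Theta> = \<Theta>' and F = F])
  have am: "a \<in> spectrum_maps F \<Theta>' \<Theta>" using a by (simp add: gspectrum_maps_iff)
  fix V x assume V: "V \<in> fd_spaces F" and x: "x \<in> topspace (lev \<Theta>' V)"
  show "?l V x = ?r V x"
    using cls_in[OF \<Theta>' V one_closed x] spectrum_maps_in[OF am V x]
    by (simp add: transpose_down_apply V x spectrum_comp_apply ind_mor_apply[OF \<Theta>' \<Theta> a V one_closed x])
qed (auto simp: transpose_down_def spectrum_comp_extensional)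

lemma adjoint_pair_ind_res:
  "adjoint_pair (Sp_G F K :: (('g, 'u) gspectrum, 'u spectrum_map) model_data) (Sp_G F G)
     (ind_ob F e G H) (ind_mor F e G H) (res_ob H) res_mor"
  unfolding adjoint_pair_def
proof (intro conjI is_category_Sp_G is_functor_ind is_functor_res exI[of _ transpose_down] ballI)
  fix \<Theta> \<Psi> :: "('g, 'u) gspectrum"
  assume "\<Theta> \<in> Ob (Sp_G F K)" "\<Psi> \<in> Ob (Sp_G F G)"
  then show "bij_betw (transpose_down \<Theta> \<Psi>) (Mor (Sp_G F G) (ind_ob F e G H \<Theta>) \<Psi>) (Mor (Sp_G F K) \<Theta> (res_ob H \<Psi>))"
    using bij_betw_transpose_down by (simp add: Sp_G_simps)
qed (simp add: Sp_G_simps res_mor_def transpose_down_natural)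

section \<open>Preservation of weak equivalences, fibrations and cofibrations\<close>

lemma pi_isomorphism_res:
  fixes \<Theta> \<Psi> :: "('g, 'u) gspectrum"
  shows "pi_isomorphism F (res_ob H \<Theta>) (res_ob H \<Psi>) f \<longleftrightarrow> pi_isomorphism F \<Theta> \<Psi> f"
proof -
  \<comment> \<open>Equality is needed for functions, because \<open>spi_stab\<close> hands
    \<open>stab_map\<close> on without its last arguments.\<close>
  have "stab_map F (res_ob H \<Phi>) = stab_map F \<Phi>" for \<Phi> :: "('g, 'u) gspectrum"
    by (intro ext) (simp add: stab_map_def cong: option.case_cong)
  then have "spi_level F k (res_ob H \<Phi>) = spi_level F k \<Phi>" "spi_stab F k (res_ob H \<Phi>) = spi_stab F k \<Phi>"
    for k and \<Phi> :: "('g, 'u) gspectrum"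
    by (intro ext, simp add: spi_level_def spi_stab_def)+
  then have "spi F k (res_ob H \<Phi>) = spi F k \<Phi>" "spi_map F k (res_ob H \<Phi>) f = spi_map F k \<Phi> f"
    for k and \<Phi> :: "('g, 'u) gspectrum"
    by (simp add: spi_def, intro ext, simp add: spi_map_def)
  then show ?thesis by (simp add: pi_isomorphism_def)
qed

lemma stable_fibration_res:
  fixes \<Theta> \<Psi> :: "('g, 'u) gspectrum"
  shows "stable_fibration F (res_ob H \<Theta>) (res_ob H \<Psi>) f \<longleftrightarrow> stable_fibration F \<Theta> \<Psi> f"
proof -
  have "adj_struct (res_ob H \<Phi>) = adj_struct \<Phi>" "loops (res_ob H \<Phi>) = loops \<Phi>" for \<Phi> :: "('g, 'u) gspectrum"
    by (intro ext, simp add: adj_struct_def loops_def)+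
  then show ?thesis by (simp add: stable_fibration_def)
qed

lemma quillen_adjunction_ind_res:
  "quillen_adjunction (Sp_G F K :: (('g, 'u) gspectrum, 'u spectrum_map) model_data) (Sp_G F G)
     (ind_ob F e G H) (ind_mor F e G H) (res_ob H) res_mor"
  unfolding quillen_adjunction_def
proof (intro conjI ballI adjoint_pair_ind_res)
  let ?C = "Sp_G F K :: (('g, 'u) gspectrum, 'u spectrum_map) model_data"
    and ?D = "Sp_G F G :: (('g, 'u) gspectrum, 'u spectrum_map) model_data"
  have Fib: "res_mor X Y p \<in> Fib ?C (res_ob H X) (res_ob H Y)" if "p \<in> Fib ?D X Y" for X Y p
    using that by (simp add: Sp_G_simps res_mor_def stable_fibration_res gspectrum_maps_res)
  have Weq: "res_mor X Y p \<in> Weq ?C (res_ob H X) (res_ob H Y)" if "p \<in> Weq ?D X Y" for X Y p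
    using that by (simp add: Sp_G_simps res_mor_def pi_isomorphism_res gspectrum_maps_res)
  show "res_mor X Y p \<in> Fib ?C (res_ob H X) (res_ob H Y)" if "p \<in> Fib ?D X Y" for X Y p
    using Fib that .
  show "res_mor X Y p \<in> Fib ?C (res_ob H X) (res_ob H Y) \<inter> Weq ?C (res_ob H X) (res_ob H Y)"
    if "p \<in> Fib ?D X Y \<inter> Weq ?D X Y" for X Y p
    using Fib Weq that by blast
  fix A B i assume A: "A \<in> Ob ?C" and B: "B \<in> Ob ?C" and i: "i \<in> Cof ?C A B"
  have iM: "i \<in> Mor ?C A B" using i by (simp add: Sp_G_simps)
  have "ind_mor F e G H A B i \<in> Mor ?D (ind_ob F e G H A) (ind_ob F e G H B)"
    using is_functor_ind A B iM unfolding is_functor_def by blast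
  moreover have "has_llp ?D (ind_ob F e G H A) (ind_ob F e G H B) (ind_mor F e G H A B i) X Y p"
    if X: "X \<in> Ob ?D" and Y: "Y \<in> Ob ?D" and p: "p \<in> Fib ?D X Y \<inter> Weq ?D X Y" for X Y p
  proof (rule has_llp_left_adjoint[OF adjoint_pair_ind_res A B iM X Y])
    show "p \<in> Mor ?D X Y" using p by (simp add: Sp_G_simps)
    have "res_ob H X \<in> Ob ?C" "res_ob H Y \<in> Ob ?C"
      using is_functor_res X Y unfolding is_functor_def by blast+
    moreover have "res_mor X Y p \<in> Fib ?C (res_ob H X) (res_ob H Y) \<inter> Weq ?C (res_ob H X) (res_ob H Y)"
      using Fib Weq p by blast
    ultimately show "has_llp ?C A B i (res_ob H X) (res_ob H Y) (res_mor X Y p)"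
      using i unfolding Sp_G_simps(7) by blast
  qed
  ultimately show "ind_mor F e G H A B i \<in> Cof ?D (ind_ob F e G H A) (ind_ob F e G H B)"
    unfolding Sp_G_simps(7) by (simp add: Sp_G_simps(2))
qed

end

theorem proposition7p5:
  fixes F :: "complex set"
    and G :: "'g topgroup" and n :: nat and A :: "'g chart set"
    and H :: "'g set"
    and e :: "'g \<times> 'u \<Rightarrow> 'u"
  assumes "F = \<real> \<or> F = UNIV"
    and "lie_group G n A" and "compact_space (gtop G)"
    and "subgroup H G" and "closedin (gtop G) H"
    and "inj_on e (carrier G \<times> UNIV)"
  shows "quillen_adjunction
           (Sp_G F (subgroup_of G H) :: (('g, 'u) gspectrum, 'u spectrum_map) model_data)
           (Sp_G F G)
           (ind_ob F e G H) (ind_mor F e G H)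
           (res_ob H) res_mor"
proof -
  have "spectrum_induction F G H e"
    by (rule spectrum_induction.intro) (use assms in \<open>simp_all add: lie_group_def\<close>)
  then interpret spectrum_induction F G H e .
  show ?thesis by (rule quillen_adjunction_ind_res)
qed

end
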